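(* Let $R$ be a unital full subring of $AP^+$, let $S:=AP$ with the involution $f^*(y)=\overline{f(y)}$ ($y\in\mathbb R$), let $G:=\mathbb R$, and let $\iota:=w:\mathrm{inv}\,AP\to\mathbb R$ be the average winding number. Then the following hold: (A1) $R$ is a commutative integral domain with identity. (A2) $S$ is a unital commutative complex semisimple Banach algebra with involution $\cdot^*$, and $R\subset S$. (A3) (I1) $\iota(ab)=\iota(a)+\iota(b)$ for all $a,b\in\mathrm{inv}\,S$; (I2) $\iota(a^* )=-\iota(a)$ for all $a\in\mathrm{inv}\,S$; (I3) $\iota$ is locally constant, i.e. continuous when $G$ is given the discrete topology. (A4) An element $x\in R\cap\mathrm{inv}\,S$ is invertible as an element of $R$ if and only if $\iota(x)=0$.
   Context: $AP$ (almost periodic functions) is the smallest closed subalgebra of $L^\infty(\mathbb R)$ (sup norm) containing all functions $y\mapsto e^{i\lambda y}$, $\lambda\in\mathbb R$. For $f\in AP$ and $\lambda\in\mathbb R$ put $f_\lambda=\lim_{N\to\infty}\frac1{2N}\int_{-N}^N e^{-i\lambda y}f(y)\,dy$, and let $\sigma(f)=\{\lambda\in\mathbb R: f_\lambda\ne0\}$ be the Bohr–Fourier spectrum. $AP^+=\{f\in AP:\sigma(f)\subset[0,\infty)\}$. $\mathrm{inv}\,S$ is the set of invertible elements of $S$. For $f\in\mathrm{inv}\,AP$, the average winding number is $w(f)=\lim_{T\to\infty}\frac1{2T}\big(\arg f(T)-\arg f(-T)\big)$, where $\arg f$ is a continuous argument of $f$ on $\mathbb R$ (the limit exists). A subring $R_1$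 of a commutative unital ring $R_2$ is full if every $x\in R_1$ that is invertible in $R_2$ is invertible in $R_1$. *)

theory Defs
  imports "HOL-Probability.Essential_Supremum" "HOL-Algebra.QuotRing" "HOL-Algebra.Subrings"
begin

subsection \<open>Banach algebras with involution and full subrings\<close>

definition complex_ring :: "complex ring"
  where "complex_ring = \<lparr>carrier = UNIV, mult = (*), one = 1, zero = 0, add = (+)\<rparr>"

record 'a star_algebra = "(complex, 'a) module" +
  alg_norm :: "'a \<Rightarrow> real"
  alg_star :: "'a \<Rightarrow> 'a"

text \<open>The guard is there because \<^locale>\<open>Metric_space\<close> demands nonnegativity and symmetry
  on the whole type, where the ring operations are arbitrary outside the carrier.\<close>

definition alg_dist :: "('a, 'b) star_algebra_scheme \<Rightarrow> 'a \<Rightarrow> 'a \<Rightarrow> real"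
  where "alg_dist S x y =
    (if x \<in> carrier S \<and> y \<in> carrier S then alg_norm S (x \<ominus>\<^bsub>S\<^esub> y) else 0)"

definition norm_topology :: "('a, 'b) star_algebra_scheme \<Rightarrow> 'a topology"
  where "norm_topology S = Metric_space.mtopology (carrier S) (alg_dist S)"

text \<open>Unital commutative complex Banach algebras with an involution. The locale
  \<^locale>\<open>algebra\<close> already provides the commutative unital complex algebra structure.\<close>

locale comm_banach_star_algebra = algebra complex_ring S
  for S :: "('a, 'b) star_algebra_scheme" (structure) +
  assumes norm_nonneg: "x \<in> carrier S \<Longrightarrow> 0 \<le> alg_norm S x"
    and norm_eq_zero: "x \<in> carrier S \<Longrightarrow> alg_norm S x = 0 \<longleftrightarrow> x = \<zero>"
    and norm_triangle: "\<lbrakk>x \<in> carrier S; y \<in> carrier S\<rbrakk>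
          \<Longrightarrow> alg_norm S (x \<oplus> y) \<le> alg_norm S x + alg_norm S y"
    and norm_smult: "x \<in> carrier S \<Longrightarrow> alg_norm S (c \<odot> x) = cmod c * alg_norm S x"
    and norm_mult: "\<lbrakk>x \<in> carrier S; y \<in> carrier S\<rbrakk>
          \<Longrightarrow> alg_norm S (x \<otimes> y) \<le> alg_norm S x * alg_norm S y"
    and norm_one: "alg_norm S \<one> = 1"
    and complete: "Metric_space.mcomplete (carrier S) (alg_dist S)"
    and star_closed: "x \<in> carrier S \<Longrightarrow> alg_star S x \<in> carrier S"
    and star_star: "x \<in> carrier S \<Longrightarrow> alg_star S (alg_star S x) = x"
    and star_add: "\<lbrakk>x \<in> carrier S; y \<in> carrier S\<rbrakk>
          \<Longrightarrow> alg_star S (x \<oplus> y) = alg_star S x \<oplus> alg_star S y"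
    and star_smult: "x \<in> carrier S \<Longrightarrow> alg_star S (c \<odot> x) = cnj c \<odot> alg_star S x"
    and star_mult: "\<lbrakk>x \<in> carrier S; y \<in> carrier S\<rbrakk>
          \<Longrightarrow> alg_star S (x \<otimes> y) = alg_star S y \<otimes> alg_star S x"

text \<open>Semisimplicity of a commutative unital ring: its Jacobson radical is zero.\<close>

definition semisimple :: "('a, 'b) ring_scheme \<Rightarrow> bool"
  where "semisimple S \<longleftrightarrow> \<Inter> {I. maximalideal I S} = {\<zero>\<^bsub>S\<^esub>}"

text \<open>By \<^locale>\<open>subring\<close>, a subring contains the identity of the ambient ring.\<close>

definition full_subring :: "'a set \<Rightarrow> ('a, 'b) ring_scheme \<Rightarrow> bool"
  where "full_subring R\<^sub>1 R\<^sub>2 \<longleftrightarrow> subring R\<^sub>1 R\<^sub>2 \<and>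
    (\<forall>x\<in>R\<^sub>1. x \<in> Units R\<^sub>2 \<longrightarrow> x \<in> Units (R\<^sub>2\<lparr>carrier := R\<^sub>1\<rparr>))"

subsection \<open>Almost periodic functions\<close>

definition Linf_norm :: "(real \<Rightarrow> complex) \<Rightarrow> real"
  where "Linf_norm f = real_of_ereal (esssup lborel (\<lambda>y. ereal (cmod (f y))))"

definition Linf :: "(real \<Rightarrow> complex) set"
  where "Linf = {f \<in> borel_measurable lborel. esssup lborel (\<lambda>y. ereal (cmod (f y))) < \<infinity>}"

text \<open>A set of classes modulo a.e. equality is represented by the set of all members of these
  classes. The last condition (with constant sequences) makes every closed subalgebra
  saturated under a.e. equality, so no quotient is needed.\<close>

definition closed_subalgebra_Linf :: "(real \<Rightarrow> complex) set \<Rightarrow> bool"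
  where "closed_subalgebra_Linf A \<longleftrightarrow> A \<subseteq> Linf \<and>
    (\<forall>f\<in>A. \<forall>g\<in>A. (\<lambda>y. f y + g y) \<in> A) \<and>
    (\<forall>c. \<forall>f\<in>A. (\<lambda>y. c * f y) \<in> A) \<and>
    (\<forall>f\<in>A. \<forall>g\<in>A. (\<lambda>y. f y * g y) \<in> A) \<and>
    (\<forall>u. \<forall>f\<in>Linf. (\<forall>n. u n \<in> A) \<longrightarrow>
       (\<lambda>n. Linf_norm (\<lambda>y. u n y - f y)) \<longlonglongrightarrow> 0 \<longrightarrow> f \<in> A)"

definition AP_Linf :: "(real \<Rightarrow> complex) set"
  where "AP_Linf = \<Inter> {A. closed_subalgebra_Linf A \<and>
    (\<forall>\<omega>::real. (\<lambda>y. exp (\<i> * complex_of_real (\<omega> * y))) \<in> A)}"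

text \<open>Each class in \<^const>\<open>AP_Linf\<close> has exactly one continuous member, because an essentially
  uniform limit of continuous functions has a continuous version. As usual, an almost periodic
  function is identified with this member; its point values are needed for its argument.\<close>

definition AP :: "(real \<Rightarrow> complex) set"
  where "AP = {f \<in> AP_Linf. continuous_on UNIV f}"

definition bohr_coeff :: "(real \<Rightarrow> complex) \<Rightarrow> real \<Rightarrow> complex"
  where "bohr_coeff f \<omega> = Lim at_top (\<lambda>N::real.
    complex_of_real (1 / (2 * N)) *
      integral {-N..N} (\<lambda>y. exp (- \<i> * complex_of_real (\<omega> * y)) * f y))"

definition bohr_spectrum :: "(real \<Rightarrow> complex) \<Rightarrow> real set"
  where "bohr_spectrum f = {\<omega>. bohr_coeff f \<omega> \<noteq> 0}"

definition AP_plus :: "(real \<Rightarrow> complex) set"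
  where "AP_plus = {f \<in> AP. bohr_spectrum f \<subseteq> {0..}}"

definition AP_algebra :: "(real \<Rightarrow> complex) star_algebra"
  where "AP_algebra = \<lparr>carrier = AP, mult = (\<lambda>f g y. f y * g y), one = (\<lambda>y. 1),
    zero = (\<lambda>y. 0), add = (\<lambda>f g y. f y + g y), smult = (\<lambda>c f y. c * f y),
    alg_norm = Linf_norm, alg_star = (\<lambda>f y. cnj (f y))\<rparr>"

definition continuous_arg :: "(real \<Rightarrow> complex) \<Rightarrow> (real \<Rightarrow> real) \<Rightarrow> bool"
  where "continuous_arg f \<theta> \<longleftrightarrow> continuous_on UNIV \<theta> \<and>
    (\<forall>t. f t = complex_of_real (cmod (f t)) * cis (\<theta> t))"

text \<open>Two continuous arguments of a nowhere vanishing function differ by a constant, so the choice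
  is immaterial.\<close>

definition avg_winding :: "(real \<Rightarrow> complex) \<Rightarrow> real"
  where "avg_winding f = (let \<theta> = (SOME \<theta>. continuous_arg f \<theta>) in
    Lim at_top (\<lambda>T::real. (\<theta> T - \<theta> (- T)) / (2 * T)))"

end

theory Submission
  imports Defs "HOL-Complex_Analysis.Complex_Analysis" "HOL-Real_Asymp.Real_Asymp"
begin

text \<open>All arguments are about means \<open>M\<close> of almost periodic functions on the line. Convolution with
  a normalised product of Fejer kernels shows that a continuous function with Bohr's translation
  property is a uniform limit of trigonometric polynomials whose frequencies lie in its spectrum;
  hence \<open>AP\<^sup>+\<close> is the uniform closure of the polynomials with nonnegative frequencies.

  A unit \<open>f\<close> of \<open>AP\<close> has the form \<open>e\<^sub>w exp G\<close> with \<open>G \<in> AP\<close>, where \<open>e\<^sub>w\<close> is the character of frequency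
  \<open>w = w(f)\<close>, so the winding number is additive and locally constant.
  Approximating \<open>G\<close> by a polynomial and splitting it into frequencies \<open>\<ge> 0\<close> and \<open>< 0\<close> gives
  \<open>f = e\<^sub>w exp(q) exp(r) Z\<close> with \<open>Re Z \<ge> 1/2\<close>. If \<open>f \<in> AP\<^sup>+\<close>, then \<open>exp(q)\<close> can be divided out inside
  \<open>AP\<^sup>+\<close>, and for the remaining factors the orthogonality of functions with disjoint spectra together
  with \<open>Re M(Z |b|\<^sup>2) \<ge> M(|b|\<^sup>2) / 2\<close> decides whether the inverse has negative frequencies.

  Zero divisors are excluded in \<open>AP\<^sup>+\<close> because its elements extend to bounded holomorphic functions
  on the upper half-plane, to which the maximum principle and the identity theorem apply.\<close>

subsection \<open>Trigonometric polynomials and their uniform limits\<close>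

text \<open>The projection of \<open>AP\<close> onto one half-line of frequencies is unbounded in
  the sup norm, so in general a logarithm \<open>G\<close> has no exact splitting into a part with
  spectrum in \<open>{0..}\<close> and one with spectrum in \<open>{..<0}\<close>. Only a
  trigonometric approximant is split, term by term, and the error survives as the factor
  \<open>Z = exp (G - q - r)\<close>. The lower bound on \<open>Re Z\<close> makes \<open>Z\<close>
  a positive weight in mean square estimates; these replace the missing factorisation. Since
  \<open>exp q\<close> and \<open>exp (- q)\<close> both have spectrum in \<open>{0..}\<close>, the
  factor \<open>exp q\<close> affects neither membership in \<open>AP_plus\<close> nor invertibility
  there. \<open>bohr_coeff\<close> and \<open>avg_winding\<close> are given by \<open>Lim\<close>,
  which is informative only when the limit exists; hence the relational \<open>has_mean\<close> and
  an existence proof for means. A function known only to have Bohr's translation property has no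
  such means yet, so its approximation works along sequences. On continuous functions a bound almost
  everywhere is a bound everywhere. The analysis therefore uses pointwise bounds throughout, and the
  essential supremum enters only when \<open>AP\<close> is identified with a uniform
  closure.\<close>

definition ee :: "real \<Rightarrow> real \<Rightarrow> complex"
  where "ee l t = cis (l * t)"

lemma norm_ee [simp]: "cmod (ee l t) = 1"
  by (simp add: ee_def)

lemma ee_0 [simp]: "ee 0 t = 1"
  by (simp add: ee_def)

lemma ee_mult: "ee l t * ee m t = ee (l + m) t"
  by (simp add: ee_def cis_mult algebra_simps)

lemma cnj_ee: "cnj (ee l t) = ee (- l) t"
  by (simp add: ee_def cis_cnj)

lemma ee_diff_arg: "ee l (s - t) = ee l s * ee (- l) t"
  by (simp add: ee_def cis_mult algebra_simps)

lemma ee_add_arg: "ee l (s + t) = ee l s * ee l t"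
  by (simp add: ee_def cis_mult algebra_simps)

lemma continuous_on_ee [continuous_intros]: "continuous_on A (ee l)"
  unfolding ee_def by (intro continuous_intros)

text \<open>The linear span of the characters with frequencies in \<open>S\<close>. Frequencies may
  repeat, so no normal form is needed and closure properties are proved one term at a time.\<close>

inductive_set trig :: "real set \<Rightarrow> (real \<Rightarrow> complex) set" for S
  where zero: "(\<lambda>t. 0) \<in> trig S"
  | step: "\<lbrakk>p \<in> trig S; l \<in> S\<rbrakk> \<Longrightarrow> (\<lambda>t. c * ee l t + p t) \<in> trig S"

lemma trig_monom: "l \<in> S \<Longrightarrow> (\<lambda>t. c * ee l t) \<in> trig S"
  using trig.step[OF trig.zero, of l S c] by simp

lemma trig_ee: "l \<in> S \<Longrightarrow> ee l \<in> trig S"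
  using trig_monom[of l S 1] by simp

lemma trig_add:
  assumes "p \<in> trig S" "q \<in> trig S"
  shows "(\<lambda>t. p t + q t) \<in> trig S"
  using assms(1)
proof induction
  case zero
  then show ?case using assms(2) by simp
next
  case (step p l c)
  then show ?case using trig.step[of "\<lambda>t. p t + q t" S l c] by (simp add: add.assoc)
qed

lemma trig_monom_mult:
  assumes "p \<in> trig S" "\<And>m. m \<in> S \<Longrightarrow> l + m \<in> U"
  shows "(\<lambda>t. (c * ee l t) * p t) \<in> trig U"
  using assms(1)
proof induction
  case zero
  then show ?case by (simp add: trig.zero)
next
  case (step p m d)
  have "(\<lambda>t. (c * d) * ee (l + m) t + (c * ee l t) * p t) \<in> trig U"
    using step assms(2) by (intro trig.step) auto
  then show ?case by (simp add: ee_mult[symmetric] algebra_simps)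
qed

lemma trig_mult:
  assumes "p \<in> trig S" "q \<in> trig T" "\<And>l m. l \<in> S \<Longrightarrow> m \<in> T \<Longrightarrow> l + m \<in> U"
  shows "(\<lambda>t. p t * q t) \<in> trig U"
  using assms(1)
proof induction
  case zero
  then show ?case by (simp add: trig.zero)
next
  case (step p l c)
  have "(\<lambda>t. (c * ee l t) * q t + p t * q t) \<in> trig U"
    using step assms by (intro trig_add trig_monom_mult[OF assms(2)]) auto
  then show ?case by (simp add: algebra_simps)
qed

lemma trig_cnj:
  assumes "p \<in> trig S"
  shows "(\<lambda>t. cnj (p t)) \<in> trig (uminus ` S)"
  using assms
proof induction
  case zero
  then show ?case by (simp add: trig.zero)
next
  case (step p l c)
  then have "(\<lambda>t. cnj c * ee (- l) t + cnj (p t)) \<in> trig (uminus ` S)"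
    by (intro trig.step) auto
  then show ?case by (simp add: cnj_ee)
qed

lemma trig_mono: "p \<in> trig S \<Longrightarrow> S \<subseteq> T \<Longrightarrow> p \<in> trig T"
  by (induction rule: trig.induct) (auto intro: trig.intros)

lemma trig_split:
  assumes "p \<in> trig UNIV"
  shows "\<exists>q\<in>trig A. \<exists>r\<in>trig (- A). p = (\<lambda>t. q t + r t)"
  using assms
proof induction
  case zero
  show ?case
    by (intro bexI[of _ "\<lambda>t. 0"]) (auto intro: trig.zero)
next
  case (step p l c)
  then obtain q r where qr: "q \<in> trig A" "r \<in> trig (- A)" "p = (\<lambda>t. q t + r t)"
    by blast
  show ?case
  proof (cases "l \<in> A")
    case True
    show ?thesis
      by (rule bexI[OF _ trig.step[OF qr(1) True, of c]], rule bexI[OF _ qr(2)]) (simp add: qr(3) add.assoc)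
  next
    case False
    then have "l \<in> - A" by simp
    show ?thesis
      by (rule bexI[OF _ qr(1)], rule bexI[OF _ trig.step[OF qr(2) \<open>l \<in> - A\<close>, of c]])
        (simp add: qr(3) add.left_commute)
  qed
qed

lemma trig_sum_repr:
  assumes "p \<in> trig S"
  shows "\<exists>n c m. (\<forall>i<n. m i \<in> S) \<and> p = (\<lambda>t. \<Sum>i<(n::nat). c i * ee (m i) t)"
  using assms
proof induction
  case zero
  show ?case by (intro exI[of _ 0]) simp
next
  case (step p l c)
  then obtain n d m where h: "\<forall>i<n. m i \<in> S" "p = (\<lambda>t. \<Sum>i<(n::nat). d i * ee (m i) t)"
    by blast
  show ?case
    using h step
    by (intro exI[of _ "Suc n"] exI[of _ "d(n := c)"] exI[of _ "m(n := l)"])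
      (auto simp: less_Suc_eq add.commute intro!: sum.cong)
qed

lemma trig_sum:
  assumes "\<And>i. i < n \<Longrightarrow> m i \<in> S"
  shows "(\<lambda>t. \<Sum>i<(n::nat). c i * ee (m i) t) \<in> trig S"
  using assms
proof (induction n)
  case 0
  then show ?case by (simp add: trig.zero)
next
  case (Suc n)
  then show ?case
    using trig.step[of "\<lambda>t. \<Sum>i<n. c i * ee (m i) t" S "m n" "c n"] by (simp add: add.commute)
qed

lemma trig_continuous: "p \<in> trig S \<Longrightarrow> continuous_on A p"
  by (induction rule: trig.induct) (auto intro!: continuous_intros)

lemma trig_bounded: "p \<in> trig S \<Longrightarrow> \<exists>B. \<forall>t. cmod (p t) \<le> B"
proof (induction rule: trig.induct)
  case (step p l c)
  then obtain B where B: "\<And>t. cmod (p t) \<le> B" by blast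
  have "cmod (c * ee l t + p t) \<le> cmod c + B" for t
    using norm_triangle_ineq[of "c * ee l t" "p t"] B[of t] by (simp add: norm_mult)
  then show ?case by blast
qed auto

text \<open>The uniform closure of \<open>trig S\<close>. Keeping \<open>S\<close> arbitrary turns
  spectral statements about products and conjugates into arithmetic of sets of frequencies;
  \<open>AP\<close> and \<open>AP_plus\<close> become the cases \<open>UNIV\<close> and
  \<open>{0..}\<close>.\<close>

definition APS :: "real set \<Rightarrow> (real \<Rightarrow> complex) set"
  where "APS S = {f. \<forall>\<epsilon>>0. \<exists>p\<in>trig S. \<forall>t. cmod (f t - p t) \<le> \<epsilon>}"

lemma APS_trig: "p \<in> trig S \<Longrightarrow> p \<in> APS S"
  unfolding APS_def by (auto intro!: bexI[of _ p])

lemma APS_mono: "f \<in> APS S \<Longrightarrow> S \<subseteq> T \<Longrightarrow> f \<in> APS T"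
  unfolding APS_def by (blast intro: trig_mono)

lemma APS_D:
  assumes "f \<in> APS S" "\<epsilon> > 0"
  obtains p where "p \<in> trig S" "\<And>t. cmod (f t - p t) \<le> \<epsilon>"
  using assms unfolding APS_def by blast

lemma APS_limit:
  assumes "\<And>\<epsilon>. \<epsilon> > 0 \<Longrightarrow> \<exists>g\<in>APS S. \<forall>t. cmod (f t - g t) \<le> \<epsilon>"
  shows "f \<in> APS S"
  unfolding APS_def
proof safe
  fix \<epsilon> :: real assume "\<epsilon> > 0"
  then obtain g where g: "g \<in> APS S" "\<And>t. cmod (f t - g t) \<le> \<epsilon> / 2"
    using assms[of "\<epsilon> / 2"] by auto
  obtain p where p: "p \<in> trig S" "\<And>t. cmod (g t - p t) \<le> \<epsilon> / 2"
    using APS_D[OF g(1), of "\<epsilon> / 2"] \<open>\<epsilon> > 0\<close> by auto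
  have "cmod (f t - p t) \<le> \<epsilon>" for t
    using g(2)[of t] p(2)[of t] norm_triangle_ineq[of "f t - g t" "g t - p t"] by simp
  then show "\<exists>p\<in>trig S. \<forall>t. cmod (f t - p t) \<le> \<epsilon>" using p by blast
qed

lemma APS_sequence:
  assumes "f \<in> APS S"
  obtains p where "\<And>n. p n \<in> trig S" "\<And>n t. cmod (f t - p n t) \<le> 1 / real (Suc n)"
proof -
  have "\<exists>p. \<forall>n. p n \<in> trig S \<and> (\<forall>t. cmod (f t - p n t) \<le> 1 / real (Suc n))"
  proof (intro choice allI)
    fix n
    obtain p where "p \<in> trig S" "\<And>t. cmod (f t - p t) \<le> 1 / real (Suc n)"
      using APS_D[OF assms, of "1 / real (Suc n)"] by auto
    then show "\<exists>p. p \<in> trig S \<and> (\<forall>t. cmod (f t - p t) \<le> 1 / real (Suc n))" by blast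
  qed
  then show ?thesis using that by blast
qed

lemma APS_bounded:
  assumes "f \<in> APS S"
  obtains B where "B > 0" "\<And>t. cmod (f t) \<le> B"
proof -
  obtain p where p: "p \<in> trig S" "\<And>t. cmod (f t - p t) \<le> 1"
    using APS_D[OF assms, of 1] by auto
  obtain B where B: "\<And>t. cmod (p t) \<le> B" using trig_bounded[OF p(1)] by blast
  have "cmod (f t) \<le> \<bar>B\<bar> + 1" for t
    using norm_triangle_ineq[of "f t - p t" "p t"] p(2)[of t] B[of t] by simp
  then show ?thesis using that[of "\<bar>B\<bar> + 1"] by simp
qed

lemma APS_continuous:
  assumes "f \<in> APS S"
  shows "continuous_on A f"
proof -
  obtain p where p: "\<And>n. p n \<in> trig S" "\<And>n t. cmod (f t - p n t) \<le> 1 / real (Suc n)"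
    using APS_sequence[OF assms] by blast
  have "uniform_limit A p f sequentially"
  proof (rule uniform_limitI)
    fix e :: real assume "e > 0"
    then obtain N where N: "N > 0" "inverse (real N) < e" using reals_Archimedean2 ex_inverse_of_nat_less by blast
    have "dist (p n t) (f t) < e" if "n \<ge> N" for n t
    proof -
      have "dist (p n t) (f t) \<le> 1 / real (Suc n)"
        using p(2)[of t n] by (simp add: dist_norm norm_minus_commute)
      also have "\<dots> \<le> inverse (real N)" using that N by (simp add: field_simps)
      finally show ?thesis using N by simp
    qed
    then show "\<forall>\<^sub>F n in sequentially. \<forall>x\<in>A. dist (p n x) (f x) < e"
      by (auto simp: eventually_sequentially)
  qed
  then show ?thesis
    by (rule uniform_limit_theorem[rotated]) (auto intro!: always_eventually trig_continuous p)
qed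

lemma APS_add:
  assumes "f \<in> APS S" "g \<in> APS S"
  shows "(\<lambda>t. f t + g t) \<in> APS S"
  unfolding APS_def
proof safe
  fix \<epsilon> :: real assume "\<epsilon> > 0"
  then have e: "\<epsilon> / 2 > 0" by simp
  obtain p where p: "p \<in> trig S" "\<And>t. cmod (f t - p t) \<le> \<epsilon> / 2" using APS_D[OF assms(1) e] by auto
  obtain q where q: "q \<in> trig S" "\<And>t. cmod (g t - q t) \<le> \<epsilon> / 2" using APS_D[OF assms(2) e] by auto
  have "cmod (f t + g t - (p t + q t)) \<le> \<epsilon>" for t
    using norm_triangle_ineq[of "f t - p t" "g t - q t"] p(2)[of t] q(2)[of t]
    by (simp add: algebra_simps)
  then show "\<exists>p\<in>trig S. \<forall>t. cmod (f t + g t - p t) \<le> \<epsilon>"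
    by (intro bexI[OF _ trig_add[OF p(1) q(1)]]) simp
qed

lemma APS_mult:
  assumes "f \<in> APS S" "g \<in> APS T" "\<And>l m. l \<in> S \<Longrightarrow> m \<in> T \<Longrightarrow> l + m \<in> U"
  shows "(\<lambda>t. f t * g t) \<in> APS U"
  unfolding APS_def
proof safe
  fix \<epsilon> :: real assume e: "\<epsilon> > 0"
  obtain B where B: "B > 0" "\<And>t. cmod (g t) \<le> B" using APS_bounded[OF assms(2)] by blast
  obtain p where p: "p \<in> trig S" "\<And>t. cmod (f t - p t) \<le> \<epsilon> / (2 * B)"
    using APS_D[OF assms(1), of "\<epsilon> / (2 * B)"] e B by auto
  \<comment> \<open>The error of \<open>q\<close> is multiplied by \<open>p\<close>, so
    \<open>q\<close> can be chosen only after \<open>p\<close> and its bound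
    \<open>C\<close>.\<close>
  obtain C where C: "C > 0" "\<And>t. cmod (p t) \<le> C" using APS_bounded[OF APS_trig[OF p(1)]] by blast
  obtain q where q: "q \<in> trig T" "\<And>t. cmod (g t - q t) \<le> \<epsilon> / (2 * C)"
    using APS_D[OF assms(2), of "\<epsilon> / (2 * C)"] e C by auto
  have "cmod (f t * g t - p t * q t) \<le> \<epsilon>" for t
  proof -
    have "f t * g t - p t * q t = (f t - p t) * g t + p t * (g t - q t)"
      by (simp add: algebra_simps)
    then have "cmod (f t * g t - p t * q t) \<le> cmod (f t - p t) * cmod (g t) + cmod (p t) * cmod (g t - q t)"
      using norm_triangle_ineq by (metis norm_mult)
    also have "\<dots> \<le> \<epsilon> / (2 * B) * B + C * (\<epsilon> / (2 * C))"
      using p(2) q(2) B C e by (intro add_mono mult_mono) (auto simp: less_imp_le)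
    also have "\<dots> = \<epsilon>" using B C by simp
    finally show ?thesis .
  qed
  then show "\<exists>p\<in>trig U. \<forall>t. cmod (f t * g t - p t) \<le> \<epsilon>"
    by (intro bexI[OF _ trig_mult[OF p(1) q(1) assms(3)]]) simp
qed

lemma APS_cmult:
  assumes "f \<in> APS S"
  shows "(\<lambda>t. c * f t) \<in> APS S"
  using APS_mult[OF APS_trig[OF trig_monom[of 0 "{0}" c]] assms, of S] by simp

lemma APS_cnj:
  assumes "f \<in> APS S"
  shows "(\<lambda>t. cnj (f t)) \<in> APS (uminus ` S)"
  unfolding APS_def
proof safe
  fix \<epsilon> :: real assume "\<epsilon> > 0"
  then obtain p where p: "p \<in> trig S" "\<And>t. cmod (f t - p t) \<le> \<epsilon>" using APS_D[OF assms] by auto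
  have "cmod (cnj (f t) - cnj (p t)) \<le> \<epsilon>" for t
    using p(2)[of t] by (metis complex_cnj_diff complex_mod_cnj)
  then show "\<exists>p\<in>trig (uminus ` S). \<forall>t. cmod (cnj (f t) - p t) \<le> \<epsilon>"
    by (intro bexI[OF _ trig_cnj[OF p(1)]]) simp
qed

lemma APS_cnj_UNIV: "f \<in> APS UNIV \<Longrightarrow> (\<lambda>t. cnj (f t)) \<in> APS UNIV"
  using APS_cnj[of f UNIV] APS_mono by blast

lemma APS_mult_UNIV: "f \<in> APS UNIV \<Longrightarrow> g \<in> APS UNIV \<Longrightarrow> (\<lambda>t. f t * g t) \<in> APS UNIV"
  by (rule APS_mult) auto

lemma APS_uminus: "f \<in> APS S \<Longrightarrow> (\<lambda>t. - f t) \<in> APS S"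
  using APS_cmult[of f S "-1"] by simp

lemma APS_diff: "f \<in> APS S \<Longrightarrow> g \<in> APS S \<Longrightarrow> (\<lambda>t. f t - g t) \<in> APS S"
  using APS_add[OF _ APS_uminus, of f S g] by simp

lemma APS_const: "0 \<in> S \<Longrightarrow> (\<lambda>t. c) \<in> APS S"
  using APS_trig[OF trig_monom[of 0 S c]] by simp

lemma APS_power:
  assumes "f \<in> APS S" "0 \<in> S" "\<And>l m. l \<in> S \<Longrightarrow> m \<in> S \<Longrightarrow> l + m \<in> S"
  shows "(\<lambda>t. f t ^ n) \<in> APS S"
proof (induction n)
  case 0
  then show ?case using assms by (simp add: APS_const)
next
  case (Suc n)
  then show ?case using APS_mult[OF assms(1) Suc assms(3)] by simp
qed

lemma APS_sum:
  assumes "\<And>i. i < (n::nat) \<Longrightarrow> f i \<in> APS S"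
  shows "(\<lambda>t. \<Sum>i<n. f i t) \<in> APS S"
  using assms
proof (induction n)
  case 0
  then show ?case by (simp add: APS_trig trig.zero)
next
  case (Suc n)
  then show ?case by (simp add: APS_add)
qed

text \<open>The conditions on \<open>S\<close> make \<open>APS S\<close> a unital closed algebra,
  and the exponential series converges uniformly on a disc that contains the range of
  \<open>f\<close>.\<close>

lemma APS_exp:
  assumes "f \<in> APS S" "0 \<in> S" "\<And>l m. l \<in> S \<Longrightarrow> m \<in> S \<Longrightarrow> l + m \<in> S"
  shows "(\<lambda>t. exp (f t)) \<in> APS S"
proof (rule APS_limit)
  fix \<epsilon> :: real assume e: "\<epsilon> > 0"
  obtain B where B: "B > 0" "\<And>t. cmod (f t) \<le> B" using APS_bounded[OF assms(1)] by blast
  have "uniform_limit (cball 0 B) (\<lambda>n z. \<Sum>i<n. z ^ i /\<^sub>R fact i) (exp :: complex \<Rightarrow> complex) sequentially"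
    unfolding exp_def
  proof (rule Weierstrass_m_test)
    show "norm (z ^ n /\<^sub>R fact n) \<le> B ^ n /\<^sub>R fact n" if "z \<in> cball 0 B" for n and z :: complex
      using that by (auto simp: norm_power divide_simps intro!: power_mono)
    show "summable (\<lambda>n. B ^ n /\<^sub>R fact n)" by (rule summable_exp_generic)
  qed
  then have "\<forall>\<^sub>F n in sequentially. \<forall>z\<in>cball 0 B. dist (\<Sum>i<n. z ^ i /\<^sub>R fact i) (exp (z::complex)) < \<epsilon>"
    using e by (rule uniform_limitD)
  then obtain n where n: "\<And>z. z \<in> cball 0 B \<Longrightarrow> dist (\<Sum>i<n. z ^ i /\<^sub>R fact i) (exp (z::complex)) < \<epsilon>"
    unfolding eventually_sequentially by blast
  have "(\<lambda>t. \<Sum>i<n. complex_of_real (inverse (fact i)) * f t ^ i) \<in> APS S"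
    by (intro APS_sum APS_cmult APS_power assms)
  then have m: "(\<lambda>t. \<Sum>i<n. f t ^ i /\<^sub>R fact i) \<in> APS S" by (simp add: scaleR_conv_of_real)
  show "\<exists>g\<in>APS S. \<forall>t. cmod (exp (f t) - g t) \<le> \<epsilon>"
    by (rule bexI[OF _ m]) (use n B in \<open>auto simp: dist_norm norm_minus_commute less_imp_le\<close>)
qed

subsection \<open>Mean values\<close>

definition avg :: "(real \<Rightarrow> complex) \<Rightarrow> real \<Rightarrow> complex"
  where "avg f N = complex_of_real (1 / (2 * N)) * integral {-N..N} f"

text \<open>A relation rather than a value of \<open>Lim\<close>, so that existence of the limit is
  part of what is asserted.\<close>

definition has_mean :: "(real \<Rightarrow> complex) \<Rightarrow> complex \<Rightarrow> bool"
  where "has_mean f m \<longleftrightarrow> (avg f \<longlongrightarrow> m) at_top"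

lemma has_mean_unique: "has_mean f m \<Longrightarrow> has_mean f m' \<Longrightarrow> m = m'"
  unfolding has_mean_def by (rule tendsto_unique[OF trivial_limit_at_top_linorder])

lemma avg_add:
  "continuous_on UNIV f \<Longrightarrow> continuous_on UNIV g \<Longrightarrow> avg (\<lambda>t. f t + g t) N = avg f N + avg g N"
  unfolding avg_def
  by (subst integral_add)
    (auto intro!: integrable_continuous_interval intro: continuous_on_subset simp: algebra_simps)

lemma avg_cmult: "avg (\<lambda>t. c * f t) N = c * avg f N"
  unfolding avg_def by (simp add: mult.left_commute)

lemma avg_diff:
  "continuous_on UNIV f \<Longrightarrow> continuous_on UNIV g \<Longrightarrow> avg (\<lambda>t. f t - g t) N = avg f N - avg g N"
  using avg_add[of f "\<lambda>t. (-1) * g t" N] avg_cmult[of "-1" g N] by (simp add: continuous_on_minus)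

lemma avg_sum:
  assumes "\<And>i. i < (n::nat) \<Longrightarrow> continuous_on UNIV (f i)"
  shows "avg (\<lambda>t. \<Sum>i<n. f i t) N = (\<Sum>i<n. avg (f i) N)"
  using assms
proof (induction n)
  case 0
  then show ?case by (simp add: avg_def)
next
  case (Suc n)
  then have "continuous_on UNIV (\<lambda>t. \<Sum>i<n. f i t)" by (intro continuous_intros) auto
  then show ?case using Suc by (simp add: avg_add)
qed

text \<open>The majorant is complex valued and enters through its real part, so that one notion of
  average serves both functions and their bounds.\<close>

lemma norm_avg_le:
  assumes "continuous_on UNIV f" "continuous_on UNIV g" "\<And>t. cmod (f t) \<le> Re (g t)" "N > 0"
  shows "cmod (avg f N) \<le> Re (avg g N)"
proof -
  have i: "f integrable_on {-N..N}" "g integrable_on {-N..N}"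
    using assms by (auto intro!: integrable_continuous_interval intro: continuous_on_subset)
  have "cmod (integral {-N..N} f) \<le> integral {-N..N} g \<bullet> 1"
    by (rule integral_norm_bound_integral_component[OF i]) (use assms in \<open>simp add: inner_complex_def\<close>)
  then show ?thesis
    using assms(4) unfolding avg_def
    by (simp add: norm_mult norm_divide inner_complex_def divide_right_mono)
qed

lemma Re_avg_le:
  assumes "continuous_on UNIV f" "continuous_on UNIV g" "\<And>t. Re (f t) \<le> Re (g t)" "N > 0"
  shows "Re (avg f N) \<le> Re (avg g N)"
proof -
  have i: "f integrable_on {-N..N}" "g integrable_on {-N..N}"
    using assms by (auto intro!: integrable_continuous_interval intro: continuous_on_subset)
  have "Re (integral {-N..N} f) \<le> Re (integral {-N..N} g)"
    using integral_component_le[of 1, OF _ i] assms by (simp add: inner_complex_def)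
  then show ?thesis
    using assms(4) unfolding avg_def by (simp add: divide_right_mono)
qed

lemma avg_const: "N > 0 \<Longrightarrow> avg (\<lambda>t. c) N = c"
  unfolding avg_def by (simp add: scaleR_conv_of_real)

lemma has_mean_const: "has_mean (\<lambda>t. c) c"
  unfolding has_mean_def
  by (rule tendsto_eventually) (auto simp: eventually_at_top_dense avg_const intro: exI[of _ 0])

lemma has_mean_add:
  "\<lbrakk>has_mean f m; has_mean g m'; continuous_on UNIV f; continuous_on UNIV g\<rbrakk>
    \<Longrightarrow> has_mean (\<lambda>t. f t + g t) (m + m')"
  unfolding has_mean_def by (subst avg_add[THEN ext]) (auto intro: tendsto_add)

lemma has_mean_diff:
  "\<lbrakk>has_mean f m; has_mean g m'; continuous_on UNIV f; continuous_on UNIV g\<rbrakk>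
    \<Longrightarrow> has_mean (\<lambda>t. f t - g t) (m - m')"
  unfolding has_mean_def by (subst avg_diff[THEN ext]) (auto intro: tendsto_diff)

lemma has_mean_cmult: "has_mean f m \<Longrightarrow> has_mean (\<lambda>t. c * f t) (c * m)"
  unfolding has_mean_def by (subst avg_cmult[THEN ext]) (auto intro: tendsto_mult)

lemma has_mean_sum:
  assumes "finite I" "\<And>i. i \<in> I \<Longrightarrow> has_mean (f i) (m i)" "\<And>i. i \<in> I \<Longrightarrow> continuous_on UNIV (f i)"
  shows "has_mean (\<lambda>t. \<Sum>i\<in>I. f i t) (\<Sum>i\<in>I. m i)"
  using assms
proof induction
  case empty
  then show ?case by (simp add: has_mean_const)
next
  case (insert i I)
  then have "has_mean (\<lambda>t. f i t + (\<Sum>i\<in>I. f i t)) (m i + (\<Sum>i\<in>I. m i))"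
    by (intro has_mean_add continuous_on_sum) auto
  then show ?case using insert by simp
qed

lemma has_mean_norm_le:
  assumes "has_mean f m" "has_mean g m'" "continuous_on UNIV f" "continuous_on UNIV g"
    "\<And>t. cmod (f t) \<le> Re (g t)"
  shows "cmod m \<le> Re m'"
proof (rule tendsto_le[OF trivial_limit_at_top_linorder])
  show "((\<lambda>N. Re (avg g N)) \<longlongrightarrow> Re m') at_top" "((\<lambda>N. cmod (avg f N)) \<longlongrightarrow> cmod m) at_top"
    using assms by (auto simp: has_mean_def intro: tendsto_intros)
  show "\<forall>\<^sub>F N in at_top. cmod (avg f N) \<le> Re (avg g N)"
    using assms norm_avg_le by (auto simp: eventually_at_top_dense intro!: exI[of _ 0])
qed

lemma has_mean_Re_le:
  assumes "has_mean f m" "has_mean g m'" "continuous_on UNIV f" "continuous_on UNIV g"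
    "\<And>t. Re (f t) \<le> Re (g t)"
  shows "Re m \<le> Re m'"
proof (rule tendsto_le[OF trivial_limit_at_top_linorder])
  show "((\<lambda>N. Re (avg g N)) \<longlongrightarrow> Re m') at_top" "((\<lambda>N. Re (avg f N)) \<longlongrightarrow> Re m) at_top"
    using assms by (auto simp: has_mean_def intro: tendsto_intros)
  show "\<forall>\<^sub>F N in at_top. Re (avg f N) \<le> Re (avg g N)"
    using assms Re_avg_le by (auto simp: eventually_at_top_dense intro!: exI[of _ 0])
qed

text \<open>The antiderivative of a nonconstant character is bounded, so its average over
  \<open>{-N..N}\<close> is of order \<open>1 / N\<close>.\<close>

lemma has_mean_ee:
  assumes "l \<noteq> 0"
  shows "has_mean (ee l) 0"
  unfolding has_mean_def
proof (rule Lim_null_comparison)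
  have int: "(ee l has_integral (ee l N / (\<i> * l) - ee l (- N) / (\<i> * l))) {-N..N}" if "N > 0" for N
  proof (rule fundamental_theorem_of_calculus)
    fix x
    have "((\<lambda>z. exp (\<i> * of_real l * z) / (\<i> * l)) has_field_derivative exp (\<i> * of_real l * of_real x))
        (at (of_real x))"
      using assms by (auto intro!: derivative_eq_intros)
    then have "((\<lambda>t. exp (\<i> * of_real l * of_real t) / (\<i> * l)) has_vector_derivative exp (\<i> * of_real l * of_real x))
        (at x within {-N..N})"
      by (rule has_vector_derivative_real_field)
    then show "((\<lambda>t. ee l t / (\<i> * l)) has_vector_derivative ee l x) (at x within {-N..N})"
      unfolding ee_def cis_conv_exp by (simp add: algebra_simps)
  qed (use that in simp)
  show "\<forall>\<^sub>F N in at_top. cmod (avg (ee l) N) \<le> 1 / (\<bar>l\<bar> * N)"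
    unfolding eventually_at_top_dense
  proof (intro exI[of _ 0] allI impI)
    fix N :: real assume N: "N > 0"
    have "cmod (avg (ee l) N) = 1 / (2 * N) * cmod (ee l N / (\<i> * l) - ee l (- N) / (\<i> * l))"
      unfolding avg_def integral_unique[OF int[OF N]] using N by (simp only: norm_mult norm_of_real) simp
    also have "\<dots> \<le> 1 / (2 * N) * (1 / \<bar>l\<bar> + 1 / \<bar>l\<bar>)"
      using N norm_triangle_ineq4[of "ee l N / (\<i> * l)" "ee l (- N) / (\<i> * l)"]
      by (intro mult_left_mono) (auto simp: norm_divide norm_mult)
    also have "\<dots> = 1 / (\<bar>l\<bar> * N)" using N assms by (simp add: field_simps)
    finally show "cmod (avg (ee l) N) \<le> 1 / (\<bar>l\<bar> * N)" .
  qed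
  show "((\<lambda>N. 1 / (\<bar>l\<bar> * N)) \<longlongrightarrow> 0) at_top"
    using assms by real_asymp
qed

lemma trig_has_mean:
  assumes "p \<in> trig S"
  shows "\<exists>m. has_mean p m"
  using assms
proof induction
  case zero
  then show ?case using has_mean_const by blast
next
  case (step p l c)
  then obtain m where "has_mean p m" by blast
  moreover have "\<exists>m. has_mean (ee l) m"
    using has_mean_ee has_mean_const[of 1] by (cases "l = 0") (auto simp: ee_def[abs_def])
  ultimately show ?case
    using has_mean_add[OF has_mean_cmult] trig_continuous[OF step(1)]
    by (metis continuous_on_ee continuous_on_mult_left)
qed

lemma trig_mean_zero:
  assumes "p \<in> trig S" "0 \<notin> S"
  shows "has_mean p 0"
  using assms(1)
proof induction
  case zero
  then show ?case using has_mean_const by blast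
next
  case (step p l c)
  then have "has_mean (ee l) 0" using assms by (intro has_mean_ee) auto
  then have "has_mean (\<lambda>t. c * ee l t + p t) (c * 0 + 0)"
    by (intro has_mean_add has_mean_cmult step.IH continuous_intros trig_continuous[OF step(1)])
  then show ?case by simp
qed

text \<open>Means of two approximants differ by at most their sup distance, so they form a Cauchy
  sequence; a three-epsilon argument transfers the limit to \<open>f\<close>.\<close>

lemma APS_mean_exists:
  assumes "f \<in> APS S"
  shows "\<exists>m. has_mean f m"
proof -
  obtain p where p: "\<And>n. p n \<in> trig S" "\<And>n t. cmod (f t - p n t) \<le> 1 / real (Suc n)"
    using APS_sequence[OF assms] by blast
  have "\<exists>m. \<forall>n. has_mean (p n) (m n)"
    using trig_has_mean[OF p(1)] by (intro choice) blast
  then obtain m where m: "\<And>n. has_mean (p n) (m n)" by blast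
  have cf: "continuous_on A f" and cp: "continuous_on A (p n)" for A n
    using APS_continuous[OF assms] trig_continuous[OF p(1)] by auto
  have "cmod (m n - m k) \<le> Re (complex_of_real (1 / real (Suc n) + 1 / real (Suc k)))" for n k
  proof (rule has_mean_norm_le)
    show "has_mean (\<lambda>t. p n t - p k t) (m n - m k)" by (intro has_mean_diff m cp)
    show "has_mean (\<lambda>t. complex_of_real (1 / real (Suc n) + 1 / real (Suc k)))
        (complex_of_real (1 / real (Suc n) + 1 / real (Suc k)))" by (rule has_mean_const)
    show "cmod (p n t - p k t) \<le> Re (complex_of_real (1 / real (Suc n) + 1 / real (Suc k)))" for t
      using norm_triangle_ineq4[of "f t - p k t" "f t - p n t"] p(2)[of t n] p(2)[of t k]
      by simp
  qed (intro continuous_intros cp)+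
  then have d: "dist (m n) (m k) \<le> 1 / real (Suc n) + 1 / real (Suc k)" for n k
    by (simp add: dist_norm)
  have small: "\<exists>N. \<forall>n\<ge>N. 1 / real (Suc n) < e" if e: "e > 0" for e
  proof -
    obtain N where N: "N > 0" "inverse (real N) < e" using ex_inverse_of_nat_less[OF e] by blast
    have "1 / real (Suc n) < e" if "n \<ge> N" for n
    proof -
      have "1 / real (Suc n) \<le> inverse (real N)" using that N by (simp add: field_simps)
      then show ?thesis using N by simp
    qed
    then show ?thesis by blast
  qed
  have "Cauchy m"
  proof (rule metric_CauchyI)
    fix e :: real assume "e > 0"
    then obtain N where N: "\<forall>n\<ge>N. 1 / real (Suc n) < e / 2" using small[of "e / 2"] by auto
    have "dist (m n) (m k) < e" if "n \<ge> N" "k \<ge> N" for n k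
      using d[of n k] N[rule_format, OF that(1)] N[rule_format, OF that(2)] by linarith
    then show "\<exists>M. \<forall>n\<ge>M. \<forall>k\<ge>M. dist (m n) (m k) < e" by blast
  qed
  then obtain M where M: "m \<longlonglongrightarrow> M" using Cauchy_convergent convergent_def by blast
  have "(avg f \<longlongrightarrow> M) at_top"
  proof (rule tendstoI)
    fix e :: real assume e: "e > 0"
    obtain N1 where N1: "\<forall>n\<ge>N1. 1 / real (Suc n) < e / 3" using small[of "e / 3"] e by auto
    obtain N2 where N2: "\<forall>n\<ge>N2. dist (m n) M < e / 3"
      using metric_LIMSEQ_D[OF M, of "e / 3"] e by auto
    define n where "n = max N1 N2"
    have "\<forall>\<^sub>F N in at_top. dist (avg (p n) N) (m n) < e / 3"
      using m[of n] e unfolding has_mean_def by (intro tendstoD) auto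
    moreover have "\<forall>\<^sub>F N::real in at_top. N > 0" by (rule eventually_gt_at_top)
    ultimately show "\<forall>\<^sub>F N in at_top. dist (avg f N) M < e"
    proof eventually_elim
      case (elim N)
      have "cmod (avg (\<lambda>t. f t - p n t) N) \<le> Re (avg (\<lambda>t. complex_of_real (1 / real (Suc n))) N)"
        by (rule norm_avg_le) (use elim p(2)[of _ n] in \<open>auto intro!: continuous_intros cf cp simp del: of_nat_Suc\<close>)
      then have "cmod (avg f N - avg (p n) N) < e / 3"
        using elim N1[rule_format, of n] by (simp add: avg_diff cf cp avg_const n_def)
      then show ?case
        using elim N2[rule_format, of n] norm_triangle_ineq[of "avg f N - avg (p n) N" "avg (p n) N - M"]
          norm_triangle_ineq[of "avg (p n) N - m n" "m n - M"]
        by (simp add: dist_norm n_def)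
    qed
  qed
  then show ?thesis unfolding has_mean_def by blast
qed

lemma APS_mean_zero:
  assumes "f \<in> APS S" "0 \<notin> S"
  shows "has_mean f 0"
proof -
  obtain m where m: "has_mean f m" using APS_mean_exists[OF assms(1)] by blast
  have "cmod m \<le> e" if e: "e > 0" for e
  proof -
    obtain p where p: "p \<in> trig S" "\<And>t. cmod (f t - p t) \<le> e" using APS_D[OF assms(1) e] by blast
    have "cmod (m - 0) \<le> Re (complex_of_real e)"
      by (rule has_mean_norm_le[OF has_mean_diff[OF m trig_mean_zero[OF p(1) assms(2)]] has_mean_const])
        (intro continuous_intros trig_continuous[OF p(1)] APS_continuous[OF assms(1)] | simp add: p(2))+
    then show ?thesis by simp
  qed
  then have "cmod m \<le> 0" by (rule field_le_epsilon[of _ 0, simplified])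
  then show ?thesis using m by simp
qed

text \<open>The variance argument: the mean of \<open>|f - m|^2\<close> equals
  \<open>v - |m|^2\<close> and has nonnegative real part.\<close>

lemma mean_Jensen:
  assumes "f \<in> APS UNIV" "has_mean f m" "has_mean (\<lambda>t. f t * cnj (f t)) v"
  shows "(cmod m)\<^sup>2 \<le> Re v"
proof -
  note c = APS_continuous[OF assms(1)]
  have "has_mean (\<lambda>t. f t * cnj (f t) - cnj m * f t) (v - cnj m * m)"
    by (intro has_mean_diff has_mean_cmult assms continuous_intros c)
  moreover obtain m' where m': "has_mean (\<lambda>t. cnj (f t)) m'"
    using APS_mean_exists[OF APS_cnj_UNIV[OF assms(1)]] by blast
  moreover have "has_mean (\<lambda>t. m * cnj (f t) - m * cnj m) (m * m' - m * cnj m)"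
    by (intro has_mean_diff has_mean_const has_mean_cmult[OF m'] continuous_intros c)
  ultimately have "has_mean (\<lambda>t. (f t * cnj (f t) - cnj m * f t) - (m * cnj (f t) - m * cnj m))
      ((v - cnj m * m) - (m * m' - m * cnj m))"
    by (intro has_mean_diff[of "\<lambda>t. f t * cnj (f t) - cnj m * f t" _ "\<lambda>t. m * cnj (f t) - m * cnj m"]
        continuous_intros c)
  moreover have "m' = cnj m"
  proof -
    have "avg (\<lambda>t. cnj (f t)) N = cnj (avg f N)" for N
      unfolding avg_def by (simp add: integral_cnj)
    then have "has_mean (\<lambda>t. cnj (f t)) (cnj m)"
      using assms(2) unfolding has_mean_def by (subst ext) (auto intro: tendsto_cnj)
    then show ?thesis using m' has_mean_unique by blast
  qed
  ultimately have *: "has_mean (\<lambda>t. (f t * cnj (f t) - cnj m * f t) - (m * cnj (f t) - m * cnj m))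
      (v - m * cnj m)"
    by (simp add: mult.commute[of "cnj m" m])
  have "Re 0 \<le> Re (v - m * cnj m)"
  proof (rule has_mean_Re_le[OF has_mean_const *])
    show "continuous_on UNIV (\<lambda>t::real. 0::complex)" by (intro continuous_intros)
    show "continuous_on UNIV (\<lambda>t. f t * cnj (f t) - cnj m * f t - (m * cnj (f t) - m * cnj m))"
      by (intro continuous_intros c)
    fix t
    have "(f t * cnj (f t) - cnj m * f t) - (m * cnj (f t) - m * cnj m) = (f t - m) * cnj (f t - m)"
      by (simp add: algebra_simps)
    then have "Re ((f t * cnj (f t) - cnj m * f t) - (m * cnj (f t) - m * cnj m)) = (cmod (f t - m))\<^sup>2"
      by (simp only: complex_norm_square[symmetric]) simp
    then show "Re 0 \<le> Re ((f t * cnj (f t) - cnj m * f t) - (m * cnj (f t) - m * cnj m))"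
      by (simp only: zero_complex.sel zero_le_power2)
  qed
  then show ?thesis by (simp add: complex_norm_square[symmetric] del: complex_mult_cnj)
qed

subsection \<open>A positive kernel concentrated near almost periods\<close>

text \<open>Nonnegative coefficients survive products, and additional terms can only increase the
  mean. Nonnegativity of the values is a separate property, proved for Fejer products in
  \<open>fejer_prod_real\<close>.\<close>

inductive_set trig_nn :: "(real \<Rightarrow> complex) set"
  where zero: "(\<lambda>t. 0) \<in> trig_nn"
  | step: "\<lbrakk>p \<in> trig_nn; a \<ge> 0\<rbrakk> \<Longrightarrow> (\<lambda>t. complex_of_real a * ee l t + p t) \<in> trig_nn"

lemma trig_dist_sq: "(\<lambda>t. complex_of_real ((cmod (ee l t - 1))\<^sup>2)) \<in> trig UNIV"
proof -
  have E: "(\<lambda>t. ee l t + (-1) * ee 0 t) \<in> trig UNIV"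
    by (intro trig_add trig_monom trig_ee) auto
  have "(\<lambda>t. complex_of_real ((cmod (ee l t - 1))\<^sup>2)) =
      (\<lambda>t. (ee l t + (-1) * ee 0 t) * cnj (ee l t + (-1) * ee 0 t))"
    by (rule ext) (simp only: complex_norm_square, simp)
  then show ?thesis
    using trig_mult[OF E trig_mono[OF trig_cnj[OF E]], of UNIV UNIV] by simp
qed

lemma trig_nn_trig: "p \<in> trig_nn \<Longrightarrow> p \<in> trig UNIV"
  by (induction rule: trig_nn.induct) (auto intro: trig.intros)

lemma trig_nn_monom: "a \<ge> 0 \<Longrightarrow> (\<lambda>t. complex_of_real a * ee l t) \<in> trig_nn"
  using trig_nn.step[OF trig_nn.zero, of a l] by simp

lemma trig_nn_add:
  assumes "p \<in> trig_nn" "q \<in> trig_nn"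
  shows "(\<lambda>t. p t + q t) \<in> trig_nn"
  using assms(1)
proof induction
  case zero
  then show ?case using assms(2) by simp
next
  case (step p a l)
  then show ?case using trig_nn.step[of "\<lambda>t. p t + q t" a l] by (simp add: add.assoc)
qed

lemma trig_nn_sum: "finite I \<Longrightarrow> (\<And>i. i \<in> I \<Longrightarrow> f i \<in> trig_nn) \<Longrightarrow> (\<lambda>t. \<Sum>i\<in>I. f i t) \<in> trig_nn"
  by (induction rule: finite_induct) (auto intro: trig_nn.zero trig_nn_add)

lemma trig_nn_monom_mult:
  assumes "p \<in> trig_nn" "a \<ge> 0"
  shows "(\<lambda>t. (complex_of_real a * ee l t) * p t) \<in> trig_nn"
  using assms(1)
proof induction
  case zero
  then show ?case by (simp add: trig_nn.zero)
next
  case (step p b m)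
  have "(\<lambda>t. complex_of_real (a * b) * ee (l + m) t + (complex_of_real a * ee l t) * p t) \<in> trig_nn"
    using step assms(2) by (intro trig_nn.step) auto
  then show ?case by (simp add: ee_mult[symmetric] algebra_simps)
qed

lemma trig_nn_mult:
  assumes "p \<in> trig_nn" "q \<in> trig_nn"
  shows "(\<lambda>t. p t * q t) \<in> trig_nn"
  using assms(1)
proof induction
  case zero
  then show ?case by (simp add: trig_nn.zero)
next
  case (step p a l)
  have "(\<lambda>t. (complex_of_real a * ee l t) * q t + p t * q t) \<in> trig_nn"
    using step assms by (intro trig_nn_add trig_nn_monom_mult) auto
  then show ?case by (simp add: algebra_simps)
qed

lemma trig_nn_mean:
  assumes "p \<in> trig_nn" "has_mean p m"
  shows "Re m \<ge> 0" "Im m = 0"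
proof -
  have "\<exists>m. has_mean p m \<and> Re m \<ge> 0 \<and> Im m = 0"
    using assms(1)
  proof induction
    case zero
    then show ?case using has_mean_const[of 0] by force
  next
    case (step p a l)
    then obtain m where m: "has_mean p m" "Re m \<ge> 0" "Im m = 0" by blast
    obtain e where e: "has_mean (ee l) e" "Re e \<ge> 0" "Im e = 0"
    proof (cases "l = 0")
      case True
      have "ee l = (\<lambda>t. 1)" using True by (simp add: fun_eq_iff)
      then show ?thesis using that[of 1] has_mean_const[of 1] by simp
    next
      case False
      then show ?thesis using that[of 0] has_mean_ee by simp
    qed
    have "has_mean (\<lambda>t. complex_of_real a * ee l t + p t) (complex_of_real a * e + m)"
      by (intro has_mean_add has_mean_cmult e m continuous_intros
        trig_continuous[OF trig_nn_trig[OF step(1)]])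
    then show ?case using m e step by (intro exI[of _ "complex_of_real a * e + m"]) auto
  qed
  then show "Re m \<ge> 0" "Im m = 0" using has_mean_unique[OF assms(2)] by auto
qed

text \<open>The Fejer kernel in the variable \<open>l * t\<close>: expanded, the frequency
  \<open>k * l\<close> with \<open>|k| < n\<close> carries the coefficient
  \<open>1 - |k| / n\<close>.\<close>

definition fejer :: "nat \<Rightarrow> real \<Rightarrow> real \<Rightarrow> complex"
  where "fejer n l t = complex_of_real (1 / real n) * ((\<Sum>i<n. ee (real i * l) t) * cnj (\<Sum>i<n. ee (real i * l) t))"

lemma fejer_eq_norm: "fejer n l t = complex_of_real (1 / real n * (cmod (\<Sum>i<n. ee (real i * l) t))\<^sup>2)"
  unfolding fejer_def by (simp only: complex_norm_square[symmetric] of_real_mult)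

text \<open>In the double sum the \<open>n\<close> diagonal pairs contribute \<open>1 / n\<close>
  each, and every off-diagonal pair has the nonnegative coefficient \<open>1 / n\<close>.\<close>

lemma fejer_decomp:
  assumes "n > 0"
  shows "\<exists>q\<in>trig_nn. \<forall>t. fejer n l t = 1 + q t"
proof
  define q where "q = (\<lambda>t. \<Sum>(i, j)\<in>{(i, j). i < n \<and> j < n \<and> i \<noteq> j}.
    complex_of_real (1 / real n) * ee (real i * l - real j * l) t)"
  have fin: "finite {(i, j). i < n \<and> j < n \<and> i \<noteq> j}"
    by (rule finite_subset[of _ "{..<n} \<times> {..<n}"]) auto
  show "q \<in> trig_nn"
    unfolding q_def by (intro trig_nn_sum fin) (auto intro!: trig_nn_monom simp del: of_real_divide)
  show "\<forall>t. fejer n l t = 1 + q t"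
  proof
    fix t
    have "fejer n l t = (\<Sum>(i, j)\<in>{..<n} \<times> {..<n}. complex_of_real (1 / real n) * ee (real i * l - real j * l) t)"
      unfolding fejer_def cnj_sum sum_product unfolding sum_distrib_left unfolding sum.cartesian_product
      by (intro sum.cong refl) (auto simp: cnj_ee ee_mult)
    also have "{..<n} \<times> {..<n} = (\<lambda>i. (i, i)) ` {..<n} \<union> {(i, j). i < n \<and> j < n \<and> i \<noteq> j}"
      by auto
    also have "(\<Sum>(i, j)\<in>(\<lambda>i. (i, i)) ` {..<n} \<union> {(i, j). i < n \<and> j < n \<and> i \<noteq> j}.
        complex_of_real (1 / real n) * ee (real i * l - real j * l) t) =
        (\<Sum>(i, j)\<in>(\<lambda>i. (i, i)) ` {..<n}. complex_of_real (1 / real n) * ee (real i * l - real j * l) t) + q t"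
      unfolding q_def by (rule sum.union_disjoint) (use fin in auto)
    also have "(\<Sum>(i, j)\<in>(\<lambda>i. (i, i)) ` {..<n}. complex_of_real (1 / real n) * ee (real i * l - real j * l) t) = 1"
      using assms by (subst sum.reindex) (auto simp: inj_on_def)
    finally show "fejer n l t = 1 + q t" .
  qed
qed

lemma fejer_trig_nn:
  assumes "n > 0"
  shows "fejer n l \<in> trig_nn"
proof -
  obtain q where q: "q \<in> trig_nn" "\<forall>t. fejer n l t = 1 + q t" using fejer_decomp[OF assms] by blast
  then have "fejer n l = (\<lambda>t. complex_of_real 1 * ee 0 t + q t)" by auto
  then show ?thesis using trig_nn.step[OF q(1), of 1 0] by simp
qed

text \<open>Multiplication by \<open>ee l t - 1\<close> collapses the geometric sum to
  \<open>ee l t ^ n - 1\<close>, whose modulus is at most 2. The 4 is the square of this 2.\<close>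

lemma fejer_concentrated:
  assumes "n > 0"
  shows "Re (fejer n l t) * (cmod (ee l t - 1))\<^sup>2 \<le> 4 / real n"
proof -
  have "(\<Sum>i<n. ee (real i * l) t) * (ee l t - 1) = ee l t ^ n - 1"
  proof -
    have "ee (real i * l) t = ee l t ^ i" for i
      by (simp add: ee_def Complex.DeMoivre algebra_simps)
    then show ?thesis using power_diff_1_eq[of "ee l t" n] by (simp add: mult.commute)
  qed
  then have "cmod (\<Sum>i<n. ee (real i * l) t) * cmod (ee l t - 1) = cmod (ee l t ^ n - 1)"
    by (metis norm_mult)
  also have "\<dots> \<le> 2"
    using norm_triangle_ineq4[of "ee l t ^ n" 1] by (simp add: norm_power)
  finally have "(cmod (\<Sum>i<n. ee (real i * l) t) * cmod (ee l t - 1))\<^sup>2 \<le> 2\<^sup>2"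
    by (intro power_mono) auto
  then show ?thesis
    unfolding fejer_eq_norm using assms by (simp add: power_mult_distrib field_simps)
qed

definition fejer_prod :: "nat \<Rightarrow> real set \<Rightarrow> real \<Rightarrow> complex"
  where "fejer_prod n A t = (\<Prod>l\<in>A. fejer n l t)"

lemma fejer_prod_trig_nn:
  assumes "n > 0"
  shows "fejer_prod n A \<in> trig_nn"
proof (cases "finite A")
  case True
  then show ?thesis
  proof induction
    case empty
    then show ?case using trig_nn_monom[of 1 0] by (simp add: fejer_prod_def[abs_def])
  next
    case (insert l A)
    then show ?case
      using trig_nn_mult[OF fejer_trig_nn[OF assms, of l] insert.IH] by (simp add: fejer_prod_def[abs_def])
  qed
next
  case False
  then show ?thesis using trig_nn_monom[of 1 0] by (simp add: fejer_prod_def[abs_def])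
qed

lemma fejer_prod_insert:
  assumes "n > 0" "finite A" "l \<notin> A"
  shows "\<exists>q\<in>trig_nn. \<forall>t. fejer_prod n (insert l A) t = fejer_prod n A t + q t"
proof -
  obtain q where q: "q \<in> trig_nn" "\<forall>t. fejer n l t = 1 + q t" using fejer_decomp[OF assms(1)] by blast
  show ?thesis
  proof
    show "(\<lambda>t. q t * fejer_prod n A t) \<in> trig_nn"
      by (intro trig_nn_mult q fejer_prod_trig_nn assms)
    show "\<forall>t. fejer_prod n (insert l A) t = fejer_prod n A t + q t * fejer_prod n A t"
      using assms q by (simp add: fejer_prod_def algebra_simps)
  qed
qed

lemma trig_nn_mean_mono:
  assumes "p \<in> trig_nn" "q \<in> trig_nn" "has_mean p m" "has_mean (\<lambda>t. p t + q t) m'"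
  shows "Re m \<le> Re m'"
proof -
  note c = trig_continuous[OF trig_nn_trig]
  have "has_mean (\<lambda>t. (p t + q t) - p t) (m' - m)"
    by (intro has_mean_diff assms continuous_intros c)
  then have "Re (m' - m) \<ge> 0" using trig_nn_mean(1)[OF assms(2), of "m' - m"] by simp
  then show ?thesis by simp
qed

text \<open>Rational relations between the frequencies in \<open>A\<close> can raise the mean above
  1, so only a lower bound is available and \<open>kernel_exists\<close> has to divide by the actual
  mean.\<close>

lemma fejer_prod_mean:
  assumes "n > 0" "finite A"
  shows "\<exists>m\<ge>1. has_mean (fejer_prod n A) (complex_of_real m)"
  using assms(2)
proof induction
  case empty
  then show ?case using has_mean_const[of 1] by (intro exI[of _ 1]) (simp add: fejer_prod_def[abs_def])
next
  case (insert l A)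
  then obtain m where m: "m \<ge> 1" "has_mean (fejer_prod n A) (complex_of_real m)" by blast
  obtain m' where m': "has_mean (fejer_prod n (insert l A)) m'"
    using trig_has_mean[OF trig_nn_trig[OF fejer_prod_trig_nn[OF assms(1)]]] by blast
  obtain q where q: "q \<in> trig_nn" "fejer_prod n (insert l A) = (\<lambda>t. fejer_prod n A t + q t)"
    using fejer_prod_insert[OF assms(1) insert.hyps] by blast
  have "Re (complex_of_real m) \<le> Re m'"
    using trig_nn_mean_mono[OF fejer_prod_trig_nn[OF assms(1)] q(1) m(2)] m' q(2) by simp
  moreover have "Im m' = 0" using trig_nn_mean(2)[OF fejer_prod_trig_nn[OF assms(1)] m'] .
  then have "m' = complex_of_real (Re m')" by (simp add: complex_eq_iff)
  ultimately show ?case using m m' by (intro exI[of _ "Re m'"]) auto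
qed

lemma fejer_prod_real: "fejer_prod n A t = complex_of_real (Re (fejer_prod n A t))" "Re (fejer_prod n A t) \<ge> 0"
proof -
  have "fejer_prod n A t = complex_of_real (\<Prod>l\<in>A. 1 / real n * (cmod (\<Sum>i<n. ee (real i * l) t))\<^sup>2)"
    unfolding fejer_prod_def fejer_eq_norm by simp
  moreover have "(\<Prod>l\<in>A. 1 / real n * (cmod (\<Sum>i<n. ee (real i * l) t))\<^sup>2) \<ge> 0"
    by (intro prod_nonneg) auto
  ultimately show "fejer_prod n A t = complex_of_real (Re (fejer_prod n A t))" "Re (fejer_prod n A t) \<ge> 0"
    by (metis Re_complex_of_real)+
qed

text \<open>Normalising the product of Fejer kernels does not spoil the concentration at any single
  frequency \<open>l\<close>: since all coefficients are nonnegative, dropping the factor belonging to \<open>l\<close>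
  can only decrease the mean.\<close>

lemma kernel_exists:
  assumes "finite A" "e > 0"
  shows "\<exists>K\<in>trig UNIV. (\<forall>t. K t = complex_of_real (Re (K t)) \<and> Re (K t) \<ge> 0) \<and> has_mean K 1 \<and>
    (\<forall>l\<in>A. \<exists>v. has_mean (\<lambda>t. K t * complex_of_real ((cmod (ee l t - 1))\<^sup>2)) v \<and> Re v \<le> e)"
proof -
  obtain n where n: "n > 0" "4 / real n < e"
  proof -
    obtain n where "n > 0" "inverse (real n) < e / 4"
      using ex_inverse_of_nat_less[of "e / 4"] assms by auto
    then show ?thesis using that[of n] by (simp add: field_simps)
  qed
  obtain m where m: "m \<ge> 1" "has_mean (fejer_prod n A) (complex_of_real m)"
    using fejer_prod_mean[OF n(1) assms(1)] by blast
  define K where "K = (\<lambda>t. complex_of_real (1 / m) * fejer_prod n A t)"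
  have F: "fejer_prod n B \<in> trig UNIV" for B
    by (intro trig_nn_trig fejer_prod_trig_nn n)
  have K: "K \<in> trig UNIV"
    using trig_mult[OF trig_monom[of 0 UNIV "1 / m"] F[of A], of UNIV] unfolding K_def by simp
  have K_mean: "has_mean K 1"
    using has_mean_cmult[OF m(2), of "complex_of_real (1 / m)"] m(1) unfolding K_def by simp
  have K_real: "K t = complex_of_real (Re (K t)) \<and> Re (K t) \<ge> 0" for t
  proof -
    have "K t = complex_of_real (1 / m * Re (fejer_prod n A t))"
      unfolding K_def by (subst fejer_prod_real(1)) simp
    then show ?thesis using fejer_prod_real(2)[of n A t] m(1) by simp
  qed
  have "\<exists>v. has_mean (\<lambda>t. K t * complex_of_real ((cmod (ee l t - 1))\<^sup>2)) v \<and> Re v \<le> e" if l: "l \<in> A" for l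
  proof -
    define B where "B = A - {l}"
    have B: "A = insert l B" "finite B" "l \<notin> B" using l assms unfolding B_def by auto
    obtain mB where mB: "mB \<ge> 1" "has_mean (fejer_prod n B) (complex_of_real mB)"
      using fejer_prod_mean[OF n(1) B(2)] by blast
    obtain q where q: "q \<in> trig_nn" "fejer_prod n A = (\<lambda>t. fejer_prod n B t + q t)"
      using fejer_prod_insert[OF n(1) B(2,3)] B(1) by blast
    have "Re (complex_of_real mB) \<le> Re (complex_of_real m)"
      using trig_nn_mean_mono[OF fejer_prod_trig_nn[OF n(1)] q(1) mB(2), of "complex_of_real m"] m(2) q(2) by simp
    then have le: "mB \<le> m" by simp
    have KE: "(\<lambda>t. K t * complex_of_real ((cmod (ee l t - 1))\<^sup>2)) \<in> trig UNIV"
      by (rule trig_mult[OF K trig_dist_sq]) simp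
    then obtain v where v: "has_mean (\<lambda>t. K t * complex_of_real ((cmod (ee l t - 1))\<^sup>2)) v"
      using trig_has_mean by blast
    \<comment> \<open>\<open>fejer_concentrated\<close> absorbs the factor of \<open>l\<close>
      together with the squared distance. The rest is the product over \<open>B\<close>, with mean
      \<open>mB\<close>, and \<open>mB / m\<close> is at most 1.\<close>
    have "Re v \<le> Re (complex_of_real (4 / (n * m)) * complex_of_real mB)"
    proof (rule has_mean_Re_le[OF v has_mean_cmult[OF mB(2)]])
      fix t
      have "K t = complex_of_real (1 / m) * (fejer n l t * fejer_prod n B t)"
        unfolding K_def B(1) using B(2,3) by (simp add: fejer_prod_def)
      also have "\<dots> = complex_of_real (1 / m * (Re (fejer n l t) * Re (fejer_prod n B t)))"
        by (subst fejer_prod_real(1), subst (1 2) fejer_eq_norm) simp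
      finally have "Re (K t * complex_of_real ((cmod (ee l t - 1))\<^sup>2)) =
          1 / m * Re (fejer_prod n B t) * (Re (fejer n l t) * (cmod (ee l t - 1))\<^sup>2)"
        by simp
      also have "\<dots> \<le> 1 / m * Re (fejer_prod n B t) * (4 / real n)"
        using m fejer_prod_real(2) by (intro mult_left_mono fejer_concentrated n) auto
      finally show "Re (K t * complex_of_real ((cmod (ee l t - 1))\<^sup>2)) \<le>
          Re (complex_of_real (4 / (n * m)) * fejer_prod n B t)"
        by (simp add: mult_ac)
    qed (intro continuous_intros trig_continuous[OF KE] trig_continuous[OF F])+
    also have "\<dots> \<le> 4 / n * 1"
      using le mB m n by (simp add: field_simps)
    finally show ?thesis using v n by auto
  qed
  then show ?thesis using K K_mean K_real by blast
qed

subsection \<open>Approximation of functions with Bohr's translation property\<close>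

definition bohr_near :: "real set \<Rightarrow> real \<Rightarrow> real \<Rightarrow> bool"
  where "bohr_near A \<eta> \<tau> \<longleftrightarrow> (\<forall>l\<in>A. cmod (ee l \<tau> - 1) \<le> \<eta>)"

text \<open>Uniform continuity at 0 for the topology given by finitely many characters. Compared
  with a relatively dense set of almost periods, this form supplies the frequencies \<open>A\<close>
  from which the kernel is built, and it passes to logarithms.\<close>

definition bohr_ap :: "(real \<Rightarrow> complex) \<Rightarrow> bool"
  where "bohr_ap f \<longleftrightarrow> continuous_on UNIV f \<and>
    (\<forall>\<epsilon>>0. \<exists>A \<eta>. finite A \<and> \<eta> > 0 \<and> (\<forall>\<tau>. bohr_near A \<eta> \<tau> \<longrightarrow> (\<forall>t. cmod (f (t + \<tau>) - f t) \<le> \<epsilon>)))"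

lemma trig_bohr:
  assumes "p \<in> trig S" "\<epsilon> > 0"
  shows "\<exists>A \<eta>. finite A \<and> \<eta> > 0 \<and> (\<forall>\<tau>. bohr_near A \<eta> \<tau> \<longrightarrow> (\<forall>t. cmod (p (t + \<tau>) - p t) \<le> \<epsilon>))"
  using assms
proof (induction arbitrary: \<epsilon>)
  case zero
  then show ?case by (intro exI[of _ "{}"] exI[of _ 1]) auto
next
  case (step p l c)
  obtain A \<eta> where A: "finite A" "\<eta> > 0" "\<And>\<tau> t. bohr_near A \<eta> \<tau> \<Longrightarrow> cmod (p (t + \<tau>) - p t) \<le> \<epsilon> / 2"
    using step.IH[of "\<epsilon> / 2"] step.prems by auto
  \<comment> \<open>The added 1 keeps the quotient meaningful for \<open>c = 0\<close>.\<close>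
  define \<delta> where "\<delta> = min \<eta> (\<epsilon> / (2 * (cmod c + 1)))"
  have d: "\<delta> > 0" unfolding \<delta>_def using A step.prems by (auto intro!: divide_pos_pos add_nonneg_pos)
  have "cmod (c * ee l (t + \<tau>) + p (t + \<tau>) - (c * ee l t + p t)) \<le> \<epsilon>"
    if b: "bohr_near (insert l A) \<delta> \<tau>" for \<tau> t
  proof -
    have "bohr_near A \<eta> \<tau>" using b unfolding bohr_near_def \<delta>_def by auto
    then have 1: "cmod (p (t + \<tau>) - p t) \<le> \<epsilon> / 2" by (rule A)
    have "cmod (ee l \<tau> - 1) \<le> \<epsilon> / (2 * (cmod c + 1))" using b unfolding bohr_near_def \<delta>_def by auto
    then have "cmod c * cmod (ee l \<tau> - 1) \<le> (cmod c + 1) * (\<epsilon> / (2 * (cmod c + 1)))"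
      by (intro mult_mono) auto
    also have "\<dots> = \<epsilon> / 2" using norm_ge_zero[of c] by (simp add: field_simps add_nonneg_eq_0_iff)
    also have "cmod c * cmod (ee l \<tau> - 1) = cmod (c * ee l t * (ee l \<tau> - 1))" by (simp add: norm_mult)
    finally have 2: "cmod (c * ee l t * (ee l \<tau> - 1)) \<le> \<epsilon> / 2" .
    have eq: "c * ee l (t + \<tau>) + p (t + \<tau>) - (c * ee l t + p t) = c * ee l t * (ee l \<tau> - 1) + (p (t + \<tau>) - p t)"
      by (simp add: ee_add_arg algebra_simps)
    show ?thesis
      unfolding eq using 1 2 norm_triangle_ineq[of "c * ee l t * (ee l \<tau> - 1)" "p (t + \<tau>) - p t"] by linarith
  qed
  then show ?case using A(1) d by (intro exI[of _ "insert l A"] exI[of _ \<delta>]) auto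
qed

lemma APS_bohr_ap:
  assumes "f \<in> APS S"
  shows "bohr_ap f"
  unfolding bohr_ap_def
proof (intro conjI allI impI)
  show "continuous_on UNIV f" by (rule APS_continuous[OF assms])
  fix \<epsilon> :: real assume e: "\<epsilon> > 0"
  obtain p where p: "p \<in> trig S" "\<And>t. cmod (f t - p t) \<le> \<epsilon> / 3"
    using APS_D[OF assms, of "\<epsilon> / 3"] e by auto
  obtain A \<eta> where A: "finite A" "\<eta> > 0" "\<And>\<tau> t. bohr_near A \<eta> \<tau> \<Longrightarrow> cmod (p (t + \<tau>) - p t) \<le> \<epsilon> / 3"
    using trig_bohr[OF p(1), of "\<epsilon> / 3"] e by auto
  have "cmod (f (t + \<tau>) - f t) \<le> \<epsilon>" if "bohr_near A \<eta> \<tau>" for \<tau> t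
    using A(3)[OF that, of t] p(2)[of t] p(2)[of "t + \<tau>"]
      norm_triangle_ineq4[of "f (t + \<tau>) - p (t + \<tau>)" "f t - p t"]
      norm_triangle_ineq[of "f (t + \<tau>) - p (t + \<tau>) - (f t - p t)" "p (t + \<tau>) - p t"]
    by simp
  then show "\<exists>A \<eta>. finite A \<and> \<eta> > 0 \<and> (\<forall>\<tau>. bohr_near A \<eta> \<tau> \<longrightarrow> (\<forall>t. cmod (f (t + \<tau>) - f t) \<le> \<epsilon>))"
    using A(1,2) by blast
qed

text \<open>Bohr neighbourhoods are syndetic, by total boundedness of the torus.\<close>

lemma bohr_near_syndetic:
  assumes "finite A" "\<eta> > 0"
  shows "\<exists>F. finite F \<and> (\<forall>t. \<exists>s\<in>F. bohr_near A \<eta> (t - s))"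
proof -
  obtain C where C: "finite C" "sphere (0::complex) 1 \<subseteq> (\<Union>c\<in>C. ball c (\<eta> / 2))"
    using compact_sphere[of "0::complex" 1] assms(2) unfolding compact_eq_totally_bounded
    by (meson half_gt_zero)
  have "\<exists>c. \<forall>z\<in>sphere (0::complex) 1. c z \<in> C \<and> z \<in> ball (c z) (\<eta> / 2)"
  proof (intro bchoice ballI)
    fix z :: complex assume "z \<in> sphere 0 1"
    then have "z \<in> (\<Union>c\<in>C. ball c (\<eta> / 2))" using C(2) by (rule subsetD[rotated])
    then show "\<exists>c. c \<in> C \<and> z \<in> ball c (\<eta> / 2)" by blast
  qed
  then obtain c where c: "\<And>z. cmod z = 1 \<Longrightarrow> c z \<in> C \<and> z \<in> ball (c z) (\<eta> / 2)" by (metis mem_sphere_0)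
  \<comment> \<open>\<open>\<phi> t\<close> records a covering ball for each \<open>ee l t\<close>.
    It takes finitely many values, and one representative of each value is enough: points with equal
    records differ by an element of the Bohr neighbourhood.\<close>
  define \<phi> where "\<phi> = (\<lambda>t. \<lambda>l\<in>A. c (ee l t))"
  have "range \<phi> \<subseteq> A \<rightarrow>\<^sub>E C" unfolding \<phi>_def using c by auto
  then have fin: "finite (range \<phi>)"
    using finite_subset finite_PiE[OF assms(1), of "\<lambda>_. C"] C(1) by blast
  define F where "F = inv_into UNIV \<phi> ` range \<phi>"
  have "\<exists>s\<in>F. bohr_near A \<eta> (t - s)" for t
  proof
    show "inv_into UNIV \<phi> (\<phi> t) \<in> F" unfolding F_def by blast
    define s where "s = inv_into UNIV \<phi> (\<phi> t)"
    have s: "\<phi> s = \<phi> t" unfolding s_def by (simp add: f_inv_into_f)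
    show "bohr_near A \<eta> (t - inv_into UNIV \<phi> (\<phi> t))"
      unfolding bohr_near_def s_def[symmetric]
    proof
      fix l assume l: "l \<in> A"
      then have "c (ee l s) = c (ee l t)" using s unfolding \<phi>_def by (metis restrict_apply')
      then have "dist (ee l t) (ee l s) < \<eta>"
        using c[of "ee l s"] c[of "ee l t"] dist_triangle_half_r[of "c (ee l t)" "ee l t" \<eta> "ee l s"] by auto
      moreover have "ee l (t - s) - 1 = (ee l t - ee l s) * ee (- l) s"
        by (simp add: ee_diff_arg algebra_simps ee_mult)
      ultimately show "cmod (ee l (t - s) - 1) \<le> \<eta>" by (simp add: norm_mult dist_norm)
    qed
  qed
  then show ?thesis using fin unfolding F_def by blast
qed

text \<open>Up to an error of 1, every value is a value at one of the finitely many representatives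
  in \<open>F\<close>.\<close>

lemma bohr_ap_bounded:
  assumes "bohr_ap f"
  shows "\<exists>B>0. \<forall>t. cmod (f t) \<le> B"
proof -
  obtain A \<eta> where A: "finite A" "\<eta> > 0" "\<And>\<tau> t. bohr_near A \<eta> \<tau> \<Longrightarrow> cmod (f (t + \<tau>) - f t) \<le> 1"
    using assms unfolding bohr_ap_def by (metis zero_less_one)
  obtain F where F: "finite F" "\<And>t. \<exists>s\<in>F. bohr_near A \<eta> (t - s)"
    using bohr_near_syndetic[OF A(1,2)] by blast
  have "cmod (f t) \<le> (\<Sum>s\<in>F. cmod (f s)) + 1" for t
  proof -
    obtain s where s: "s \<in> F" "bohr_near A \<eta> (t - s)" using F by blast
    have "cmod (f t) \<le> cmod (f s) + 1"
      using A(3)[OF s(2), of s] norm_triangle_ineq[of "f t - f s" "f s"] by simp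
    moreover have "cmod (f s) \<le> (\<Sum>s\<in>F. cmod (f s))"
      by (rule member_le_sum) (use s F in auto)
    ultimately show ?thesis by simp
  qed
  moreover have "(\<Sum>s\<in>F. cmod (f s)) + 1 > 0" by (simp add: sum_nonneg add_nonneg_pos)
  ultimately show ?thesis by blast
qed

text \<open>Only the frequency 0 contributes to the mean, and its term is unchanged by
  \<open>s |-> x - s\<close>; every other term becomes a multiple of a nonconstant character. A
  change of variables would shift the averaging window instead.\<close>

lemma trig_mean_reflect:
  assumes "p \<in> trig S" "has_mean p m"
  shows "has_mean (\<lambda>s. p (x - s)) m"
proof -
  have "\<exists>m. has_mean p m \<and> has_mean (\<lambda>s. p (x - s)) m"
    using assms(1)
  proof induction
    case zero
    then show ?case using has_mean_const by blast
  next
    case (step p l c)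
    then obtain m where m: "has_mean p m" "has_mean (\<lambda>s. p (x - s)) m" by blast
    obtain e where e: "has_mean (\<lambda>t. ee l t) e" "has_mean (\<lambda>s. ee l (x - s)) e"
    proof (cases "l = 0")
      case True
      then show ?thesis using that[of 1] has_mean_const[of 1] by simp
    next
      case False
      then have "has_mean (ee (- l)) 0" by (intro has_mean_ee) simp
      then have "has_mean (\<lambda>s. ee l (x - s)) 0"
        using has_mean_cmult[of "ee (- l)" 0 "ee l x"] by (simp add: ee_diff_arg)
      then show ?thesis using that[of 0] has_mean_ee[OF False] by simp
    qed
    have "has_mean (\<lambda>t. c * ee l t + p t) (c * e + m)"
      by (intro has_mean_add has_mean_cmult e m continuous_intros trig_continuous[OF step(1)])
    moreover have "has_mean (\<lambda>s. c * ee l (x - s) + p (x - s)) (c * e + m)"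
      by (intro has_mean_add has_mean_cmult e m continuous_intros
        continuous_on_compose2[OF trig_continuous[OF step(1), of UNIV]]
        continuous_on_compose2[OF continuous_on_ee[of UNIV l]]) auto
    ultimately show ?case by blast
  qed
  then show ?thesis using has_mean_unique[OF assms(2)] by auto
qed

text \<open>The approximant is the convolution of \<open>f\<close> with the kernel. Its coefficients are limits along
  a sequence \<open>T\<close>, so existence of the means of \<open>f\<close> is not presupposed.\<close>

lemma bohr_ap_approx:
  assumes f: "bohr_ap f" and e: "\<epsilon> > 0"
  shows "\<exists>(n::nat) k m. \<forall>T c. filterlim T at_top sequentially \<longrightarrow>
    (\<forall>i<n. (\<lambda>j. avg (\<lambda>s. f s * ee (- m i) s) (T j)) \<longlonglongrightarrow> c i) \<longrightarrow>
    (\<forall>x. cmod (f x - (\<Sum>i<n. (k i * c i) * ee (m i) x)) \<le> \<epsilon>)"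
proof -
  have cf: "continuous_on UNIV f" using f unfolding bohr_ap_def by blast
  obtain B where B: "B > 0" "\<And>t. cmod (f t) \<le> B" using bohr_ap_bounded[OF f] by blast
  obtain A \<eta> where A: "finite A" "\<eta> > 0" "\<And>\<tau> t. bohr_near A \<eta> \<tau> \<Longrightarrow> cmod (f (t + \<tau>) - f t) \<le> \<epsilon> / 2"
    using f e unfolding bohr_ap_def by (metis half_gt_zero)
  \<comment> \<open>Chosen so that \<open>card A\<close> copies of
    \<open>2 * B / \<eta>\<^sup>2 * e2\<close> add up to at most \<open>\<epsilon> / 2\<close>; the
    added 1 covers an empty \<open>A\<close>.\<close>
  define e2 where "e2 = \<epsilon> * \<eta>\<^sup>2 / (4 * B * (real (card A) + 1))"
  have e2: "e2 > 0" unfolding e2_def using e A B by (intro divide_pos_pos mult_pos_pos) auto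
  obtain K where K: "K \<in> trig UNIV" "\<And>t. K t = complex_of_real (Re (K t))" "\<And>t. Re (K t) \<ge> 0" "has_mean K 1"
    "\<forall>l\<in>A. \<exists>v. has_mean (\<lambda>t. K t * complex_of_real ((cmod (ee l t - 1))\<^sup>2)) v \<and> Re v \<le> e2"
    using kernel_exists[OF A(1) e2] by blast
  obtain n k m where Ks: "K = (\<lambda>t. \<Sum>i<(n::nat). k i * ee (m i) t)"
    using trig_sum_repr[OF K(1)] by blast
  note cK = trig_continuous[OF K(1)]
  have "cmod (f x - (\<Sum>i<n. (k i * c i) * ee (m i) x)) \<le> \<epsilon>"
    if T: "filterlim T at_top sequentially"
      and c: "\<forall>i<n. (\<lambda>j. avg (\<lambda>s. f s * ee (- m i) s) (T j)) \<longlonglongrightarrow> c i" for T c x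
  proof -
    have cKx: "continuous_on UNIV (\<lambda>s. K (x - s))"
      by (intro continuous_on_compose2[OF cK] continuous_intros) auto
    define W where "W = (\<lambda>l s. K (x - s) * complex_of_real ((cmod (ee l (x - s) - 1))\<^sup>2))"
    have cW: "continuous_on UNIV (W l)" for l
      unfolding W_def by (intro continuous_intros cKx continuous_on_compose2[OF continuous_on_ee]) auto
    have "\<exists>v. \<forall>l\<in>A. has_mean (W l) (v l) \<and> Re (v l) \<le> e2"
    proof (intro bchoice ballI)
      fix l assume "l \<in> A"
      then obtain v where v: "has_mean (\<lambda>t. K t * complex_of_real ((cmod (ee l t - 1))\<^sup>2)) v" "Re v \<le> e2"
        using K(5) by blast
      have "(\<lambda>t. K t * complex_of_real ((cmod (ee l t - 1))\<^sup>2)) \<in> trig UNIV"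
        by (rule trig_mult[OF K(1) trig_dist_sq]) simp
      then have "has_mean (W l) v" unfolding W_def by (rule trig_mean_reflect[OF _ v(1)])
      then show "\<exists>v. has_mean (W l) v \<and> Re v \<le> e2" using v by blast
    qed
    then obtain v where v: "\<And>l. l \<in> A \<Longrightarrow> has_mean (W l) (v l)" "\<And>l. l \<in> A \<Longrightarrow> Re (v l) \<le> e2" by blast
    \<comment> \<open>A majorant of \<open>|f s - f x| * K (x - s)\<close>. If \<open>x - s\<close>
      lies in the Bohr neighbourhood, the first summand suffices. Otherwise some \<open>l\<close> in
      \<open>A\<close> violates the bound \<open>\<eta>\<close>, and its summand dominates
      \<open>2 * B * K (x - s)\<close>.\<close>
    define H where "H = (\<lambda>s. complex_of_real (\<epsilon> / 2) * K (x - s) + (\<Sum>l\<in>A. complex_of_real (2 * B / \<eta>\<^sup>2) * W l s))"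
    have cH: "continuous_on UNIV H"
      unfolding H_def by (intro continuous_intros cKx cW)
    have mH: "has_mean H (complex_of_real (\<epsilon> / 2) * 1 + (\<Sum>l\<in>A. complex_of_real (2 * B / \<eta>\<^sup>2) * v l))"
      unfolding H_def
      by (intro has_mean_add has_mean_cmult has_mean_sum trig_mean_reflect[OF K(1,4)] A v continuous_intros cKx cW)
    have "Re (complex_of_real (\<epsilon> / 2) * 1 + (\<Sum>l\<in>A. complex_of_real (2 * B / \<eta>\<^sup>2) * v l))
        = \<epsilon> / 2 + (\<Sum>l\<in>A. 2 * B / \<eta>\<^sup>2 * Re (v l))" by simp
    also have "\<dots> \<le> \<epsilon> / 2 + (\<Sum>l\<in>A. 2 * B / \<eta>\<^sup>2 * e2)"
      using v(2) B A by (intro add_left_mono sum_mono mult_left_mono) auto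
    also have "\<dots> = \<epsilon> / 2 + \<epsilon> / 2 * (real (card A) / (real (card A) + 1))"
    proof -
      have "2 * B / \<eta>\<^sup>2 * (\<epsilon> * \<eta>\<^sup>2 / (4 * B * X)) = \<epsilon> / 2 / X" if "X > 0" for X
        using that A(2) B(1) by (simp add: field_simps)
      then have "2 * B / \<eta>\<^sup>2 * e2 = \<epsilon> / 2 / (real (card A) + 1)" unfolding e2_def by simp
      then show ?thesis by simp
    qed
    also have "\<dots> \<le> \<epsilon> / 2 + \<epsilon> / 2 * 1"
      using e by (intro add_left_mono mult_left_mono) (auto simp: field_simps)
    finally have vH: "Re (complex_of_real (\<epsilon> / 2) * 1 + (\<Sum>l\<in>A. complex_of_real (2 * B / \<eta>\<^sup>2) * v l)) \<le> \<epsilon>"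
      by simp
    have pt: "cmod (f s * K (x - s) - f x * K (x - s)) \<le> Re (H s)" for s
    proof -
      have W0: "Re (W l s) = Re (K (x - s)) * (cmod (ee l (x - s) - 1))\<^sup>2" for l
        unfolding W_def by simp
      have W0': "Re (W l s) \<ge> 0" for l unfolding W0 using K(3) by simp
      have HR: "Re (H s) = \<epsilon> / 2 * Re (K (x - s)) + (\<Sum>l\<in>A. 2 * B / \<eta>\<^sup>2 * Re (W l s))"
        unfolding H_def by simp
      have "cmod (K (x - s)) = Re (K (x - s))" using K(2,3)[of "x - s"] by (metis abs_of_nonneg norm_of_real)
      then have n: "cmod (f s * K (x - s) - f x * K (x - s)) = cmod (f s - f x) * Re (K (x - s))"
        by (metis left_diff_distrib norm_mult)
      show ?thesis
      proof (cases "bohr_near A \<eta> (x - s)")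
        case True
        have "cmod (f s - f x) \<le> \<epsilon> / 2"
          using A(3)[OF True, of s] by (simp add: norm_minus_commute)
        then have "cmod (f s - f x) * Re (K (x - s)) \<le> \<epsilon> / 2 * Re (K (x - s))"
          using K(3) by (intro mult_right_mono)
        moreover have "(\<Sum>l\<in>A. 2 * B / \<eta>\<^sup>2 * Re (W l s)) \<ge> 0"
          using W0' B by (intro sum_nonneg) auto
        ultimately show ?thesis unfolding n HR by linarith
      next
        case False
        then obtain l where l: "l \<in> A" "cmod (ee l (x - s) - 1) > \<eta>"
          unfolding bohr_near_def by auto
        have "\<eta>\<^sup>2 \<le> (cmod (ee l (x - s) - 1))\<^sup>2" using l A by (intro power_mono) auto
        then have "1 \<le> (cmod (ee l (x - s) - 1))\<^sup>2 / \<eta>\<^sup>2" using A by (simp add: field_simps)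
        then have "2 * B * Re (K (x - s)) * 1 \<le> 2 * B * Re (K (x - s)) * ((cmod (ee l (x - s) - 1))\<^sup>2 / \<eta>\<^sup>2)"
          using B K(3) by (intro mult_left_mono) auto
        also have "\<dots> = 2 * B / \<eta>\<^sup>2 * Re (W l s)" unfolding W0 by simp
        also have "\<dots> \<le> (\<Sum>l\<in>A. 2 * B / \<eta>\<^sup>2 * Re (W l s))"
          using W0' B l A by (intro member_le_sum[where f = "\<lambda>l. 2 * B / \<eta>\<^sup>2 * Re (W l s)"]) auto
        finally have "2 * B * Re (K (x - s)) \<le> (\<Sum>l\<in>A. 2 * B / \<eta>\<^sup>2 * Re (W l s))" by simp
        moreover have "cmod (f s - f x) \<le> 2 * B"
          using norm_triangle_ineq4[of "f s" "f x"] B(2)[of s] B(2)[of x] by simp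
        then have "cmod (f s - f x) * Re (K (x - s)) \<le> 2 * B * Re (K (x - s))"
          using K(3) by (intro mult_right_mono)
        moreover have "\<epsilon> / 2 * Re (K (x - s)) \<ge> 0" using K(3) e by simp
        ultimately show ?thesis unfolding n HR by linarith
      qed
    qed
    have c1: "continuous_on UNIV (\<lambda>s. f s * K (x - s))" and c2: "continuous_on UNIV (\<lambda>s. f x * K (x - s))"
      by (intro continuous_intros cf cKx)+
    have le: "cmod (avg (\<lambda>s. f s * K (x - s)) N - f x * avg (\<lambda>s. K (x - s)) N) \<le> Re (avg H N)" if "N > 0" for N
      using norm_avg_le[OF continuous_on_diff[OF c1 c2] cH pt that] avg_diff[OF c1 c2, of N]
      by (simp add: avg_cmult)
    \<comment> \<open>Expanding \<open>K\<close> makes the averaged convolution a trigonometric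
      polynomial in \<open>x\<close>, with the averages assumed to converge as coefficients.\<close>
    have avgK: "avg (\<lambda>s. f s * K (x - s)) N = (\<Sum>i<n. k i * ee (m i) x * avg (\<lambda>s. f s * ee (- m i) s) N)" for N
    proof -
      have "(\<lambda>s. f s * K (x - s)) = (\<lambda>s. \<Sum>i<n. (k i * ee (m i) x) * (f s * ee (- m i) s))"
        unfolding Ks by (auto simp: ee_diff_arg sum_distrib_left mult_ac intro!: sum.cong)
      then show ?thesis
        by (simp only:) (subst avg_sum, auto simp: avg_cmult intro!: continuous_intros cf)
    qed
    have "(\<lambda>j. avg (\<lambda>s. f s * K (x - s)) (T j)) \<longlonglongrightarrow> (\<Sum>i<n. k i * ee (m i) x * c i)"
      unfolding avgK by (intro tendsto_intros) (use c in auto)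
    moreover have "(\<lambda>j. avg (\<lambda>s. K (x - s)) (T j)) \<longlonglongrightarrow> 1"
      using trig_mean_reflect[OF K(1,4), of x] T unfolding has_mean_def by (rule filterlim_compose)
    ultimately have "(\<lambda>j. cmod (avg (\<lambda>s. f s * K (x - s)) (T j) - f x * avg (\<lambda>s. K (x - s)) (T j)))
        \<longlonglongrightarrow> cmod ((\<Sum>i<n. k i * ee (m i) x * c i) - f x * 1)"
      by (intro tendsto_intros)
    moreover have "(\<lambda>j. Re (avg H (T j))) \<longlonglongrightarrow>
        Re (complex_of_real (\<epsilon> / 2) * 1 + (\<Sum>l\<in>A. complex_of_real (2 * B / \<eta>\<^sup>2) * v l))"
      by (intro tendsto_Re filterlim_compose[OF mH[unfolded has_mean_def] T])
    moreover have "\<forall>\<^sub>F j in sequentially. T j > 0"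
      using T by (simp add: filterlim_at_top_dense)
    then have "\<forall>\<^sub>F j in sequentially. cmod (avg (\<lambda>s. f s * K (x - s)) (T j) - f x * avg (\<lambda>s. K (x - s)) (T j))
        \<le> Re (avg H (T j))"
      by eventually_elim (rule le)
    ultimately have "cmod ((\<Sum>i<n. k i * ee (m i) x * c i) - f x * 1) \<le>
        Re (complex_of_real (\<epsilon> / 2) * 1 + (\<Sum>l\<in>A. complex_of_real (2 * B / \<eta>\<^sup>2) * v l))"
      by - (rule tendsto_le[OF sequentially_bot]; assumption)
    then have "cmod ((\<Sum>i<n. k i * ee (m i) x * c i) - f x) \<le> \<epsilon>" using vH by simp
    then show ?thesis by (simp add: norm_minus_commute mult_ac)
  qed
  then show ?thesis by blast
qed

lemma convergent_subseq_finite: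
  fixes a :: "nat \<Rightarrow> nat \<Rightarrow> complex"
  assumes "\<And>i j. i < n \<Longrightarrow> cmod (a i j) \<le> B"
  shows "\<exists>r. strict_mono r \<and> (\<forall>i<n. convergent (\<lambda>j. a i (r j)))"
  using assms
proof (induction n)
  case 0
  show ?case by (intro exI[of _ id]) (auto simp: strict_mono_def)
next
  case (Suc n)
  then obtain r where r: "strict_mono r" "\<forall>i<n. convergent (\<lambda>j. a i (r j))"
    using less_SucI by blast
  have "bounded (range (\<lambda>j. a n (r j)))" using Suc.prems[of n] by (auto simp: bounded_iff)
  then obtain l s where s: "strict_mono s" "((\<lambda>j. a n (r j)) \<circ> s) \<longlonglongrightarrow> l"
    using bounded_imp_convergent_subsequence by blast
  have "convergent (\<lambda>j. a i ((r \<circ> s) j))" if "i < Suc n" for i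
  proof (cases "i = n")
    case True
    then show ?thesis using s(2) by (auto simp: convergent_def o_def)
  next
    case False
    then have "convergent (\<lambda>j. a i (r j))" using r that by auto
    then show ?thesis using convergent_subseq_convergent[OF _ s(1)] by (auto simp: o_def)
  qed
  then show ?case using strict_mono_o[OF r(1) s(1)] by blast
qed

text \<open>Only finitely many frequencies occur in the approximant, and their averages are bounded;
  a common subsequence along which they converge replaces the unknown means.\<close>

lemma bohr_ap_APS:
  assumes f: "bohr_ap f"
  shows "f \<in> APS UNIV"
  unfolding APS_def
proof safe
  fix \<epsilon> :: real assume e: "\<epsilon> > 0"
  have cf: "continuous_on UNIV f" using f unfolding bohr_ap_def by blast
  obtain B where B: "B > 0" "\<And>t. cmod (f t) \<le> B" using bohr_ap_bounded[OF f] by blast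
  obtain n k m where nkm: "\<And>T c x. \<lbrakk>filterlim T at_top sequentially;
    \<forall>i<(n::nat). (\<lambda>j. avg (\<lambda>s. f s * ee (- m i) s) (T j)) \<longlonglongrightarrow> c i\<rbrakk> \<Longrightarrow>
    cmod (f x - (\<Sum>i<n. (k i * c i) * ee (m i) x)) \<le> \<epsilon>"
    using bohr_ap_approx[OF f e] by blast
  \<comment> \<open>\<open>Suc\<close> keeps the averaging window nondegenerate.\<close>
  have "cmod (avg (\<lambda>s. f s * ee (- m i) s) (real (Suc j))) \<le> B" for i j
  proof -
    have "cmod (avg (\<lambda>s. f s * ee (- m i) s) (real (Suc j))) \<le> Re (avg (\<lambda>s. complex_of_real B) (real (Suc j)))"
      by (rule norm_avg_le) (auto intro!: continuous_intros cf simp: norm_mult B)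
    then show ?thesis by (subst (asm) avg_const) auto
  qed
  then obtain r where r: "strict_mono r" "\<forall>i<n. convergent (\<lambda>j. avg (\<lambda>s. f s * ee (- m i) s) (real (Suc (r j))))"
    using convergent_subseq_finite[of n "\<lambda>i j. avg (\<lambda>s. f s * ee (- m i) s) (real (Suc j))" B] by auto
  define c where "c = (\<lambda>i. lim (\<lambda>j. avg (\<lambda>s. f s * ee (- m i) s) (real (Suc (r j)))))"
  have "filterlim (\<lambda>j. real (Suc (r j))) at_top sequentially"
    by (intro filterlim_compose[OF filterlim_real_sequentially] filterlim_compose[OF filterlim_Suc]
      filterlim_subseq r)
  moreover have "\<forall>i<n. (\<lambda>j. avg (\<lambda>s. f s * ee (- m i) s) (real (Suc (r j)))) \<longlonglongrightarrow> c i"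
    using r(2) by (simp add: c_def convergent_LIMSEQ_iff)
  ultimately have "cmod (f x - (\<Sum>i<n. (k i * c i) * ee (m i) x)) \<le> \<epsilon>" for x
    by (rule nkm)
  then show "\<exists>p\<in>trig UNIV. \<forall>t. cmod (f t - p t) \<le> \<epsilon>"
    by (intro bexI[OF _ trig_sum[of n m UNIV "\<lambda>i. k i * c i"]]) auto
qed

text \<open>The kernel approximant has the coefficients \<open>k i * c i\<close>, where
  \<open>c i\<close> is a Fourier coefficient of \<open>f\<close> and vanishes off \<open>S\<close>.
  These zero terms are relabelled with the frequency 0, which belongs to \<open>S\<close>.\<close>

lemma APS_spectrum:
  assumes f: "f \<in> APS UNIV" and "0 \<in> S" and S: "\<And>l. l \<notin> S \<Longrightarrow> has_mean (\<lambda>s. f s * ee (- l) s) 0"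
  shows "f \<in> APS S"
  unfolding APS_def
proof safe
  fix \<epsilon> :: real assume e: "\<epsilon> > 0"
  obtain n k m where nkm: "\<And>T c x. \<lbrakk>filterlim T at_top sequentially;
    \<forall>i<(n::nat). (\<lambda>j. avg (\<lambda>s. f s * ee (- m i) s) (T j)) \<longlonglongrightarrow> c i\<rbrakk> \<Longrightarrow>
    cmod (f x - (\<Sum>i<n. (k i * c i) * ee (m i) x)) \<le> \<epsilon>"
    using bohr_ap_approx[OF APS_bohr_ap[OF f] e] by blast
  have "\<forall>i. \<exists>c. has_mean (\<lambda>s. f s * ee (- m i) s) c \<and> (m i \<notin> S \<longrightarrow> c = 0)"
    using S APS_mean_exists[OF APS_mult_UNIV[OF f APS_trig[OF trig_ee]]] by blast
  then obtain c where c: "\<And>i. has_mean (\<lambda>s. f s * ee (- m i) s) (c i)" "\<And>i. m i \<notin> S \<Longrightarrow> c i = 0"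
    by metis
  have *: "cmod (f x - (\<Sum>i<n. (k i * c i) * ee (m i) x)) \<le> \<epsilon>" for x
  proof (rule nkm)
    show "filterlim real at_top sequentially" by (rule filterlim_real_sequentially)
    show "\<forall>i<n. (\<lambda>j. avg (\<lambda>s. f s * ee (- m i) s) (real j)) \<longlonglongrightarrow> c i"
      using c(1) filterlim_compose[OF _ filterlim_real_sequentially] unfolding has_mean_def by blast
  qed
  have "(\<Sum>i<n. (k i * c i) * ee (m i) x) = (\<Sum>i<n. (k i * c i) * ee (if m i \<in> S then m i else 0) x)" for x
    using c(2) by (intro sum.cong) auto
  then show "\<exists>p\<in>trig S. \<forall>t. cmod (f t - p t) \<le> \<epsilon>"
    using * by (intro bexI[OF _ trig_sum[of n "\<lambda>i. if m i \<in> S then m i else 0" S "\<lambda>i. k i * c i"]])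
      (auto simp: assms(2))
qed

lemma APS_coeff_zero:
  assumes "f \<in> APS S" "l \<notin> S"
  shows "has_mean (\<lambda>s. f s * ee (- l) s) 0"
proof (rule APS_mean_zero)
  show "(\<lambda>s. f s * ee (- l) s) \<in> APS (UNIV - {0})"
    by (rule APS_mult[OF assms(1) APS_trig[OF trig_ee[of "- l" "{- l}"]]]) (use assms in auto)
qed simp

subsection \<open>Logarithms of almost periodic functions\<close>

text \<open>The values lie in the integer multiples of \<open>2 * pi * \<i>\<close>, a set with gaps
  of length \<open>2 * pi\<close>, while the line is connected.\<close>

lemma exp_eq_1_constant:
  fixes h :: "real \<Rightarrow> complex"
  assumes "continuous_on UNIV h" "\<And>t. exp (h t) = 1"
  shows "h s = h t"
proof -
  have "h constant_on UNIV"
  proof (rule continuous_discrete_range_constant)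
    show "connected (UNIV :: real set)" by (rule connected_UNIV)
    fix x :: real
    have "2 * pi \<le> norm (h y - h x)" if ne: "h y \<noteq> h x" for y
    proof -
      obtain n m :: int where "Re (h y) = 0" "Im (h y) = of_int (2 * n) * pi"
        "Re (h x) = 0" "Im (h x) = of_int (2 * m) * pi"
        using assms(2)[of x] assms(2)[of y] unfolding exp_eq_1 by blast
      then have "h y - h x = complex_of_real (2 * pi * of_int (n - m)) * \<i>"
        by (simp add: complex_eq_iff algebra_simps)
      moreover from this have "n - m \<noteq> 0" using ne by auto
      then have "1 \<le> \<bar>of_int (n - m) :: real\<bar>" by linarith
      ultimately show ?thesis by (simp add: norm_mult abs_mult del: of_int_diff)
    qed
    then show "\<exists>e>0. \<forall>y. y \<in> UNIV \<and> h y \<noteq> h x \<longrightarrow> e \<le> norm (h y - h x)"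
      by (intro exI[of _ "2 * pi"]) auto
  qed (rule assms)
  then show ?thesis unfolding constant_on_def by auto
qed

lemma Re_gt_0_near_1: "cmod (z - 1) < 1 \<Longrightarrow> Re z > 0"
  using abs_Re_le_cmod[of "z - 1"] by simp

text \<open>\<open>exp D\<close> avoids the branch cut, so \<open>D - Ln (exp D)\<close> is
  continuous with exponential 1, hence constant. The remaining term obeys
  \<open>|Ln (1 + z)| \<le> 2 * |z|\<close>, valid for \<open>|z| < 1 / 2\<close>, which
  \<open>1 / 3\<close> ensures.\<close>

lemma close_to_constant:
  fixes D :: "real \<Rightarrow> complex"
  assumes "continuous_on UNIV D" "\<And>t. cmod (exp (D t) - 1) \<le> \<epsilon>" "\<epsilon> \<le> 1 / 3"
  shows "\<exists>c. \<forall>t. cmod (D t - c) \<le> 2 * \<epsilon>"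
proof -
  define h where "h = (\<lambda>t. D t - Ln (exp (D t)))"
  have "Re (exp (D t)) > 0" for t
    using assms(2)[of t] assms(3) by (intro Re_gt_0_near_1) linarith
  then have nn: "exp (D t) \<notin> \<real>\<^sub>\<le>\<^sub>0" for t
    by (metis complex_nonpos_Reals_iff not_less)
  have "continuous_on UNIV h"
    unfolding h_def using nn by (intro continuous_intros assms continuous_on_Ln) auto
  moreover have "exp (h t) = 1" for t unfolding h_def by (simp add: exp_diff)
  ultimately have const: "h t = h 0" for t by (rule exp_eq_1_constant)
  have "cmod (D t - h 0) \<le> 2 * \<epsilon>" for t
  proof -
    have "D t - h 0 = D t - h t" using const[of t] by (simp only:)
    also have "\<dots> = Ln (1 + (exp (D t) - 1))" by (simp add: h_def)
    also have "cmod \<dots> \<le> 2 * cmod (exp (D t) - 1)"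
      using assms(2)[of t] assms(3) by (intro norm_Ln_le) linarith
    also have "\<dots> \<le> 2 * \<epsilon>" using assms(2)[of t] by simp
    finally show ?thesis .
  qed
  then show ?thesis by blast
qed

text \<open>A logarithm \<open>g\<close> of an almost periodic function need not be almost periodic, but every almost
  period of \<open>exp g\<close> acts on \<open>g\<close> approximately by adding a constant. Since Bohr neighbourhoods are
  syndetic, this makes \<open>g\<close> a quasimorphism, hence linear up to a bounded error.\<close>

definition bohr_quasi :: "(real \<Rightarrow> complex) \<Rightarrow> bool"
  where "bohr_quasi g \<longleftrightarrow> continuous_on UNIV g \<and>
    (\<forall>\<epsilon>>0. \<exists>A \<eta>. finite A \<and> \<eta> > 0 \<and> (\<forall>\<tau>. bohr_near A \<eta> \<tau> \<longrightarrow> (\<exists>c. \<forall>t. cmod (g (t + \<tau>) - g t - c) \<le> \<epsilon>)))"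

text \<open>Moving an argument to a representative in \<open>F\<close> changes \<open>g\<close> by
  an almost constant amount, which cancels in differences. What remains involves only the finitely
  many values on \<open>F\<close> and \<open>F + F\<close>.\<close>

lemma bohr_quasi_additive:
  assumes "bohr_quasi g"
  shows "\<exists>C. \<forall>s t. cmod (g (s + t) - g s - g t) \<le> C"
proof -
  obtain A \<eta> where A: "finite A" "\<eta> > 0"
    "\<And>\<tau>. bohr_near A \<eta> \<tau> \<Longrightarrow> \<exists>c. \<forall>t. cmod (g (t + \<tau>) - g t - c) \<le> 1"
    using assms unfolding bohr_quasi_def by (metis zero_less_one)
  obtain F where F: "finite F" "\<And>t. \<exists>s\<in>F. bohr_near A \<eta> (t - s)"
    using bohr_near_syndetic[OF A(1,2)] by blast
  define C1 where "C1 = (\<Sum>i\<in>F. \<Sum>j\<in>F. cmod (g (i + j) - g i))"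
  define C2 where "C2 = (\<Sum>j\<in>F. cmod (g j))"
  have bd1: "cmod (g (s + j) - g s) \<le> C1 + 2" if j: "j \<in> F" for s j
  proof -
    obtain i where i: "i \<in> F" "bohr_near A \<eta> (s - i)" using F by blast
    obtain c where c: "\<And>t. cmod (g (t + (s - i)) - g t - c) \<le> 1" using A(3)[OF i(2)] by blast
    have "cmod (g (i + j) - g i) \<le> (\<Sum>j\<in>F. cmod (g (i + j) - g i))"
      by (rule member_le_sum) (use j F in auto)
    also have "\<dots> \<le> C1"
      unfolding C1_def
      by (rule member_le_sum[where f = "\<lambda>i. \<Sum>j\<in>F. cmod (g (i + j) - g i)"])
        (use i F in \<open>auto intro: sum_nonneg\<close>)
    finally have 1: "cmod (g (i + j) - g i) \<le> C1" .
    have 2: "cmod (g (s + j) - g (i + j) - c) \<le> 1" using c[of "i + j"] by (simp add: algebra_simps)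
    have 3: "cmod (g s - g i - c) \<le> 1" using c[of i] by (simp add: algebra_simps)
    show ?thesis
      using 1 2 3 norm_triangle_ineq4[of "g (s + j) - g (i + j) - c" "g s - g i - c"]
        norm_triangle_ineq[of "(g (s + j) - g (i + j) - c) - (g s - g i - c)" "g (i + j) - g i"]
      by (simp add: algebra_simps)
  qed
  have "cmod (g (s + t) - g s - g t) \<le> C1 + C2 + 4" for s t
  proof -
    obtain j where j: "j \<in> F" "bohr_near A \<eta> (t - j)" using F by blast
    obtain c where c: "\<And>r. cmod (g (r + (t - j)) - g r - c) \<le> 1" using A(3)[OF j(2)] by blast
    have 1: "cmod (g j) \<le> C2"
      unfolding C2_def by (rule member_le_sum) (use j F in auto)
    have 2: "cmod (g (s + t) - g (s + j) - c) \<le> 1" using c[of "s + j"] by (simp add: algebra_simps)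
    have 3: "cmod (g t - g j - c) \<le> 1" using c[of j] by (simp add: algebra_simps)
    have "g (s + t) - g s - g t = (g (s + t) - g (s + j) - c) - (g t - g j - c) + ((g (s + j) - g s) - g j)"
      by simp
    then have "cmod (g (s + t) - g s - g t) \<le> cmod ((g (s + t) - g (s + j) - c) - (g t - g j - c)) + cmod ((g (s + j) - g s) - g j)"
      by (metis norm_triangle_ineq)
    then show ?thesis
      using 1 2 3 bd1[OF j(1), of s] norm_triangle_ineq4[of "g (s + t) - g (s + j) - c" "g t - g j - c"]
        norm_triangle_ineq4[of "g (s + j) - g s" "g j"] by linarith
  qed
  then show ?thesis by blast
qed

text \<open>Hyers' argument: \<open>g n / n\<close> is Cauchy, and its limit \<open>W\<close>
  satisfies \<open>|g n - n * W| \<le> 2 * C\<close>. Fractional parts are handled by boundedness on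
  \<open>{0..1}\<close>, negative arguments by quasi-additivity at \<open>- t + t\<close>.\<close>

lemma quasi_additive_linear:
  fixes g :: "real \<Rightarrow> complex"
  assumes cont: "continuous_on UNIV g" and C: "\<And>s t. cmod (g (s + t) - g s - g t) \<le> C"
  shows "\<exists>W C'. \<forall>t. cmod (g t - complex_of_real t * W) \<le> C'"
proof -
  have C0: "C \<ge> 0" using C[of 0 0] norm_ge_zero order_trans by blast
  have iter: "cmod (g (real m * x) - of_nat m * g x) \<le> real (Suc m) * C" for m x
  proof (induction m)
    case 0
    then show ?case using C[of 0 0] by simp
  next
    case (Suc m)
    have "g (real (Suc m) * x) - of_nat (Suc m) * g x =
        (g (real m * x + x) - g (real m * x) - g x) + (g (real m * x) - of_nat m * g x)"
      by (simp add: algebra_simps)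
    then have "cmod (g (real (Suc m) * x) - of_nat (Suc m) * g x) \<le> C + real (Suc m) * C"
      using C[of "real m * x" x] Suc norm_triangle_ineq by (smt (verit))
    then show ?case by (simp add: algebra_simps)
  qed
  define q where "q = (\<lambda>n. g (real (Suc n)) / of_nat (Suc n))"
  \<comment> \<open>\<open>q m\<close> and \<open>q n\<close> are compared through the common
    multiple \<open>Suc m * Suc n\<close> of their arguments.\<close>
  have qq: "cmod (g (real (Suc m) * real (Suc n)) / of_nat (Suc m * Suc n) - q n) \<le> 2 * C / real (Suc n)" for m n
  proof -
    have "g (real (Suc m) * real (Suc n)) / of_nat (Suc m * Suc n) - q n =
        (g (real (Suc m) * real (Suc n)) - of_nat (Suc m) * g (real (Suc n))) / of_nat (Suc m * Suc n)"
      unfolding q_def diff_divide_distrib of_nat_mult by (simp del: of_nat_Suc)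
    then have "cmod (g (real (Suc m) * real (Suc n)) / of_nat (Suc m * Suc n) - q n) =
        cmod (g (real (Suc m) * real (Suc n)) - of_nat (Suc m) * g (real (Suc n))) / real (Suc m * Suc n)"
      by (simp only: norm_divide norm_of_nat)
    also have "\<dots> \<le> real (Suc (Suc m)) * C / real (Suc m * Suc n)"
      by (intro divide_right_mono iter) simp
    also have "\<dots> \<le> 2 * real (Suc m) * C / real (Suc m * Suc n)"
      by (intro divide_right_mono mult_right_mono C0) auto
    also have "\<dots> = 2 * C / real (Suc n)" unfolding of_nat_mult by (simp del: of_nat_Suc)
    finally show ?thesis .
  qed
  have dq: "cmod (q m - q n) \<le> 2 * C / real (Suc m) + 2 * C / real (Suc n)" for m n
    using qq[of m n] qq[of n m]
      norm_triangle_ineq4[of "g (real (Suc m) * real (Suc n)) / of_nat (Suc m * Suc n) - q n"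
        "g (real (Suc n) * real (Suc m)) / of_nat (Suc n * Suc m) - q m"]
    by (simp add: mult.commute del: of_nat_Suc of_nat_mult mult_Suc mult_Suc_right)
  have "Cauchy q"
  proof (rule metric_CauchyI)
    fix e :: real assume e: "e > 0"
    have "(\<lambda>n. 2 * C / real (Suc n)) \<longlonglongrightarrow> 0" by real_asymp
    then have "\<forall>\<^sub>F n in sequentially. 2 * C / real (Suc n) < e / 2"
      using e by (intro order_tendstoD) auto
    then obtain N where N: "\<And>n. n \<ge> N \<Longrightarrow> 2 * C / real (Suc n) < e / 2"
      by (auto simp only: eventually_sequentially)
    have "dist (q m) (q n) < e" if "m \<ge> N" "n \<ge> N" for m n
      using dq[of m n] N[OF that(1)] N[OF that(2)] unfolding dist_norm by linarith
    then show "\<exists>M. \<forall>m\<ge>M. \<forall>n\<ge>M. dist (q m) (q n) < e" by blast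
  qed
  then obtain W where W: "q \<longlonglongrightarrow> W" using Cauchy_convergent convergent_def by blast
  have qW: "cmod (W - q n) \<le> 2 * C / real (Suc n)" for n
  proof (rule tendsto_le[OF sequentially_bot])
    show "(\<lambda>m. cmod (q m - q n)) \<longlonglongrightarrow> cmod (W - q n)" by (intro tendsto_intros W)
    show "(\<lambda>m. 2 * C / real (Suc m) + 2 * C / real (Suc n)) \<longlonglongrightarrow> 2 * C / real (Suc n)" by real_asymp
    show "\<forall>\<^sub>F m in sequentially. cmod (q m - q n) \<le> 2 * C / real (Suc m) + 2 * C / real (Suc n)"
      using dq by simp
  qed
  have nat: "cmod (g (real n) - of_nat n * W) \<le> 2 * C" for n
  proof (cases n)
    case 0
    then show ?thesis using C[of 0 0] C0 by simp
  next
    case (Suc k)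
    have "g (real n) - of_nat n * W = of_nat n * (q k - W)"
      unfolding q_def Suc by (simp add: right_diff_distrib del: of_nat_Suc)
    then have "cmod (g (real n) - of_nat n * W) = real n * cmod (W - q k)"
      by (simp add: norm_mult norm_minus_commute)
    also have "\<dots> \<le> real n * (2 * C / real (Suc k))" by (intro mult_left_mono qW) simp
    also have "\<dots> = 2 * C" using Suc by simp
    finally show ?thesis .
  qed
  have "bounded (g ` {0..1})"
    by (intro compact_imp_bounded compact_continuous_image continuous_on_subset[OF cont]) auto
  then obtain B where B: "\<And>r. r \<in> {0..1} \<Longrightarrow> cmod (g r) \<le> B" unfolding bounded_iff by blast
  have pos: "cmod (g t - complex_of_real t * W) \<le> 3 * C + B + cmod W" if "t \<ge> 0" for t
  proof -
    define n where "n = nat \<lfloor>t\<rfloor>"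
    define r where "r = t - real n"
    have r: "0 \<le> r" "r \<le> 1" "t = real n + r" using that unfolding r_def n_def by linarith+
    have eq: "g t - complex_of_real t * W = (g (real n + r) - g (real n) - g r) + (g (real n) - of_nat n * W)
        + (g r - complex_of_real r * W)"
      unfolding r(3) by (simp add: algebra_simps)
    have "cmod (complex_of_real r * W) \<le> 1 * cmod W"
      unfolding norm_mult using r by (intro mult_right_mono) auto
    then have "cmod (g r - complex_of_real r * W) \<le> B + cmod W"
      using B[of r] r norm_triangle_ineq4[of "g r" "complex_of_real r * W"] by auto
    then show ?thesis
      unfolding eq using C[of "real n" r] nat[of n]
        norm_triangle_ineq[of "g (real n + r) - g (real n) - g r" "g (real n) - of_nat n * W"]
        norm_triangle_ineq[of "(g (real n + r) - g (real n) - g r) + (g (real n) - of_nat n * W)"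
          "g r - complex_of_real r * W"] by linarith
  qed
  have "cmod (g t - complex_of_real t * W) \<le> 5 * C + B + cmod W" for t
  proof (cases "t \<ge> 0")
    case True
    then show ?thesis using pos C0 by (smt (verit))
  next
    case False
    have eq: "g t - complex_of_real t * W = - (g (- t + t) - g (- t) - g t) + g 0 - (g (- t) - complex_of_real (- t) * W)"
      by (simp add: algebra_simps)
    show ?thesis
      unfolding eq using pos[of "- t"] False C[of "- t" t] C[of 0 0]
        norm_triangle_ineq4[of "- (g (- t + t) - g (- t) - g t) + g 0" "g (- t) - complex_of_real (- t) * W"]
        norm_triangle_ineq[of "- (g (- t + t) - g (- t) - g t)" "g 0"] by (simp add: norm_minus_commute)
  qed
  then show ?thesis by blast
qed

text \<open>Without its linear part \<open>g\<close> is bounded. Repeating a shift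
  \<open>\<tau>\<close> that adds roughly \<open>c\<close> would make a bounded function drift
  unless \<open>|c| \<le> \<epsilon> / 2\<close>; so \<open>\<tau>\<close> is a true almost
  period.\<close>

lemma bohr_quasi_linear_part:
  assumes g: "bohr_quasi g"
  shows "\<exists>W. bohr_ap (\<lambda>t. g t - complex_of_real t * W)"
proof -
  have cont: "continuous_on UNIV g" using g unfolding bohr_quasi_def by blast
  obtain C where "\<And>s t. cmod (g (s + t) - g s - g t) \<le> C" using bohr_quasi_additive[OF g] by blast
  then obtain W B where WB: "\<And>t. cmod (g t - complex_of_real t * W) \<le> B"
    using quasi_additive_linear[OF cont] by blast
  define \<phi> where "\<phi> = (\<lambda>t. g t - complex_of_real t * W)"
  have B: "cmod (\<phi> t) \<le> B" for t using WB unfolding \<phi>_def .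
  have "bohr_ap \<phi>"
    unfolding bohr_ap_def
  proof (intro conjI allI impI)
    show "continuous_on UNIV \<phi>" unfolding \<phi>_def by (intro continuous_intros cont)
    fix \<epsilon> :: real assume e: "\<epsilon> > 0"
    then have "\<epsilon> / 2 > 0" by simp
    then obtain A \<eta> where A: "finite A" "\<eta> > 0"
      "\<And>\<tau>. bohr_near A \<eta> \<tau> \<Longrightarrow> \<exists>c. \<forall>t. cmod (g (t + \<tau>) - g t - c) \<le> \<epsilon> / 2"
      using g unfolding bohr_quasi_def by metis
    have "cmod (\<phi> (t + \<tau>) - \<phi> t) \<le> \<epsilon>" if near: "bohr_near A \<eta> \<tau>" for \<tau> t
    proof -
      obtain c0 where c0: "\<And>t. cmod (g (t + \<tau>) - g t - c0) \<le> \<epsilon> / 2" using A(3)[OF near] by blast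
      define c where "c = c0 - complex_of_real \<tau> * W"
      have c: "cmod (\<phi> (t + \<tau>) - \<phi> t - c) \<le> \<epsilon> / 2" for t
      proof -
        have "\<phi> (t + \<tau>) - \<phi> t - c = g (t + \<tau>) - g t - c0"
          unfolding \<phi>_def c_def by (simp add: algebra_simps)
        then show ?thesis using c0 by simp
      qed
      have iter: "cmod (\<phi> (real n * \<tau>) - \<phi> 0 - of_nat n * c) \<le> real n * (\<epsilon> / 2)" for n
      proof (induction n)
        case (Suc n)
        have "\<phi> (real (Suc n) * \<tau>) - \<phi> 0 - of_nat (Suc n) * c =
            (\<phi> (real n * \<tau> + \<tau>) - \<phi> (real n * \<tau>) - c) + (\<phi> (real n * \<tau>) - \<phi> 0 - of_nat n * c)"
          by (simp add: algebra_simps)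
        then have "cmod (\<phi> (real (Suc n) * \<tau>) - \<phi> 0 - of_nat (Suc n) * c) \<le> \<epsilon> / 2 + real n * (\<epsilon> / 2)"
          using c[of "real n * \<tau>"] Suc norm_triangle_ineq by (smt (verit))
        then show ?case by (simp add: algebra_simps)
      qed simp
      have "cmod c \<le> \<epsilon> / 2"
      proof (rule ccontr)
        assume "\<not> cmod c \<le> \<epsilon> / 2"
        then obtain n where n: "real n * (cmod c - \<epsilon> / 2) > 2 * B"
          using reals_Archimedean3[of "cmod c - \<epsilon> / 2"] by auto
        have "real n * cmod c = cmod (of_nat n * c)" by (simp add: norm_mult)
        also have "\<dots> \<le> cmod (\<phi> (real n * \<tau>) - \<phi> 0) + cmod (\<phi> (real n * \<tau>) - \<phi> 0 - of_nat n * c)"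
          using norm_triangle_ineq4[of "\<phi> (real n * \<tau>) - \<phi> 0" "\<phi> (real n * \<tau>) - \<phi> 0 - of_nat n * c"] by simp
        also have "\<dots> \<le> 2 * B + real n * (\<epsilon> / 2)"
          using iter[of n] B[of "real n * \<tau>"] B[of 0] norm_triangle_ineq4[of "\<phi> (real n * \<tau>)" "\<phi> 0"] by linarith
        finally show False using n by (simp add: algebra_simps)
      qed
      then show ?thesis
        using c[of t] norm_triangle_ineq[of "\<phi> (t + \<tau>) - \<phi> t - c" c] by simp
    qed
    then show "\<exists>A \<eta>. finite A \<and> \<eta> > 0 \<and> (\<forall>\<tau>. bohr_near A \<eta> \<tau> \<longrightarrow> (\<forall>t. cmod (\<phi> (t + \<tau>) - \<phi> t) \<le> \<epsilon>))"
      using A(1,2) by blast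
  qed
  then show ?thesis unfolding \<phi>_def by blast
qed

text \<open>Bohr's argument theorem. The lower bound \<open>\<delta>\<close> keeps
  \<open>f (t + \<tau>) / f t\<close> near 1, so the continuous logarithm satisfies
  \<open>bohr_quasi\<close>. Its linear part must be imaginary and is therefore a character.\<close>

lemma APS_log:
  assumes f: "f \<in> APS UNIV" and d: "\<delta> > 0" "\<And>t. cmod (f t) \<ge> \<delta>"
  shows "\<exists>w. \<exists>G\<in>APS UNIV. \<forall>t. f t = ee w t * exp (G t)"
proof -
  have "f t \<noteq> 0" for t using d(2)[of t] d(1) by auto
  then obtain g where g: "continuous_on UNIV g" "\<And>t. f t = exp (g t)"
    using continuous_logarithm_on_contractible[OF APS_continuous[OF f, of UNIV]]
    by (metis UNIV_I contractible_UNIV)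
  have "bohr_quasi g"
    unfolding bohr_quasi_def
  proof (intro conjI allI impI g(1))
    fix \<epsilon> :: real assume e: "\<epsilon> > 0"
    define e1 where "e1 = min (\<epsilon> / 2) (1 / 3)"
    have e1: "e1 > 0" "e1 \<le> 1 / 3" "2 * e1 \<le> \<epsilon>" using e unfolding e1_def by auto
    obtain A \<eta> where A: "finite A" "\<eta> > 0" "\<And>\<tau> t. bohr_near A \<eta> \<tau> \<Longrightarrow> cmod (f (t + \<tau>) - f t) \<le> \<delta> * e1"
      using APS_bohr_ap[OF f] d(1) e1(1) unfolding bohr_ap_def by (metis mult_pos_pos)
    have "\<exists>c. \<forall>t. cmod (g (t + \<tau>) - g t - c) \<le> \<epsilon>" if near: "bohr_near A \<eta> \<tau>" for \<tau>
    proof -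
      have "\<exists>c. \<forall>t. cmod (g (t + \<tau>) - g t - c) \<le> 2 * e1"
      proof (rule close_to_constant[OF _ _ e1(2)])
        show "continuous_on UNIV (\<lambda>t. g (t + \<tau>) - g t)"
          by (intro continuous_intros continuous_on_compose2[OF g(1)] g(1)) auto
        fix t
        have "(exp (g (t + \<tau>) - g t) - 1) * f t = f (t + \<tau>) - f t"
          by (simp add: g(2) exp_diff algebra_simps)
        then have "cmod (exp (g (t + \<tau>) - g t) - 1) * cmod (f t) \<le> \<delta> * e1"
          using A(3)[OF near, of t] by (metis norm_mult)
        moreover have "cmod (exp (g (t + \<tau>) - g t) - 1) * \<delta> \<le> cmod (exp (g (t + \<tau>) - g t) - 1) * cmod (f t)"
          using d by (intro mult_left_mono) auto
        ultimately show "cmod (exp (g (t + \<tau>) - g t) - 1) \<le> e1"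
          using d(1) by (smt (verit) mult.commute mult_le_cancel_left_pos)
      qed
      then show ?thesis using e1(3) by (meson order_trans)
    qed
    then show "\<exists>A \<eta>. finite A \<and> \<eta> > 0 \<and> (\<forall>\<tau>. bohr_near A \<eta> \<tau> \<longrightarrow> (\<exists>c. \<forall>t. cmod (g (t + \<tau>) - g t - c) \<le> \<epsilon>))"
      using A(1,2) by blast
  qed
  then obtain W where W: "bohr_ap (\<lambda>t. g t - complex_of_real t * W)"
    using bohr_quasi_linear_part by blast
  define G where "G = (\<lambda>t. g t - complex_of_real t * W)"
  have G: "G \<in> APS UNIV" using bohr_ap_APS[OF W] unfolding G_def .
  obtain B where B: "\<And>t. cmod (G t) \<le> B" using APS_bounded[OF G] by blast
  obtain M where M: "M > 0" "\<And>t. cmod (f t) \<le> M" using APS_bounded[OF f] by blast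
  \<comment> \<open>Otherwise \<open>|f| = exp (Re g)\<close> would grow exponentially in one
    direction.\<close>
  have "Re W = 0"
  proof (rule ccontr)
    assume ne: "Re W \<noteq> 0"
    have bd: "t * Re W \<le> ln M + B" for t
    proof -
      have "exp (Re (g t)) = cmod (f t)" by (simp add: g(2))
      then have "Re (g t) = ln (cmod (f t))" by (metis ln_exp)
      also have "\<dots> \<le> ln M" using M(2)[of t] d(1) d(2)[of t] by (subst ln_le_cancel_iff) auto
      finally have "Re (g t) \<le> ln M" .
      moreover have "Re (g t) - t * Re W = Re (G t)" unfolding G_def by simp
      moreover have "\<bar>Re (G t)\<bar> \<le> B" using abs_Re_le_cmod[of "G t"] B[of t] by linarith
      ultimately show ?thesis by linarith
    qed
    have "(ln M + B + 1) / Re W * Re W = ln M + B + 1" using ne by simp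
    then show False using bd[of "(ln M + B + 1) / Re W"] by linarith
  qed
  then have "W = \<i> * complex_of_real (Im W)" by (simp add: complex_eq_iff)
  then have "complex_of_real t * W = \<i> * complex_of_real (Im W * t)" for t
    by (metis mult.assoc mult.commute of_real_mult)
  then have eW: "exp (complex_of_real t * W) = ee (Im W) t" for t
    by (simp only: ee_def cis_conv_exp)
  have "f t = ee (Im W) t * exp (G t)" for t
    unfolding g(2) G_def eW[symmetric] by (simp add: exp_diff)
  then show ?thesis using G by blast
qed

subsection \<open>The average winding number\<close>

text \<open>The argument picked by \<open>SOME\<close> differs from \<open>w * t + Im (G t)\<close>
  by a constant, and the bounded part is lost on division by \<open>2 * T\<close>.
  \<open>avg_winding_near\<close> applies this to a \<open>G\<close> corrected by a principal
  logarithm, known there to be continuous and bounded.\<close>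

lemma avg_winding_eq:
  assumes f: "\<And>t. f t = ee w t * exp (G t)" and cG: "continuous_on UNIV G" and B: "\<And>t. cmod (G t) \<le> B"
  shows "avg_winding f = w"
proof -
  have fc: "f t = complex_of_real (cmod (f t)) * cis (w * t + Im (G t))" for t
    unfolding f norm_mult norm_ee norm_exp_eq_Re exp_eq_polar[of "G t"]
    by (simp add: ee_def cis_mult[symmetric])
  then have "continuous_arg f (\<lambda>t. w * t + Im (G t))"
    unfolding continuous_arg_def by (auto intro!: continuous_intros cG)
  then have "continuous_arg f (SOME \<theta>. continuous_arg f \<theta>)" using someI[of "continuous_arg f"] by blast
  moreover define \<theta> where "\<theta> = (SOME \<theta>. continuous_arg f \<theta>)"
  ultimately have th: "continuous_on UNIV \<theta>" "\<And>t. f t = complex_of_real (cmod (f t)) * cis (\<theta> t)"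
    unfolding continuous_arg_def by auto
  define h where "h = (\<lambda>t. \<i> * complex_of_real (\<theta> t - (w * t + Im (G t))))"
  have "continuous_on UNIV h" unfolding h_def by (intro continuous_intros cG th)
  moreover have "exp (h t) = 1" for t
  proof -
    have "cmod (f t) \<noteq> 0" unfolding f by (simp add: norm_mult)
    then have "cis (\<theta> t) = cis (w * t + Im (G t))" using th(2)[of t] fc[of t] by (metis mult_left_cancel of_real_eq_0_iff)
    then show ?thesis unfolding h_def cis_conv_exp[symmetric] cis_divide[symmetric] by simp
  qed
  ultimately have "h t = h 0" for t by (rule exp_eq_1_constant)
  then have c: "\<theta> t - (w * t + Im (G t)) = \<theta> 0 - (w * 0 + Im (G 0))" for t
    unfolding h_def by (metis complex_i_not_zero mult_left_cancel of_real_eq_iff)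
  have "((\<lambda>T. (\<theta> T - \<theta> (- T)) / (2 * T)) \<longlongrightarrow> w) at_top"
  proof (rule Lim_transform_eventually)
    have "((\<lambda>T. (Im (G T) - Im (G (- T))) / (2 * T)) \<longlongrightarrow> 0) at_top"
    proof (rule Lim_null_comparison)
      show "\<forall>\<^sub>F T in at_top. norm ((Im (G T) - Im (G (- T))) / (2 * T)) \<le> B / T"
        using eventually_gt_at_top[of 0]
      proof eventually_elim
        case (elim T)
        have "\<bar>Im (G T) - Im (G (- T))\<bar> \<le> 2 * B"
          using abs_Im_le_cmod[of "G T"] abs_Im_le_cmod[of "G (- T)"] B[of T] B[of "- T"] by linarith
        then show ?case using elim by (simp add: abs_mult field_simps)
      qed
      show "((\<lambda>T. B / T) \<longlongrightarrow> 0) at_top" by real_asymp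
    qed
    then show "((\<lambda>T. w + (Im (G T) - Im (G (- T))) / (2 * T)) \<longlongrightarrow> w) at_top"
      using tendsto_add[OF tendsto_const[of w]] by fastforce
    show "\<forall>\<^sub>F T in at_top. w + (Im (G T) - Im (G (- T))) / (2 * T) = (\<theta> T - \<theta> (- T)) / (2 * T)"
      using eventually_gt_at_top[of 0]
    proof eventually_elim
      case (elim T)
      have "\<theta> T - \<theta> (- T) = 2 * T * w + (Im (G T) - Im (G (- T)))"
        using c[of T] c[of "- T"] by (simp add: algebra_simps)
      then show ?case using elim by (simp add: add_divide_distrib)
    qed
  qed
  then show ?thesis
    unfolding avg_winding_def \<theta>_def Let_def by (intro tendsto_Lim) auto
qed

lemma avg_winding_APS:
  assumes "G \<in> APS S" "\<And>t. f t = ee w t * exp (G t)"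
  shows "avg_winding f = w"
proof -
  obtain B where "\<And>t. cmod (G t) \<le> B" using APS_bounded[OF assms(1)] by blast
  then show ?thesis by (rule avg_winding_eq[OF assms(2) APS_continuous[OF assms(1)]])
qed

lemma avg_winding_mult:
  assumes "f \<in> APS UNIV" "g \<in> APS UNIV" "\<delta> > 0" "\<And>t. cmod (f t) \<ge> \<delta>" "\<delta>' > 0" "\<And>t. cmod (g t) \<ge> \<delta>'"
  shows "avg_winding (\<lambda>t. f t * g t) = avg_winding f + avg_winding g"
proof -
  obtain w G where f: "G \<in> APS UNIV" "\<And>t. f t = ee w t * exp (G t)" using APS_log[OF assms(1,3,4)] by blast
  obtain v H where g: "H \<in> APS UNIV" "\<And>t. g t = ee v t * exp (H t)" using APS_log[OF assms(2,5,6)] by blast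
  have [simp]: "avg_winding f = w" "avg_winding g = v"
    by (rule avg_winding_APS[OF f], rule avg_winding_APS[OF g])
  have "f t * g t = ee (w + v) t * exp (G t + H t)" for t
    by (simp add: f(2) g(2) exp_add ee_mult[symmetric])
  then have "avg_winding (\<lambda>t. f t * g t) = w + v"
    by (rule avg_winding_APS[OF APS_add[OF f(1) g(1)]])
  then show ?thesis by simp
qed

lemma avg_winding_cnj:
  assumes "f \<in> APS UNIV" "\<delta> > 0" "\<And>t. cmod (f t) \<ge> \<delta>"
  shows "avg_winding (\<lambda>t. cnj (f t)) = - avg_winding f"
proof -
  obtain w G where f: "G \<in> APS UNIV" "\<And>t. f t = ee w t * exp (G t)" using APS_log[OF assms] by blast
  have [simp]: "avg_winding f = w"
    by (rule avg_winding_APS[OF f])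
  have "cnj (f t) = ee (- w) t * exp (cnj (G t))" for t
    by (simp add: f(2) cnj_ee exp_cnj)
  then have "avg_winding (\<lambda>t. cnj (f t)) = - w"
    by (rule avg_winding_APS[OF APS_cnj_UNIV[OF f(1)]])
  then show ?thesis by simp
qed

text \<open>\<open>g / f\<close> stays within \<open>1 / 3\<close> of 1, so its principal logarithm
  is continuous and bounded; adding it to the logarithm of \<open>f\<close> leaves the linear part
  unchanged.\<close>

lemma avg_winding_near:
  assumes "f \<in> APS UNIV" "\<delta> > 0" "\<And>t. cmod (f t) \<ge> \<delta>" "g \<in> APS UNIV" "\<And>t. cmod (g t - f t) \<le> \<delta> / 3"
  shows "avg_winding g = avg_winding f"
proof -
  obtain w G where f: "G \<in> APS UNIV" "\<And>t. f t = ee w t * exp (G t)" using APS_log[OF assms(1-3)] by blast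
  obtain B where B: "\<And>t. cmod (G t) \<le> B" using APS_bounded[OF f(1)] by blast
  have [simp]: "avg_winding f = w"
    by (rule avg_winding_APS[OF f])
  have f0: "f t \<noteq> 0" for t using assms(2) assms(3)[of t] by auto
  define z where "z = (\<lambda>t. g t / f t)"
  have z: "cmod (z t - 1) \<le> 1 / 3" for t
  proof -
    have "z t - 1 = (g t - f t) / f t" unfolding z_def using f0 by (simp add: diff_divide_distrib)
    then have "cmod (z t - 1) = cmod (g t - f t) / cmod (f t)" by (simp add: norm_divide)
    also have "\<dots> \<le> (\<delta> / 3) / \<delta>" using assms by (intro frac_le) auto
    finally show ?thesis using assms(2) by simp
  qed
  have "Re (z t) > 0" for t using z[of t] by (intro Re_gt_0_near_1) linarith
  then have nn: "z t \<notin> \<real>\<^sub>\<le>\<^sub>0" "z t \<noteq> 0" for t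
    by (metis complex_nonpos_Reals_iff not_less, metis less_irrefl zero_complex.sel(1))
  have cz: "continuous_on UNIV z" unfolding z_def
    using f0 by (intro continuous_intros APS_continuous[OF assms(1)] APS_continuous[OF assms(4)]) auto
  have "cmod (Ln (z t)) \<le> 1" for t
    using norm_Ln_le[of "z t - 1"] z[of t] by simp
  then have "cmod (G t + Ln (z t)) \<le> B + 1" for t
    using B[of t] norm_triangle_ineq[of "G t" "Ln (z t)"] by (smt (verit))
  moreover have "continuous_on UNIV (\<lambda>t. G t + Ln (z t))"
    using nn by (intro continuous_intros APS_continuous[OF f(1)] continuous_on_Ln cz) auto
  moreover have "g t = ee w t * exp (G t + Ln (z t))" for t
  proof -
    have "g t = f t * z t" unfolding z_def using f0 by simp
    then show ?thesis using nn(2)[of t] by (simp add: f(2) exp_add)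
  qed
  ultimately have "avg_winding g = w" by (intro avg_winding_eq) auto
  then show ?thesis by simp
qed

subsection \<open>Invertibility and winding number in the positive algebra\<close>

text \<open>The approximant \<open>p = q + r\<close> is taken so close to \<open>G\<close> that
  \<open>exp (G - p)\<close> stays within \<open>1 / 2\<close> of 1.\<close>

lemma exp_trig_split:
  assumes "G \<in> APS UNIV"
  obtains q r where "q \<in> trig {0..}" "r \<in> trig {..<0}" "\<And>t. 1 / 2 \<le> Re (exp (G t - q t - r t))"
proof -
  have "((\<lambda>z. exp z) \<longlongrightarrow> exp 0) (at (0::complex))"
    by (intro tendsto_intros)
  then obtain d where d: "d > 0" "\<And>z. cmod z < d \<Longrightarrow> z \<noteq> 0 \<Longrightarrow> cmod (exp z - 1) < 1 / 2"
    using LIM_D[of exp "exp 0" "0::complex" "1 / 2"] by auto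
  obtain p where p: "p \<in> trig UNIV" "\<And>t. cmod (G t - p t) \<le> d / 2"
    using APS_D[OF assms, of "d / 2"] d(1) by auto
  obtain q r where qr: "q \<in> trig {0..}" "r \<in> trig (- {0..})" "p = (\<lambda>t. q t + r t)"
    using trig_split[OF p(1)] by blast
  have "- {0..} = {..<0::real}" by auto
  then have r: "r \<in> trig {..<0}" using qr(2) by simp
  have "1 / 2 \<le> Re (exp (G t - q t - r t))" for t
  \<comment> \<open>The punctured limit behind \<open>d\<close> says nothing at the point 0
    itself.\<close>
  proof (cases "G t - q t - r t = 0")
    case False
    have "cmod (exp (G t - q t - r t) - 1) < 1 / 2"
      using p(2)[of t] d(1) qr(3) by (intro d(2) False) (simp add: algebra_simps)
    then show ?thesis using abs_Re_le_cmod[of "exp (G t - q t - r t) - 1"] by simp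
  qed simp
  then show ?thesis using that qr(1) r by blast
qed

lemma bounded_below_unit:
  assumes "h \<in> APS S" "\<And>t. f t * h t = 1"
  obtains \<delta> where "\<delta> > 0" "\<And>t. cmod (f t) \<ge> \<delta>"
proof -
  obtain B where B: "B > 0" "\<And>t. cmod (h t) \<le> B" using APS_bounded[OF assms(1)] by blast
  have "cmod (f t) \<ge> 1 / B" for t
  proof -
    have "1 = cmod (f t) * cmod (h t)" using assms(2)[of t] by (metis norm_mult norm_one)
    also have "\<dots> \<le> cmod (f t) * B" by (intro mult_left_mono B) simp
    finally show ?thesis using B(1) by (simp add: field_simps)
  qed
  then show ?thesis using that[of "1 / B"] B(1) by simp
qed

text \<open>If the winding number \<open>w\<close> were positive, then, up to a factor with real part at least \<open>1/2\<close>,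
  the function \<open>k\<close> with positive spectrum would coincide with one with nonpositive spectrum, so
  \<open>k\<close> would be orthogonal to a multiple of itself.\<close>

lemma winding_nonpos:
  assumes f: "f \<in> APS {0..}" and h: "h \<in> APS {0..}" and fh: "\<And>t. f t * h t = 1"
  shows "avg_winding f \<le> 0"
proof (rule ccontr)
  assume "\<not> avg_winding f \<le> 0"
  obtain \<delta> where "\<delta> > 0" "\<And>t. cmod (f t) \<ge> \<delta>" using bounded_below_unit[OF h fh] by blast
  then obtain w G where G: "G \<in> APS UNIV" "\<And>t. f t = ee w t * exp (G t)"
    using APS_log[OF APS_mono[OF f]] by blast
  have w: "w > 0" using avg_winding_APS[OF G] \<open>\<not> avg_winding f \<le> 0\<close> by simp
  obtain q r where qr: "q \<in> trig {0..}" "r \<in> trig {..<0}" "\<And>t. 1 / 2 \<le> Re (exp (G t - q t - r t))"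
    using exp_trig_split[OF G(1)] by blast
  define Z where "Z = (\<lambda>t. exp (G t - q t - r t))"
  \<comment> \<open>From \<open>f * h = 1\<close> it follows that \<open>Z * k = exp (- r)\<close>:
    up to \<open>Z\<close>, a function with frequencies at least \<open>w\<close> equals one with
    frequencies at most 0.\<close>
  define k where "k = (\<lambda>t. ee w t * (exp (q t) * h t))"
  have eq: "(\<lambda>t. exp (q t)) \<in> APS {0..}" "(\<lambda>t. exp (- q t)) \<in> APS {0..}"
    by (rule APS_exp[OF APS_trig[OF qr(1)]]; simp) (rule APS_exp[OF APS_uminus[OF APS_trig[OF qr(1)]]]; simp)
  have r0: "r \<in> APS {..0}" by (rule APS_mono[OF APS_trig[OF qr(2)]]) auto
  have er: "(\<lambda>t. exp (- r t)) \<in> APS {..0}"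
    by (rule APS_exp[OF APS_uminus[OF r0]]; simp)
  have qh: "(\<lambda>t. exp (q t) * h t) \<in> APS {0..}" by (rule APS_mult[OF eq(1) h]) auto
  have k: "k \<in> APS {0<..}"
    unfolding k_def by (rule APS_mult[OF APS_trig[OF trig_ee[of w "{w}"]] qh]) (use w in auto)
  have fq: "(\<lambda>t. f t * exp (- q t)) \<in> APS {0..}" by (rule APS_mult[OF f eq(2)]) auto
  obtain B where B: "B > 0" "\<And>t. cmod (f t * exp (- q t)) \<le> B" using APS_bounded[OF fq] by blast
  \<comment> \<open>All frequencies of \<open>N\<close> are negative, so its mean is 0; yet
    \<open>N = Z * |k|^2\<close> has real part bounded away from 0.\<close>
  define N where "N = (\<lambda>t. exp (- r t) * cnj (k t))"
  have N: "N \<in> APS {..<0}"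
    unfolding N_def by (rule APS_mult[OF er APS_cnj[OF k]]) auto
  have ReN: "(1 / B)\<^sup>2 / 2 \<le> Re (N t)" for t
  proof -
    have "f t = ee w t * (exp (q t) * exp (r t) * Z t)"
      unfolding G(2) Z_def by (simp add: exp_diff exp_add)
    then have "exp (r t) * (Z t * k t) = f t * h t" unfolding k_def by (simp add: mult_ac)
    then have "Z t * k t = exp (- r t)" unfolding fh by (simp add: exp_minus field_simps)
    then have "N t = Z t * (k t * cnj (k t))" unfolding N_def by (simp add: mult_ac)
    also have "\<dots> = Z t * complex_of_real ((cmod (k t))\<^sup>2)" by (simp only: complex_norm_square)
    finally have "Re (N t) = Re (Z t) * (cmod (k t))\<^sup>2" by simp
    moreover have "1 / 2 * (cmod (k t))\<^sup>2 \<le> Re (Z t) * (cmod (k t))\<^sup>2"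
      using qr(3)[of t] unfolding Z_def by (intro mult_right_mono) auto
    moreover have "1 / B \<le> cmod (k t)"
    proof -
      have "k t * (f t * exp (- q t)) = ee w t * (f t * h t)"
        unfolding k_def by (simp add: exp_minus mult_ac)
      then have "cmod (k t) * cmod (f t * exp (- q t)) = 1"
        unfolding fh by (metis mult.right_neutral norm_ee norm_mult)
      moreover have "cmod (k t) * cmod (f t * exp (- q t)) \<le> cmod (k t) * B"
        by (intro mult_left_mono B) simp
      ultimately show ?thesis using B(1) by (simp add: field_simps)
    qed
    then have "(1 / B)\<^sup>2 \<le> (cmod (k t))\<^sup>2" using B(1) by (intro power_mono) auto
    ultimately show ?thesis by linarith
  qed
  have "Re (complex_of_real ((1 / B)\<^sup>2 / 2)) \<le> Re 0"
  proof (rule has_mean_Re_le[OF has_mean_const APS_mean_zero[OF N]])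
    show "Re (complex_of_real ((1 / B)\<^sup>2 / 2)) \<le> Re (N t)" for t using ReN by (simp only: Re_complex_of_real)
  qed (auto intro: continuous_intros APS_continuous[OF N])
  then show False using B(1) by (simp add: divide_le_0_iff)
qed

text \<open>\<open>winding_nonpos\<close> applies to \<open>f\<close> and to its inverse
  \<open>h\<close>, whose winding numbers add up to 0.\<close>

lemma winding_zero:
  assumes f: "f \<in> APS {0..}" and h: "h \<in> APS {0..}" and fh: "\<And>t. f t * h t = 1"
  shows "avg_winding f = 0"
proof -
  have hf: "h t * f t = 1" for t using fh[of t] by (simp add: mult.commute)
  obtain \<delta> where d: "\<delta> > 0" "\<And>t. cmod (f t) \<ge> \<delta>" using bounded_below_unit[OF h fh] by blast
  obtain \<delta>' where d': "\<delta>' > 0" "\<And>t. cmod (h t) \<ge> \<delta>'" using bounded_below_unit[OF f hf] by blast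
  have "avg_winding (\<lambda>t. f t * h t) = avg_winding f + avg_winding h"
    by (rule avg_winding_mult[OF APS_mono[OF f] APS_mono[OF h] d d']) auto
  moreover have "avg_winding (\<lambda>t. f t * h t) = 0"
    by (rule avg_winding_APS[OF APS_const[of UNIV 0]]) (auto simp: fh)
  ultimately show ?thesis
    using winding_nonpos[OF f h fh] winding_nonpos[OF h f hf] by linarith
qed

text \<open>The negative frequencies of the inverse \<open>u\<close> are controlled by an energy estimate for the
  negative part \<open>p2\<close> of a trigonometric approximation \<open>p\<close> of \<open>u\<close>.\<close>

lemma inverse_nonneg_spectrum:
  assumes f: "f \<in> APS {0..}" and h: "h \<in> APS UNIV" and fh: "\<And>t. f t * h t = 1"
    and w0: "avg_winding f = 0"
  shows "h \<in> APS {0..}"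
proof -
  obtain \<delta> where "\<delta> > 0" "\<And>t. cmod (f t) \<ge> \<delta>" using bounded_below_unit[OF h fh] by blast
  then obtain w G where G: "G \<in> APS UNIV" "\<And>t. f t = ee w t * exp (G t)"
    using APS_log[OF APS_mono[OF f]] by blast
  have w: "w = 0" using avg_winding_APS[OF G] w0 by simp
  obtain q r where qr: "q \<in> trig {0..}" "r \<in> trig {..<0}" "\<And>t. 1 / 2 \<le> Re (exp (G t - q t - r t))"
    using exp_trig_split[OF G(1)] by blast
  define Z where "Z = (\<lambda>t. exp (G t - q t - r t))"
  have eq: "(\<lambda>t. exp (q t)) \<in> APS {0..}" "(\<lambda>t. exp (- q t)) \<in> APS {0..}"
    by (rule APS_exp[OF APS_trig[OF qr(1)]]; simp) (rule APS_exp[OF APS_uminus[OF APS_trig[OF qr(1)]]]; simp)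
  have r0: "r \<in> APS {..0}" by (rule APS_mono[OF APS_trig[OF qr(2)]]) auto
  have er: "(\<lambda>t. exp (r t)) \<in> APS {..0}" "(\<lambda>t. exp (- r t)) \<in> APS {..0}"
    by (rule APS_exp[OF r0]; simp) (rule APS_exp[OF APS_uminus[OF r0]]; simp)
  \<comment> \<open>Since \<open>exp q\<close> is a unit of the positive algebra, it suffices to
    treat \<open>F = exp r * Z\<close> and its inverse \<open>u\<close>.\<close>
  define F where "F = (\<lambda>t. f t * exp (- q t))"
  define u where "u = (\<lambda>t. h t * exp (q t))"
  have F: "F \<in> APS {0..}" unfolding F_def by (rule APS_mult[OF f eq(2)]) auto
  have u: "u \<in> APS UNIV" unfolding u_def by (rule APS_mult[OF h eq(1)]) auto
  have Fu: "F t * u t = 1" for t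
  proof -
    have "F t * u t = (f t * h t) * (exp (- q t) * exp (q t))" unfolding F_def u_def by (simp only: mult_ac)
    then show ?thesis unfolding fh exp_add[symmetric] by simp
  qed
  have FZ: "F t = exp (r t) * Z t" for t
  proof -
    have "F t = exp (G t + - q t)" unfolding F_def G(2) w exp_add by simp
    also have "G t + - q t = r t + (G t - q t - r t)" by simp
    finally show ?thesis unfolding Z_def exp_add .
  qed
  obtain CF where CF: "CF > 0" "\<And>t. cmod (F t) \<le> CF" using APS_bounded[OF F] by blast
  obtain C where C: "C > 0" "\<And>t. cmod (exp (- r t)) \<le> C" using APS_bounded[OF er(2)] by blast
  have "has_mean (\<lambda>s. u s * ee (- l) s) 0" if l: "l \<notin> {0..}" for l
  proof -
    have uel: "(\<lambda>s. u s * ee (- l) s) \<in> APS UNIV"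
      by (rule APS_mult_UNIV[OF u APS_trig[OF trig_ee]]) simp
    obtain m where m: "has_mean (\<lambda>s. u s * ee (- l) s) m" using APS_mean_exists[OF uel] by blast
    \<comment> \<open>The summand 1 accounts for replacing \<open>u\<close> by \<open>p\<close>, and
      \<open>2 * C * CF\<close> for the coefficient of \<open>p2\<close>.\<close>
    have bound: "cmod m \<le> e * (1 + 2 * C * CF)" if e: "e > 0" for e
    proof -
      obtain p where p: "p \<in> trig UNIV" "\<And>t. cmod (u t - p t) \<le> e" using APS_D[OF u e] by blast
      obtain p1 p2 where p12: "p1 \<in> trig {0..}" "p2 \<in> trig (- {0..})" "p = (\<lambda>t. p1 t + p2 t)"
        using trig_split[OF p(1)] by blast
      have "- {0..} = {..<0::real}" by auto
      then have p2: "p2 \<in> trig {..<0}" using p12(2) by simp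
      have p2': "p2 \<in> trig UNIV" using trig_mono[OF p2] by simp
      \<comment> \<open>The weight \<open>exp r\<close> gives
        \<open>Z * b = F * p2 = 1 - F * p1 + E\<close>, where \<open>E\<close> is the approximation
        error, and keeps the spectrum of \<open>b\<close> negative.\<close>
      define b where "b = (\<lambda>t. exp (r t) * p2 t)"
      have b: "b \<in> APS {..<0}" unfolding b_def by (rule APS_mult[OF er(1) APS_trig[OF p2]]) auto
      have Fp1: "(\<lambda>t. F t * p1 t) \<in> APS {0..}" by (rule APS_mult[OF F APS_trig[OF p12(1)]]) auto
      \<comment> \<open>Orthogonality: \<open>1 - F * p1\<close> has frequencies at least 0 and
        \<open>cnj b\<close> only positive ones, so \<open>N\<close> has mean 0. In the energy
        identity only the error term is left against \<open>Z * |b|^2\<close>.\<close>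
      define N where "N = (\<lambda>t. (1 - F t * p1 t) * cnj (b t))"
      have N: "N \<in> APS {0<..}"
        unfolding N_def by (rule APS_mult[OF APS_diff[OF APS_const Fp1] APS_cnj[OF b]]) auto
      have bb: "(\<lambda>t. b t * cnj (b t)) \<in> APS UNIV"
        using APS_mult_UNIV APS_cnj_UNIV APS_mono[OF b] by blast
      obtain v where v: "has_mean (\<lambda>t. b t * cnj (b t)) v" using APS_mean_exists[OF bb] by blast
      have "Re (complex_of_real (1 / 4) * v - 0) \<le> Re (complex_of_real ((CF * e)\<^sup>2))"
      proof (rule has_mean_Re_le[OF has_mean_diff[OF has_mean_cmult[OF v] APS_mean_zero[OF N]] has_mean_const])
        fix t
        define E where "E = F t * (p t - u t)"
        have E: "cmod E \<le> CF * e"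
          unfolding E_def norm_mult using CF p(2)[of t] by (intro mult_mono) (auto simp: norm_minus_commute)
        have "Z t * b t = F t * p2 t" unfolding FZ b_def by simp
        also have "\<dots> = 1 + E - F t * p1 t"
          unfolding E_def using Fu[of t] by (simp add: p12(3) algebra_simps)
        finally have "Z t * b t * cnj (b t) = (1 + E - F t * p1 t) * cnj (b t)" by (simp only:)
        then have "Z t * (b t * cnj (b t)) = N t + E * cnj (b t)"
          unfolding N_def by (simp add: algebra_simps)
        then have "Z t * complex_of_real ((cmod (b t))\<^sup>2) = N t + E * cnj (b t)"
          by (simp only: complex_norm_square)
        then have "Re (Z t * complex_of_real ((cmod (b t))\<^sup>2)) = Re (N t + E * cnj (b t))" by (simp only:)
        then have "Re (Z t) * (cmod (b t))\<^sup>2 = Re (N t) + Re (E * cnj (b t))" by simp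
        moreover have "1 / 2 * (cmod (b t))\<^sup>2 \<le> Re (Z t) * (cmod (b t))\<^sup>2"
          using qr(3)[of t] unfolding Z_def by (intro mult_right_mono) auto
        moreover have "Re (E * cnj (b t)) \<le> CF * e * cmod (b t)"
        proof -
          have "Re (E * cnj (b t)) \<le> cmod E * cmod (b t)"
            using complex_Re_le_cmod[of "E * cnj (b t)"] by (simp add: norm_mult)
          also have "\<dots> \<le> CF * e * cmod (b t)" by (intro mult_right_mono E) simp
          finally show ?thesis .
        qed
        \<comment> \<open>Young's inequality gives up half of the coefficient \<open>1 / 2\<close>
          supplied by \<open>Re Z\<close> and leaves \<open>1 / 4\<close>.\<close>
        moreover have "CF * e * cmod (b t) \<le> (CF * e)\<^sup>2 + (cmod (b t))\<^sup>2 / 4"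
          using zero_le_power2[of "CF * e - cmod (b t) / 2"] by (simp add: power2_eq_square algebra_simps)
        ultimately have "1 / 4 * (cmod (b t))\<^sup>2 - Re (N t) \<le> (CF * e)\<^sup>2" by linarith
        moreover have "Re (complex_of_real (1 / 4) * (b t * cnj (b t)) - N t) = 1 / 4 * (cmod (b t))\<^sup>2 - Re (N t)"
          by (simp only: complex_norm_square[symmetric] minus_complex.sel) simp
        ultimately show "Re (complex_of_real (1 / 4) * (b t * cnj (b t)) - N t) \<le> Re (complex_of_real ((CF * e)\<^sup>2))"
          by (simp only: Re_complex_of_real)
      qed (intro continuous_intros APS_continuous[OF bb] APS_continuous[OF N] | simp)+
      then have v4: "Re v \<le> 4 * (CF * e)\<^sup>2" by simp
      have p2l: "(\<lambda>t. p2 t * ee (- l) t) \<in> trig UNIV"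
        by (rule trig_mult[OF p2' trig_ee]) auto
      have cp2: "continuous_on UNIV p2" by (rule trig_continuous[OF p2])
      obtain m2 where m2: "has_mean (\<lambda>t. p2 t * ee (- l) t) m2" using trig_has_mean[OF p2l] by blast
      have pp: "(\<lambda>t. (p2 t * ee (- l) t) * cnj (p2 t * ee (- l) t)) \<in> APS UNIV"
        by (intro APS_mult_UNIV[of "\<lambda>t. p2 t * ee (- l) t"] APS_cnj_UNIV APS_trig p2l)
      obtain v2 where v2: "has_mean (\<lambda>t. (p2 t * ee (- l) t) * cnj (p2 t * ee (- l) t)) v2"
        using APS_mean_exists[OF pp] by blast
      have "(cmod m2)\<^sup>2 \<le> Re v2" by (rule mean_Jensen[OF APS_trig[OF p2l] m2 v2])
      also have "Re v2 \<le> Re (complex_of_real (C\<^sup>2) * v)"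
      proof (rule has_mean_Re_le[OF v2 has_mean_cmult[OF v]])
        fix t
        have "p2 t = exp (- r t) * b t" unfolding b_def by (simp add: exp_minus)
        then have "cmod (p2 t * ee (- l) t) = cmod (exp (- r t)) * cmod (b t)"
          by (simp only: norm_mult norm_ee mult_1_right)
        then have "cmod (p2 t * ee (- l) t) \<le> C * cmod (b t)"
          using C(2)[of t] by (simp add: mult_right_mono del: norm_exp_eq_Re)
        then have "(cmod (p2 t * ee (- l) t))\<^sup>2 \<le> (C * cmod (b t))\<^sup>2" by (intro power_mono) auto
        moreover have "Re (z * cnj z) = (cmod z)\<^sup>2" for z
          by (simp only: complex_norm_square[symmetric] Re_complex_of_real)
        moreover have "Re (complex_of_real (C\<^sup>2) * z) = C\<^sup>2 * Re z" for z by simp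
        ultimately show "Re (p2 t * ee (- l) t * cnj (p2 t * ee (- l) t)) \<le> Re (complex_of_real (C\<^sup>2) * (b t * cnj (b t)))"
          by (simp only: power_mult_distrib)
      qed (intro continuous_intros APS_continuous[OF bb] cp2)+
      also have "\<dots> = C\<^sup>2 * Re v" by simp
      also have "\<dots> \<le> C\<^sup>2 * (4 * (CF * e)\<^sup>2)" by (intro mult_left_mono v4) simp
      also have "\<dots> = (2 * C * CF * e)\<^sup>2" by (simp add: power2_eq_square)
      finally have "cmod m2 \<le> 2 * C * CF * e"
        by (rule power2_le_imp_le) (use C(1) CF(1) e in simp)
      \<comment> \<open>As \<open>l\<close> is negative, \<open>p1\<close> has no term of frequency
        \<open>l\<close>, so \<open>m2\<close> is the coefficient of the whole approximant
        \<open>p\<close>.\<close>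
      moreover have "cmod (m - m2) \<le> Re (complex_of_real e)"
      proof (rule has_mean_norm_le[OF _ has_mean_const])
        have "(\<lambda>t. p1 t * ee (- l) t) \<in> trig {0<..}"
          by (rule trig_mult[OF p12(1) trig_ee[of "- l" "{- l}"]]) (use l in auto)
        then have p1l: "has_mean (\<lambda>t. p1 t * ee (- l) t) 0" by (rule trig_mean_zero) simp
        have "has_mean (\<lambda>t. p1 t * ee (- l) t + p2 t * ee (- l) t) (0 + m2)"
          by (intro has_mean_add p1l m2 continuous_intros cp2 trig_continuous[OF p12(1)])
        then have pl: "has_mean (\<lambda>t. p t * ee (- l) t) m2" by (simp add: p12(3) distrib_right)
        show "has_mean (\<lambda>t. u t * ee (- l) t - p t * ee (- l) t) (m - m2)"
          by (rule has_mean_diff[OF m pl]) (intro continuous_intros APS_continuous[OF u] trig_continuous[OF p(1)])+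
        show "cmod (u t * ee (- l) t - p t * ee (- l) t) \<le> Re (complex_of_real e)" for t
          using p(2)[of t] unfolding left_diff_distrib[symmetric] norm_mult by simp
      qed (intro continuous_intros APS_continuous[OF u] trig_continuous[OF p(1)])+
      ultimately show ?thesis
        using norm_triangle_ineq[of "m - m2" m2] by (simp add: algebra_simps)
    qed
    have "cmod m \<le> 0"
    proof (rule field_le_epsilon)
      fix d :: real assume d: "d > 0"
      have pos: "1 + 2 * C * CF > 0" using C(1) CF(1) by (simp add: add_pos_pos)
      then show "cmod m \<le> 0 + d" using bound[of "d / (1 + 2 * C * CF)"] d by simp
    qed
    then show ?thesis using m by simp
  qed
  then have "u \<in> APS {0..}" by (intro APS_spectrum[OF u]) auto
  then have "(\<lambda>t. u t * exp (- q t)) \<in> APS {0..}" by (rule APS_mult[OF _ eq(2)]) auto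
  moreover have "(\<lambda>t. u t * exp (- q t)) = h"
    unfolding u_def mult.assoc exp_add[symmetric] by simp
  ultimately show ?thesis by simp
qed

subsection \<open>Holomorphic extension to the upper half-plane\<close>

text \<open>Boundedness is part of the notion because it excludes functions such as
  \<open>exp (- \<i> * z)\<close>, unimodular on the line but unbounded above it.\<close>

definition half_plane_ext :: "(real \<Rightarrow> complex) \<Rightarrow> (complex \<Rightarrow> complex) \<Rightarrow> bool"
  where "half_plane_ext f P \<longleftrightarrow> P holomorphic_on {z. Im z > 0} \<and> continuous_on {z. Im z \<ge> 0} P \<and>
    (\<exists>M. \<forall>z. Im z \<ge> 0 \<longrightarrow> cmod (P z) \<le> M) \<and> (\<forall>t. P (complex_of_real t) = f t)"

lemma open_upper: "open {z. Im z > 0}"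
  by (simp add: open_Collect_less continuous_intros)

text \<open>A Phragmen--Lindelof argument: the factor \<open>1 - \<i> e z\<close> makes the function small on large
  half circles.\<close>

lemma half_plane_max_pos:
  assumes P: "half_plane_ext f P" and c: "c > 0" "\<And>t. cmod (f t) \<le> c" and z: "Im z \<ge> 0"
  shows "cmod (P z) \<le> c"
proof -
  obtain M where M: "\<And>z. Im z \<ge> 0 \<Longrightarrow> cmod (P z) \<le> M" using P unfolding half_plane_ext_def by blast
  have hol: "P holomorphic_on {z. Im z > 0}" and cont: "continuous_on {z. Im z \<ge> 0} P"
    and real: "P (complex_of_real t) = f t" for t
    using P unfolding half_plane_ext_def by auto
  have main: "cmod (P z) \<le> c * cmod (1 - \<i> * complex_of_real e * z)" if e: "e > 0" for e
  proof -
    define D where "D = (\<lambda>z. 1 - \<i> * complex_of_real e * z)"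
    have D1: "cmod (D z) \<ge> 1" if "Im z \<ge> 0" for z
    proof -
      have "1 \<le> Re (D z)" unfolding D_def using that e by simp
      then show ?thesis using complex_Re_le_cmod[of "D z"] by linarith
    qed
    have D2: "cmod (D z) \<ge> e * cmod z" if "Im z \<ge> 0" for z
    proof (rule power2_le_imp_le)
      have "(cmod (D z))\<^sup>2 = (1 + e * Im z)\<^sup>2 + (e * Re z)\<^sup>2"
        unfolding cmod_power2 D_def by (simp add: power2_eq_square)
      also have "\<dots> \<ge> (e * Im z)\<^sup>2 + (e * Re z)\<^sup>2"
        using that e by (intro add_right_mono power_mono) auto
      also have "(e * Im z)\<^sup>2 + (e * Re z)\<^sup>2 = (e * cmod z)\<^sup>2"
        by (simp add: power_mult_distrib cmod_power2 algebra_simps)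
      finally show "(e * cmod z)\<^sup>2 \<le> (cmod (D z))\<^sup>2" .
    qed simp
    have D0: "D z \<noteq> 0" if "Im z \<ge> 0" for z using D1[OF that] by auto
    define Q where "Q = (\<lambda>z. P z / D z)"
    \<comment> \<open>The half disc has to contain \<open>z\<close>, and on its arc
      \<open>|D| \<ge> e * R\<close> has to outweigh the global bound:
      \<open>M / (e * R) \<le> c\<close>.\<close>
    define R where "R = max (cmod z) (max 1 (M / (e * c)))"
    define S where "S = cball 0 R \<inter> {z. Im z \<ge> 0}"
    have clS: "closed S" unfolding S_def
      by (intro closed_Int closed_cball closed_Collect_le continuous_intros)
    have inS: "ball 0 R \<inter> {z. Im z > 0} \<subseteq> interior S"
      by (rule interior_maximal) (auto simp: S_def intro!: open_Int open_upper)
    have intS: "interior S \<subseteq> {z. Im z > 0}"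
    proof
      fix y assume y: "y \<in> interior S"
      then obtain d where d: "d > 0" "ball y d \<subseteq> S" unfolding mem_interior by blast
      have "dist y (y - \<i> * complex_of_real (d / 2)) < d" using d by (simp add: dist_norm norm_mult)
      then have "y - \<i> * complex_of_real (d / 2) \<in> S" using d(2) by auto
      then show "y \<in> {z. Im z > 0}" using d(1) unfolding S_def by simp
    qed
    have "cmod (Q z) \<le> c"
    proof (rule maximum_modulus_frontier[where S = S and f = Q])
      show "Q holomorphic_on interior S"
        unfolding Q_def D_def using intS D0[unfolded D_def]
        by (intro holomorphic_intros holomorphic_on_subset[OF hol]) auto
      show "continuous_on (closure S) Q"
        unfolding Q_def D_def closure_closed[OF clS] using D0[unfolded D_def]
        by (intro continuous_intros continuous_on_subset[OF cont]) (auto simp: S_def)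
      show "bounded S" unfolding S_def by (intro bounded_Int) simp
      show "z \<in> S" unfolding S_def R_def using z by simp
      fix y assume y: "y \<in> frontier S"
      then have yS: "y \<in> S" "y \<notin> interior S" unfolding frontier_def closure_closed[OF clS] by auto
      then have Im: "Im y \<ge> 0" unfolding S_def by simp
      have Q: "cmod (Q y) = cmod (P y) / cmod (D y)" unfolding Q_def by (rule norm_divide)
      consider "Im y = 0" | "cmod y = R" using yS inS Im unfolding S_def by force
      then show "cmod (Q y) \<le> c"
      proof cases
        case 1
        then have "y = complex_of_real (Re y)" by (simp add: complex_eq_iff)
        then have "cmod (P y) \<le> c" using real c(2) by metis
        moreover have "cmod (P y) / cmod (D y) \<le> cmod (P y) / 1"
          using D1[OF Im] by (intro divide_left_mono) auto
        ultimately show ?thesis unfolding Q by simp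
      next
        case 2
        have R: "R > 0" "M / (e * c) \<le> R" unfolding R_def by auto
        then have "M \<le> c * (e * R)" using e c(1) by (simp add: field_simps)
        also have "\<dots> \<le> c * cmod (D y)" using D2[OF Im] 2 c(1) by (intro mult_left_mono) auto
        finally have "cmod (P y) \<le> c * cmod (D y)" using M[OF Im] by linarith
        moreover have "cmod (D y) > 0" using D1[OF Im] by linarith
        ultimately show ?thesis unfolding Q by (simp add: divide_le_eq)
      qed
    qed
    then have "cmod (P z) / cmod (D z) \<le> c" unfolding Q_def norm_divide .
    moreover have "cmod (D z) > 0" using D1[OF z] by linarith
    ultimately have "cmod (P z) \<le> c * cmod (D z)" by (simp add: divide_le_eq)
    then show ?thesis unfolding D_def .
  qed
  show ?thesis
  \<comment> \<open>With \<open>z\<close> fixed, the auxiliary parameter \<open>e\<close> tends to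
    0.\<close>
  proof (rule tendsto_le[of "at_right (0::real)"])
    have "((\<lambda>e. c * cmod (1 - \<i> * complex_of_real e * z)) \<longlongrightarrow> c * cmod (1 - \<i> * complex_of_real 0 * z)) (at_right 0)"
      by (intro tendsto_intros)
    then show "((\<lambda>e. c * cmod (1 - \<i> * complex_of_real e * z)) \<longlongrightarrow> c) (at_right 0)" by simp
    show "\<forall>\<^sub>F e in at_right 0. cmod (P z) \<le> c * cmod (1 - \<i> * complex_of_real e * z)"
      using eventually_at_right_less[of "0::real"] by eventually_elim (rule main)
  qed auto
qed

text \<open>Includes \<open>c = 0\<close>, the case that makes an extension vanish once its boundary
  values do.\<close>

lemma half_plane_max:
  assumes P: "half_plane_ext f P" and c: "\<And>t. cmod (f t) \<le> c" and z: "Im z \<ge> 0"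
  shows "cmod (P z) \<le> c"
proof (rule field_le_epsilon)
  fix e :: real assume e: "e > 0"
  have "c \<ge> 0" using c[of 0] norm_ge_zero order_trans by blast
  then show "cmod (P z) \<le> c + e"
    using c e by (intro half_plane_max_pos[OF P _ _ z]) (auto intro: order_trans[OF c])
qed

lemma half_plane_ext_diff:
  assumes "half_plane_ext f P" "half_plane_ext g Q"
  shows "half_plane_ext (\<lambda>t. f t - g t) (\<lambda>z. P z - Q z)"
proof -
  obtain M N where MN: "\<And>z. Im z \<ge> 0 \<Longrightarrow> cmod (P z) \<le> M" "\<And>z. Im z \<ge> 0 \<Longrightarrow> cmod (Q z) \<le> N"
    using assms unfolding half_plane_ext_def by blast
  have "cmod (P z - Q z) \<le> M + N" if "Im z \<ge> 0" for z
    using MN(1)[OF that] MN(2)[OF that] norm_triangle_ineq4[of "P z" "Q z"] by linarith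
  then show ?thesis
    using assms unfolding half_plane_ext_def by (auto intro!: holomorphic_intros continuous_intros)
qed

lemma half_plane_ext_mult:
  assumes "half_plane_ext f P" "half_plane_ext g Q"
  shows "half_plane_ext (\<lambda>t. f t * g t) (\<lambda>z. P z * Q z)"
proof -
  obtain M N where MN: "\<And>z. Im z \<ge> 0 \<Longrightarrow> cmod (P z) \<le> M" "\<And>z. Im z \<ge> 0 \<Longrightarrow> cmod (Q z) \<le> N"
    using assms unfolding half_plane_ext_def by blast
  have "cmod (P z * Q z) \<le> M * N" if "Im z \<ge> 0" for z
    unfolding norm_mult
    by (intro mult_mono MN that order_trans[OF norm_ge_zero MN(1)[OF that]] norm_ge_zero)
  then show ?thesis
    using assms unfolding half_plane_ext_def by (auto intro!: holomorphic_intros continuous_intros)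
qed

text \<open>A character extends as \<open>exp (\<i> * l * z)\<close>, of modulus
  \<open>exp (- l * Im z)\<close>; this is at most 1 above the line because
  \<open>l \<ge> 0\<close>.\<close>

lemma trig_half_plane_ext:
  assumes "p \<in> trig {0..}"
  shows "\<exists>P. half_plane_ext p P"
  using assms
proof induction
  case zero
  show ?case by (rule exI[of _ "\<lambda>z. 0"]) (auto simp: half_plane_ext_def)
next
  case (step p l c)
  then obtain P where P: "half_plane_ext p P" by blast
  then obtain M where M: "\<And>z. Im z \<ge> 0 \<Longrightarrow> cmod (P z) \<le> M" unfolding half_plane_ext_def by blast
  have "cmod (c * exp (\<i> * complex_of_real l * z) + P z) \<le> cmod c + M" if "Im z \<ge> 0" for z
  proof -
    have "cmod (exp (\<i> * complex_of_real l * z)) \<le> 1" using that step by (simp add: mult_nonneg_nonneg)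
    then have "cmod (c * exp (\<i> * complex_of_real l * z)) \<le> cmod c * 1"
      unfolding norm_mult by (intro mult_left_mono) auto
    then show ?thesis using M[OF that] norm_triangle_ineq[of "c * exp (\<i> * complex_of_real l * z)" "P z"] by linarith
  qed
  moreover have "exp (\<i> * complex_of_real l * complex_of_real t) = ee l t" for t
    unfolding ee_def cis_conv_exp by (simp add: mult.assoc)
  ultimately have "half_plane_ext (\<lambda>t. c * ee l t + p t) (\<lambda>z. c * exp (\<i> * complex_of_real l * z) + P z)"
    using P unfolding half_plane_ext_def by (auto intro!: holomorphic_intros continuous_intros)
  then show ?case by blast
qed

text \<open>The maximum principle carries sup distances from the line to the half-plane, so the
  extensions of the approximants are uniformly Cauchy.\<close>

lemma APS_half_plane_ext:
  assumes f: "f \<in> APS {0..}"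
  shows "\<exists>F. half_plane_ext f F"
proof -
  have "\<exists>P. \<forall>n. \<exists>p. (\<forall>t. cmod (f t - p t) \<le> 1 / real (Suc n)) \<and> half_plane_ext p (P n)"
  proof (intro choice allI)
    fix n
    obtain p where "p \<in> trig {0..}" "\<And>t. cmod (f t - p t) \<le> 1 / real (Suc n)"
      using APS_D[OF f, of "1 / real (Suc n)"] by auto
    then show "\<exists>P p. (\<forall>t. cmod (f t - p t) \<le> 1 / real (Suc n)) \<and> half_plane_ext p P"
      using trig_half_plane_ext by blast
  qed
  then obtain P where "\<And>n. \<exists>p. (\<forall>t. cmod (f t - p t) \<le> 1 / real (Suc n)) \<and> half_plane_ext p (P n)" by blast
  then obtain p where p: "\<And>n t. cmod (f t - p n t) \<le> 1 / real (Suc n)" "\<And>n. half_plane_ext (p n) (P n)"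
    by metis
  have PP: "cmod (P m z - P n z) \<le> 1 / real (Suc m) + 1 / real (Suc n)" if "Im z \<ge> 0" for m n z
  proof (rule half_plane_max[OF half_plane_ext_diff[OF p(2) p(2)] _ that])
    fix t
    show "cmod (p m t - p n t) \<le> 1 / real (Suc m) + 1 / real (Suc n)"
      using norm_triangle_ineq4[of "f t - p n t" "f t - p m t"] p(1)[of t m] p(1)[of t n] by simp
  qed
  have "uniformly_Cauchy_on {z. Im z \<ge> 0} P"
  proof (rule uniformly_Cauchy_onI)
    fix e :: real assume e: "e > 0"
    have "(\<lambda>n. 1 / real (Suc n)) \<longlonglongrightarrow> 0" by real_asymp
    then have "\<forall>\<^sub>F n in sequentially. 1 / real (Suc n) < e / 2"
      using e by (intro order_tendstoD) auto
    then obtain N where N: "\<And>n. n \<ge> N \<Longrightarrow> 1 / real (Suc n) < e / 2"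
      by (auto simp only: eventually_sequentially)
    have "dist (P m z) (P n z) < e" if "Im z \<ge> 0" "m \<ge> N" "n \<ge> N" for m n z
      using PP[OF that(1), of m n] N[OF that(2)] N[OF that(3)] unfolding dist_norm by linarith
    then show "\<exists>M. \<forall>z\<in>{z. Im z \<ge> 0}. \<forall>m\<ge>M. \<forall>n\<ge>M. dist (P m z) (P n z) < e" by blast
  qed
  then obtain F where F: "uniform_limit {z. Im z \<ge> 0} P F sequentially"
    using Cauchy_uniformly_convergent uniformly_convergent_on_def by blast
  have lim: "(\<lambda>n. P n z) \<longlonglongrightarrow> F z" if "Im z \<ge> 0" for z
    using tendsto_uniform_limitI[OF F] that by simp
  have "F holomorphic_on {z. Im z > 0}"
  proof (rule holomorphic_uniform_sequence[OF open_upper])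
    show "P n holomorphic_on {z. Im z > 0}" for n using p(2) unfolding half_plane_ext_def by blast
    fix x assume "x \<in> {z. Im z > 0}"
    then obtain d where d: "d > 0" "cball x d \<subseteq> {z. Im z > 0}"
      using open_upper open_contains_cball by blast
    moreover have "{z. Im z > 0} \<subseteq> {z. Im z \<ge> 0}" by auto
    ultimately show "\<exists>d>0. cball x d \<subseteq> {z. Im z > 0} \<and> uniform_limit (cball x d) P F sequentially"
      using uniform_limit_on_subset[OF F] by blast
  qed
  moreover have "continuous_on {z. Im z \<ge> 0} F"
    by (rule uniform_limit_theorem[OF _ F]) (use p(2) in \<open>auto simp: half_plane_ext_def\<close>)
  moreover have "\<exists>M. \<forall>z. Im z \<ge> 0 \<longrightarrow> cmod (F z) \<le> M"
  proof -
    obtain M where M: "\<And>z. Im z \<ge> 0 \<Longrightarrow> cmod (P 0 z) \<le> M"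
      using p(2)[of 0] unfolding half_plane_ext_def by blast
    have "cmod (F z) \<le> M + 2" if z: "Im z \<ge> 0" for z
    proof (rule Lim_norm_ubound[OF sequentially_bot lim[OF z]])
      have "cmod (P n z) \<le> M + 2" for n
      proof -
        have "1 / real (Suc n) \<le> 1" by simp
        moreover have "1 / real (Suc 0) = 1" by simp
        ultimately show ?thesis
          using M[OF z] PP[OF z, of n 0] norm_triangle_sub[of "P n z" "P 0 z"] by linarith
      qed
      then show "\<forall>\<^sub>F n in sequentially. cmod (P n z) \<le> M + 2" by simp
    qed
    then show ?thesis by blast
  qed
  moreover have "F (complex_of_real t) = f t" for t
  proof (rule LIMSEQ_unique[OF lim])
    show "(\<lambda>n. P n (complex_of_real t)) \<longlonglongrightarrow> f t"
    proof (rule LIM_zero_cancel, rule Lim_null_comparison)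
      show "\<forall>\<^sub>F n in sequentially. norm (P n (complex_of_real t) - f t) \<le> 1 / real (Suc n)"
        using p unfolding half_plane_ext_def by (simp add: norm_minus_commute del: of_nat_Suc)
      show "(\<lambda>n. 1 / real (Suc n)) \<longlonglongrightarrow> 0" by real_asymp
    qed
  qed simp
  ultimately show ?thesis unfolding half_plane_ext_def by blast
qed

lemma APS_nonneg_zero_product:
  assumes f: "f \<in> APS {0..}" and g: "g \<in> APS {0..}" and fg: "\<And>t. f t * g t = 0"
  shows "(\<forall>t. f t = 0) \<or> (\<forall>t. g t = 0)"
proof -
  obtain F where F: "half_plane_ext f F" using APS_half_plane_ext[OF f] by blast
  obtain G where G: "half_plane_ext g G" using APS_half_plane_ext[OF g] by blast
  have FG: "F z * G z = 0" if "Im z > 0" for z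
    using half_plane_max[OF half_plane_ext_mult[OF F G], of 0 z] fg that by simp
  \<comment> \<open>Continuity up to the line returns from the open half-plane to the boundary
    values.\<close>
  have boundary: "\<forall>t. h t = 0" if H: "half_plane_ext h H" and z: "\<And>z. Im z > 0 \<Longrightarrow> H z = 0" for h H
  proof
    fix t
    have cl: "z \<in> closure {z. Im z > 0}" if "Im z \<ge> 0" for z
      unfolding closure_approachable
    proof (intro allI impI)
      fix e :: real assume "e > 0"
      then show "\<exists>y\<in>{z. Im z > 0}. dist y z < e"
        using that by (intro bexI[of _ "z + \<i> * complex_of_real (e / 2)"]) (auto simp: dist_norm norm_mult)
    qed
    moreover have "closure {z. Im z > 0} \<subseteq> {z. Im z \<ge> 0}"
      by (rule closure_minimal) (auto intro!: closed_Collect_le continuous_intros)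
    ultimately have "continuous_on (closure {z. Im z > 0}) H"
      using H continuous_on_subset unfolding half_plane_ext_def by blast
    then have "H (complex_of_real t) = 0"
      by (rule continuous_constant_on_closure) (auto intro: z cl)
    then show "h t = 0" using H unfolding half_plane_ext_def by simp
  qed
  show ?thesis
  proof (cases "\<forall>z. Im z > 0 \<longrightarrow> F z = 0")
    case True
    then show ?thesis using boundary[OF F] by blast
  next
    case False
    then obtain z0 where z0: "Im z0 > 0" "F z0 \<noteq> 0" by blast
    have cF: "continuous_on {z. Im z > 0} F"
      using F unfolding half_plane_ext_def by (blast intro: holomorphic_on_imp_continuous_on)
    have op: "open ({z. Im z > 0} \<inter> F -` (- {0}))"
      by (rule continuous_open_preimage[OF cF open_upper]) auto
    have "G z = 0" if "Im z > 0" for z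
    proof (rule analytic_continuation[where f = G and S = "{z. Im z > 0}" and \<xi> = z0
          and U = "{z. Im z > 0} \<inter> F -` (- {0})"])
      show "G holomorphic_on {z. Im z > 0}" using G unfolding half_plane_ext_def by blast
      show "open {z. Im z > 0}" by (rule open_upper)
      show "connected {z. Im z > 0}" by (intro convex_connected convex_halfspace_Im_gt)
      show "z0 islimpt {z. Im z > 0} \<inter> F -` (- {0})"
        by (rule interior_limit_point) (unfold interior_open[OF op], use z0 in simp)
      show "G y = 0" if "y \<in> {z. Im z > 0} \<inter> F -` (- {0})" for y
        using FG[of y] that by auto
    qed (use z0 that in auto)
    then show ?thesis using boundary[OF G] by blast
  qed
qed

subsection \<open>The algebra of almost periodic functions\<close>

text \<open>The set where \<open>g\<close> exceeds \<open>c\<close> is open and null, hence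
  empty.\<close>

lemma lborel_AE_continuous_le:
  fixes g :: "real \<Rightarrow> real"
  assumes g: "continuous_on UNIV g" and ae: "AE x in lborel. g x \<le> c"
  shows "g x \<le> c"
proof (rule ccontr)
  assume "\<not> g x \<le> c"
  then have "x \<in> {x. c < g x}" by simp
  then have ne: "{x. c < g x} \<noteq> {}" by blast
  have op: "open {x. c < g x}" by (intro open_Collect_less g continuous_on_const)
  have "AE x in lborel. x \<notin> {x. c < g x}" using ae by eventually_elim auto
  then have "{x. c < g x} \<in> null_sets lborel"
    using op by (subst AE_iff_null_sets) auto
  then have "negligible {x. c < g x}"
    unfolding negligible_iff_null_sets by (rule null_sets_completionI)
  then show False using open_not_negligible[OF op ne] by blast
qed

lemma lborel_AE_ex:
  assumes "AE x in (lborel :: real measure). P x"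
  shows "\<exists>x. P x"
proof (rule ccontr)
  assume "\<nexists>x. P x"
  then have "AE x in (lborel :: real measure). (1 :: real) \<le> 0" using assms by simp
  then show False using lborel_AE_continuous_le[of "\<lambda>_. 1" 0] by auto
qed

lemma Linf_norm_AE:
  assumes "f \<in> Linf"
  shows "AE y in lborel. cmod (f y) \<le> Linf_norm f" and "Linf_norm f \<ge> 0"
proof -
  define E where "E = esssup lborel (\<lambda>y. ereal (cmod (f y)))"
  have ae: "AE y in lborel. ereal (cmod (f y)) \<le> E" unfolding E_def by (rule esssup_AE)
  \<comment> \<open>\<open>real_of_ereal\<close> sends both infinities to 0: this excludes
    \<open>-\<infinity>\<close>, and membership in \<open>Linf\<close> excludes
    \<open>\<infinity>\<close>.\<close>
  have "0 \<le> E"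
  proof -
    obtain y where "ereal (cmod (f y)) \<le> E" using lborel_AE_ex[OF ae] by blast
    moreover have "0 \<le> ereal (cmod (f y))" by simp
    ultimately show ?thesis by (rule order_trans[rotated])
  qed
  moreover have "E < \<infinity>" using assms unfolding Linf_def E_def by blast
  ultimately obtain e where e: "E = ereal e" "e \<ge> 0" by (cases E) auto
  then have n: "Linf_norm f = e" unfolding Linf_norm_def E_def[symmetric] by simp
  show "AE y in lborel. cmod (f y) \<le> Linf_norm f" using ae unfolding n e(1) by simp
  show "Linf_norm f \<ge> 0" using n e(2) by simp
qed

lemma Linf_I:
  assumes "f \<in> borel_measurable lborel" "AE y in lborel. cmod (f y) \<le> c"
  shows "f \<in> Linf" and "Linf_norm f \<le> c"
proof -
  have m: "(\<lambda>y. ereal (cmod (f y))) \<in> borel_measurable lborel" using assms(1) by measurable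
  have le: "esssup lborel (\<lambda>y. ereal (cmod (f y))) \<le> ereal c"
    by (rule esssup_I[OF m]) (use assms(2) in simp)
  then show f: "f \<in> Linf" unfolding Linf_def using assms(1) by (auto intro: order_le_less_trans)
  show "Linf_norm f \<le> c"
  proof (rule ccontr)
    assume "\<not> Linf_norm f \<le> c"
    moreover have "c \<ge> 0"
      using lborel_AE_ex[OF assms(2)] norm_ge_zero order_trans by blast
    ultimately show False
      using le unfolding Linf_norm_def by (cases "esssup lborel (\<lambda>y. ereal (cmod (f y)))") auto
  qed
qed

lemma continuous_Linf:
  fixes f :: "real \<Rightarrow> complex"
  assumes "continuous_on UNIV f" "\<And>t. cmod (f t) \<le> c"
  shows "f \<in> Linf" and "Linf_norm f \<le> c"
proof -
  have "f \<in> borel_measurable lborel" using borel_measurable_continuous_onI[OF assms(1)] by simp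
  moreover have "AE y in lborel. cmod (f y) \<le> c" using assms(2) by simp
  ultimately show "f \<in> Linf" "Linf_norm f \<le> c" by (rule Linf_I)+
qed

lemma APS_Linf:
  assumes "f \<in> APS S"
  shows "f \<in> Linf"
proof -
  obtain B where "\<And>t. cmod (f t) \<le> B" using APS_bounded[OF assms] by blast
  then show ?thesis by (rule continuous_Linf(1)[OF APS_continuous[OF assms]])
qed

lemma APS_norm_upper: "f \<in> APS S \<Longrightarrow> (\<And>t. cmod (f t) \<le> c) \<Longrightarrow> Linf_norm f \<le> c"
  by (rule continuous_Linf(2)[OF APS_continuous])

lemma APS_norm_bound:
  assumes "f \<in> APS S"
  shows "cmod (f t) \<le> Linf_norm f"
  by (rule lborel_AE_continuous_le[OF _ Linf_norm_AE(1)[OF APS_Linf[OF assms]]])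
    (intro continuous_intros APS_continuous[OF assms])

section \<open>Identification of \<open>AP\<close> and \<open>AP_plus\<close> with uniform
  closures\<close>

lemma closed_subalgebra_LinfD:
  assumes "closed_subalgebra_Linf A"
  shows "\<And>f g. f \<in> A \<Longrightarrow> g \<in> A \<Longrightarrow> (\<lambda>y. f y + g y) \<in> A"
    and "\<And>c f. f \<in> A \<Longrightarrow> (\<lambda>y. c * f y) \<in> A"
    and "\<And>u f. f \<in> Linf \<Longrightarrow> (\<And>n. u n \<in> A) \<Longrightarrow> (\<lambda>n. Linf_norm (\<lambda>y. u n y - f y)) \<longlonglongrightarrow> 0 \<Longrightarrow> f \<in> A"
proof -
  note A = assms[unfolded closed_subalgebra_Linf_def, THEN conjunct2]
  show "\<And>f g. f \<in> A \<Longrightarrow> g \<in> A \<Longrightarrow> (\<lambda>y. f y + g y) \<in> A"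
    by (rule A[THEN conjunct1, rule_format])
  show "\<And>c f. f \<in> A \<Longrightarrow> (\<lambda>y. c * f y) \<in> A"
    by (rule A[THEN conjunct2, THEN conjunct1, rule_format])
  show "\<And>u f. f \<in> Linf \<Longrightarrow> (\<And>n. u n \<in> A) \<Longrightarrow> (\<lambda>n. Linf_norm (\<lambda>y. u n y - f y)) \<longlonglongrightarrow> 0 \<Longrightarrow> f \<in> A"
    by (rule A[THEN conjunct2, THEN conjunct2, THEN conjunct2, rule_format])
qed

lemma trig_closed_subalgebra:
  assumes A: "closed_subalgebra_Linf A" and ex: "\<And>\<omega>::real. (\<lambda>y. exp (\<i> * complex_of_real (\<omega> * y))) \<in> A"
    and p: "p \<in> trig S"
  shows "p \<in> A"
  using p
proof induction
  case zero
  show ?case using closed_subalgebra_LinfD(2)[OF A ex[of 0], of 0] by simp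
next
  case (step p l c)
  have "(\<lambda>y. c * ee l y) \<in> A"
    using closed_subalgebra_LinfD(2)[OF A ex[of l], of c] by (simp only: ee_def cis_conv_exp)
  then show ?case using step.IH by (rule closed_subalgebra_LinfD(1)[OF A])
qed

text \<open>An upper bound for \<open>AP_Linf\<close>. It is formed modulo null sets because every
  closed subalgebra is saturated under equality almost everywhere; the uniform closure itself would
  not qualify.\<close>

definition trig_AE_closure :: "(real \<Rightarrow> complex) set"
  where "trig_AE_closure = {f \<in> borel_measurable lborel.
    \<forall>\<epsilon>>0. \<exists>p\<in>trig UNIV. AE y in lborel. cmod (f y - p y) \<le> \<epsilon>}"

lemma trig_AE_closure_I:
  assumes "f \<in> borel_measurable lborel"
    and "\<And>\<epsilon>. \<epsilon> > 0 \<Longrightarrow> \<exists>p\<in>trig UNIV. AE y in lborel. cmod (f y - p y) \<le> \<epsilon>"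
  shows "f \<in> trig_AE_closure"
  using assms unfolding trig_AE_closure_def by simp

lemma trig_AE_closure_measurable: "f \<in> trig_AE_closure \<Longrightarrow> f \<in> borel_measurable lborel"
  unfolding trig_AE_closure_def by simp

lemma trig_AE_closure_D:
  assumes "f \<in> trig_AE_closure" "\<epsilon> > 0"
  obtains p where "p \<in> trig UNIV" "AE y in lborel. cmod (f y - p y) \<le> \<epsilon>"
proof -
  have "\<forall>\<epsilon>>0. \<exists>p\<in>trig UNIV. AE y in lborel. cmod (f y - p y) \<le> \<epsilon>"
    using assms(1) unfolding trig_AE_closure_def by simp
  then have "\<exists>p\<in>trig UNIV. AE y in lborel. cmod (f y - p y) \<le> \<epsilon>" using assms(2) by simp
  then show ?thesis using that by (elim bexE)
qed

lemma trig_AE_closure_bounded: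
  assumes "f \<in> trig_AE_closure"
  obtains C where "C > 0" "AE y in lborel. cmod (f y) \<le> C"
proof -
  obtain p where p: "p \<in> trig UNIV" "AE y in lborel. cmod (f y - p y) \<le> 1"
    by (rule trig_AE_closure_D[OF assms zero_less_one])
  obtain C where C: "C > 0" "\<And>t. cmod (p t) \<le> C" using APS_bounded[OF APS_trig[OF p(1)]] by blast
  have "AE y in lborel. cmod (f y) \<le> 1 + C"
    using p(2)
  proof eventually_elim
    case (elim y)
    then show ?case using C(2)[of y] norm_triangle_sub[of "f y" "p y"] by linarith
  qed
  then show ?thesis using C(1) that[of "1 + C"] by simp
qed

lemma trig_AE_closure_Linf: "f \<in> trig_AE_closure \<Longrightarrow> f \<in> Linf"
  using trig_AE_closure_bounded Linf_I(1) trig_AE_closure_measurable by metis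

lemma trig_AE_closure_add:
  assumes f: "f \<in> trig_AE_closure" and g: "g \<in> trig_AE_closure"
  shows "(\<lambda>y. f y + g y) \<in> trig_AE_closure"
proof (rule trig_AE_closure_I)
  show "(\<lambda>y. f y + g y) \<in> borel_measurable lborel"
    using f g by (intro borel_measurable_add trig_AE_closure_measurable)
  fix \<epsilon> :: real assume "\<epsilon> > 0"
  then have e2: "\<epsilon> / 2 > 0" by simp
  obtain p where p: "p \<in> trig UNIV" "AE y in lborel. cmod (f y - p y) \<le> \<epsilon> / 2"
    by (rule trig_AE_closure_D[OF f e2])
  obtain q where q: "q \<in> trig UNIV" "AE y in lborel. cmod (g y - q y) \<le> \<epsilon> / 2"
    by (rule trig_AE_closure_D[OF g e2])
  have "AE y in lborel. cmod (f y + g y - (p y + q y)) \<le> \<epsilon>"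
    using p(2) q(2)
  proof eventually_elim
    case (elim y)
    then show ?case using norm_triangle_ineq[of "f y - p y" "g y - q y"] by (simp add: algebra_simps)
  qed
  then show "\<exists>p\<in>trig UNIV. AE y in lborel. cmod (f y + g y - p y) \<le> \<epsilon>"
    by (rule bexI[OF _ trig_add[OF p(1) q(1)]])
qed

lemma trig_AE_closure_mult:
  assumes f: "f \<in> trig_AE_closure" and g: "g \<in> trig_AE_closure"
  shows "(\<lambda>y. f y * g y) \<in> trig_AE_closure"
proof (rule trig_AE_closure_I)
  show "(\<lambda>y. f y * g y) \<in> borel_measurable lborel"
    using f g by (intro borel_measurable_times trig_AE_closure_measurable)
  fix \<epsilon> :: real assume e: "\<epsilon> > 0"
  obtain C where C: "C > 0" "AE y in lborel. cmod (g y) \<le> C" by (rule trig_AE_closure_bounded[OF g])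
  have eC: "\<epsilon> / (2 * C) > 0" using e C(1) by simp
  obtain p where p: "p \<in> trig UNIV" "AE y in lborel. cmod (f y - p y) \<le> \<epsilon> / (2 * C)"
    by (rule trig_AE_closure_D[OF f eC])
  obtain D where D: "D > 0" "\<And>t. cmod (p t) \<le> D" using APS_bounded[OF APS_trig[OF p(1)]] by blast
  have eD: "\<epsilon> / (2 * D) > 0" using e D(1) by simp
  obtain q where q: "q \<in> trig UNIV" "AE y in lborel. cmod (g y - q y) \<le> \<epsilon> / (2 * D)"
    by (rule trig_AE_closure_D[OF g eD])
  have "AE y in lborel. cmod (f y * g y - p y * q y) \<le> \<epsilon>"
    using p(2) q(2) C(2)
  proof eventually_elim
    case (elim y)
    have "f y * g y - p y * q y = (f y - p y) * g y + p y * (g y - q y)" by (simp add: algebra_simps)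
    then have "cmod (f y * g y - p y * q y) \<le> cmod (f y - p y) * cmod (g y) + cmod (p y) * cmod (g y - q y)"
      using norm_triangle_ineq[of "(f y - p y) * g y" "p y * (g y - q y)"] by (simp only: norm_mult)
    also have "\<dots> \<le> \<epsilon> / (2 * C) * C + D * (\<epsilon> / (2 * D))"
      using elim C(1) D eC eD by (intro add_mono mult_mono) (auto simp: less_imp_le)
    also have "\<dots> = \<epsilon>" using C(1) D(1) by simp
    finally show ?case .
  qed
  then show "\<exists>p\<in>trig UNIV. AE y in lborel. cmod (f y * g y - p y) \<le> \<epsilon>"
    by (rule bexI[OF _ trig_mult[OF p(1) q(1)]]) simp
qed

lemma trig_AE_closure_trig:
  assumes "p \<in> trig S"
  shows "p \<in> trig_AE_closure"
proof (rule trig_AE_closure_I)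
  show "p \<in> borel_measurable lborel"
    using borel_measurable_continuous_onI[OF trig_continuous[OF assms]] by simp
  have "p \<in> trig UNIV" using trig_mono[OF assms] by simp
  then show "\<exists>q\<in>trig UNIV. AE y in lborel. cmod (p y - q y) \<le> \<epsilon>" if "\<epsilon> > 0" for \<epsilon>
    using that by (intro bexI[of _ p]) auto
qed

lemma closed_subalgebra_trig_AE_closure: "closed_subalgebra_Linf trig_AE_closure"
  unfolding closed_subalgebra_Linf_def
proof (intro conjI ballI allI impI)
  show sub: "trig_AE_closure \<subseteq> Linf" using trig_AE_closure_Linf by blast
  show "(\<lambda>y. c * f y) \<in> trig_AE_closure" if "f \<in> trig_AE_closure" for c f
    using trig_AE_closure_mult[OF trig_AE_closure_trig[OF trig_monom[of 0 UNIV c]] that] by simp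
  fix u :: "nat \<Rightarrow> real \<Rightarrow> complex" and f
  assume f: "f \<in> Linf" and u: "\<forall>n. u n \<in> trig_AE_closure"
    and lim: "(\<lambda>n. Linf_norm (\<lambda>y. u n y - f y)) \<longlonglongrightarrow> 0"
  show "f \<in> trig_AE_closure"
  proof (rule trig_AE_closure_I)
    show fm: "f \<in> borel_measurable lborel" using f unfolding Linf_def by simp
    fix \<epsilon> :: real assume e: "\<epsilon> > 0"
    then have e2: "\<epsilon> / 2 > 0" by simp
    obtain n where n: "Linf_norm (\<lambda>y. u n y - f y) < \<epsilon> / 2"
      using order_tendstoD(2)[OF lim e2] unfolding eventually_sequentially by blast
    have un: "u n \<in> trig_AE_closure" using u by blast
    have "(\<lambda>y. u n y - f y) \<in> Linf"
    proof (rule Linf_I(1))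
      show "(\<lambda>y. u n y - f y) \<in> borel_measurable lborel"
        by (intro borel_measurable_diff fm trig_AE_closure_measurable un)
      show "AE y in lborel. cmod (u n y - f y) \<le> Linf_norm (u n) + Linf_norm f"
        using Linf_norm_AE(1)[OF f] Linf_norm_AE(1)[OF trig_AE_closure_Linf[OF un]]
      proof eventually_elim
        case (elim y)
        then show ?case using norm_triangle_ineq4[of "u n y" "f y"] by linarith
      qed
    qed
    then have ae: "AE y in lborel. cmod (u n y - f y) \<le> Linf_norm (\<lambda>y. u n y - f y)" by (rule Linf_norm_AE)
    obtain p where p: "p \<in> trig UNIV" "AE y in lborel. cmod (u n y - p y) \<le> \<epsilon> / 2"
      by (rule trig_AE_closure_D[OF un e2])
    have "AE y in lborel. cmod (f y - p y) \<le> \<epsilon>"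
      using ae p(2)
    proof eventually_elim
      case (elim y)
      then show ?case using n norm_triangle_ineq4[of "u n y - p y" "u n y - f y"] by simp
    qed
    then show "\<exists>p\<in>trig UNIV. AE y in lborel. cmod (f y - p y) \<le> \<epsilon>" using p(1) by (rule bexI)
  qed
qed (simp_all add: trig_AE_closure_add trig_AE_closure_mult)

text \<open>For one inclusion, \<open>trig_AE_closure\<close> is among the algebras intersected, and
  continuity upgrades its bounds to all points. For the other, every such algebra contains the
  trigonometric polynomials and hence their uniform limits.\<close>

lemma AP_eq: "AP = APS UNIV"
proof (intro equalityI subsetI)
  fix f assume f: "f \<in> AP"
  have "(\<lambda>y. exp (\<i> * complex_of_real (\<omega> * y))) \<in> trig_AE_closure" for \<omega> :: real
    using trig_AE_closure_trig[OF trig_ee[of \<omega> UNIV]] by (simp add: ee_def[abs_def] cis_conv_exp)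
  then have "AP_Linf \<subseteq> trig_AE_closure"
    unfolding AP_Linf_def by (intro Inter_lower CollectI conjI closed_subalgebra_trig_AE_closure allI)
  then have fB: "f \<in> trig_AE_closure" and cf: "continuous_on UNIV f" using f unfolding AP_def by auto
  show "f \<in> APS UNIV"
    unfolding APS_def
  proof safe
    fix \<epsilon> :: real assume "\<epsilon> > 0"
    then obtain p where p: "p \<in> trig UNIV" "AE y in lborel. cmod (f y - p y) \<le> \<epsilon>"
      using trig_AE_closure_D[OF fB] by blast
    have "cmod (f t - p t) \<le> \<epsilon>" for t
      by (rule lborel_AE_continuous_le[OF _ p(2)]) (intro continuous_intros cf trig_continuous[OF p(1)])
    then show "\<exists>p\<in>trig UNIV. \<forall>t. cmod (f t - p t) \<le> \<epsilon>" using p(1) by blast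
  qed
next
  fix f assume f: "f \<in> APS UNIV"
  have "f \<in> A" if A: "closed_subalgebra_Linf A" "\<forall>\<omega>::real. (\<lambda>y. exp (\<i> * complex_of_real (\<omega> * y))) \<in> A" for A
  proof -
    obtain p where p: "\<And>n. p n \<in> trig UNIV" "\<And>n t. cmod (f t - p n t) \<le> 1 / real (Suc n)"
      using APS_sequence[OF f] by blast
    have pf: "(\<lambda>y. p n y - f y) \<in> APS UNIV" for n by (intro APS_diff APS_trig p f)
    have "p n \<in> A" for n by (rule trig_closed_subalgebra[OF A(1) A(2)[rule_format] p(1)])
    moreover have "(\<lambda>n. Linf_norm (\<lambda>y. p n y - f y)) \<longlonglongrightarrow> 0"
    proof (rule Lim_null_comparison)
      have "norm (Linf_norm (\<lambda>y. p n y - f y)) \<le> 1 / real (Suc n)" for n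
      proof -
        have "Linf_norm (\<lambda>y. p n y - f y) \<le> 1 / real (Suc n)"
          by (rule APS_norm_upper[OF pf]) (use p(2) in \<open>simp add: norm_minus_commute del: of_nat_Suc\<close>)
        then show ?thesis using Linf_norm_AE(2)[OF APS_Linf[OF pf]] by simp
      qed
      then show "\<forall>\<^sub>F n in sequentially. norm (Linf_norm (\<lambda>y. p n y - f y)) \<le> 1 / real (Suc n)" by simp
      show "(\<lambda>n. 1 / real (Suc n)) \<longlonglongrightarrow> 0" by real_asymp
    qed
    ultimately show ?thesis by (rule closed_subalgebra_LinfD(3)[OF A(1) APS_Linf[OF f]])
  qed
  then have "f \<in> AP_Linf" unfolding AP_Linf_def by (intro InterI) simp
  then show "f \<in> AP" using APS_continuous[OF f] unfolding AP_def by simp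
qed

lemma bohr_coeff_has_mean:
  assumes "has_mean (\<lambda>s. f s * ee (- l) s) m"
  shows "bohr_coeff f l = m"
proof -
  have "ee (- l) y = exp (- \<i> * complex_of_real (l * y))" for y
    unfolding ee_def cis_conv_exp by simp
  then have "(\<lambda>N. complex_of_real (1 / (2 * N)) * integral {-N..N} (\<lambda>y. exp (- \<i> * complex_of_real (l * y)) * f y)) =
      avg (\<lambda>s. f s * ee (- l) s)"
    unfolding avg_def by (simp add: mult.commute)
  then show ?thesis
    using assms unfolding bohr_coeff_def has_mean_def by (simp only:) (intro tendsto_Lim, simp_all)
qed

lemma AP_plus_eq: "AP_plus = APS {0..}"
proof (intro equalityI subsetI)
  fix f assume "f \<in> AP_plus"
  then have f: "f \<in> APS UNIV" and sp: "\<And>l. bohr_coeff f l \<noteq> 0 \<Longrightarrow> l \<in> {0..}"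
    unfolding AP_plus_def AP_eq bohr_spectrum_def by auto
  have "has_mean (\<lambda>s. f s * ee (- l) s) 0" if l: "l \<notin> {0..}" for l
  proof -
    \<comment> \<open>Existence of the mean comes first; only then does a zero value of the
      \<open>Lim\<close> in \<open>bohr_coeff\<close> say that the mean is 0.\<close>
    obtain m where m: "has_mean (\<lambda>s. f s * ee (- l) s) m"
      using APS_mean_exists[OF APS_mult_UNIV[OF f APS_trig[OF trig_ee]]] by blast
    moreover have "m = 0" using bohr_coeff_has_mean[OF m] sp[of l] l by blast
    ultimately show ?thesis by simp
  qed
  then show "f \<in> APS {0..}" by (intro APS_spectrum[OF f]) auto
next
  fix f assume f: "f \<in> APS {0..}"
  have "bohr_coeff f l = 0" if "l \<notin> {0..}" for l
    by (rule bohr_coeff_has_mean[OF APS_coeff_zero[OF f that]])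
  then show "f \<in> AP_plus"
    using APS_mono[OF f] unfolding AP_plus_def AP_eq bohr_spectrum_def by auto
qed

section \<open>Ring structure, norm and completeness\<close>

lemma carrier_AP [simp]: "carrier AP_algebra = APS UNIV"
  by (simp add: AP_algebra_def AP_eq)

lemma AP_algebra_ops [simp]:
  "mult AP_algebra = (\<lambda>f g y. f y * g y)" "one AP_algebra = (\<lambda>y. 1)"
  "zero AP_algebra = (\<lambda>y. 0)" "add AP_algebra = (\<lambda>f g y. f y + g y)"
  "smult AP_algebra = (\<lambda>c f y. c * f y)" "alg_norm AP_algebra = Linf_norm"
  "alg_star AP_algebra = (\<lambda>f y. cnj (f y))"
  by (simp_all add: AP_algebra_def)

lemma cring_function_algebra:
  assumes "(\<lambda>y. 1) \<in> T" "(\<lambda>y. 0) \<in> T" "\<And>f. f \<in> T \<Longrightarrow> (\<lambda>y. - f y) \<in> T"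
    "\<And>f g. f \<in> T \<Longrightarrow> g \<in> T \<Longrightarrow> (\<lambda>y. f y + g y) \<in> T"
    "\<And>f g. f \<in> T \<Longrightarrow> g \<in> T \<Longrightarrow> (\<lambda>y. f y * g y) \<in> T"
  shows "cring (AP_algebra\<lparr>carrier := T\<rparr>)"
proof (rule cringI)
  show "abelian_group (AP_algebra\<lparr>carrier := T\<rparr>)"
  proof (rule abelian_groupI)
    fix x assume "x \<in> carrier (AP_algebra\<lparr>carrier := T\<rparr>)"
    then show "\<exists>y\<in>carrier (AP_algebra\<lparr>carrier := T\<rparr>).
        y \<oplus>\<^bsub>AP_algebra\<lparr>carrier := T\<rparr>\<^esub> x = \<zero>\<^bsub>AP_algebra\<lparr>carrier := T\<rparr>\<^esub>"
      using assms(3)[of x] by (intro bexI[of _ "\<lambda>y. - x y"]) auto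
  qed (use assms in \<open>auto simp: algebra_simps\<close>)
  show "comm_monoid (AP_algebra\<lparr>carrier := T\<rparr>)"
    by (rule comm_monoidI) (use assms in \<open>auto simp: algebra_simps\<close>)
qed (auto simp: algebra_simps)

lemma cring_AP: "cring AP_algebra"
proof -
  have "AP_algebra\<lparr>carrier := APS UNIV\<rparr> = AP_algebra"
    by (simp add: AP_algebra_def AP_eq)
  moreover have "cring (AP_algebra\<lparr>carrier := APS UNIV\<rparr>)"
    by (rule cring_function_algebra) (simp_all add: APS_const APS_uminus APS_add APS_mult_UNIV)
  ultimately show ?thesis by (simp only:)
qed

lemma APS_nonneg_mult: "f \<in> APS {0..} \<Longrightarrow> g \<in> APS {0..} \<Longrightarrow> (\<lambda>y. f y * g y) \<in> APS {0..}"
  by (rule APS_mult) auto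

lemma cring_AP_plus: "cring (AP_algebra\<lparr>carrier := AP_plus\<rparr>)"
  unfolding AP_plus_eq
  by (rule cring_function_algebra) (simp_all add: APS_const APS_uminus APS_add APS_nonneg_mult)

lemma AP_a_inv:
  assumes "y \<in> APS UNIV"
  shows "\<ominus>\<^bsub>AP_algebra\<^esub> y = (\<lambda>t. - y t)"
proof -
  interpret cring AP_algebra by (rule cring_AP)
  show ?thesis
    by (rule minus_equality) (use assms in \<open>simp_all add: APS_uminus\<close>)
qed

lemma AP_a_minus:
  assumes "y \<in> APS UNIV"
  shows "x \<ominus>\<^bsub>AP_algebra\<^esub> y = (\<lambda>t. x t - y t)"
  unfolding a_minus_def AP_a_inv[OF assms] by simp

lemma AP_dist:
  assumes "x \<in> APS UNIV" "y \<in> APS UNIV"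
  shows "alg_dist AP_algebra x y = Linf_norm (\<lambda>t. x t - y t)"
  using assms by (simp add: alg_dist_def AP_a_minus)

lemma Linf_norm_nonneg: "f \<in> APS S \<Longrightarrow> 0 \<le> Linf_norm f"
  using APS_norm_bound norm_ge_zero order_trans by blast

lemma Linf_norm_add:
  assumes "f \<in> APS UNIV" "g \<in> APS UNIV"
  shows "Linf_norm (\<lambda>y. f y + g y) \<le> Linf_norm f + Linf_norm g"
  by (rule APS_norm_upper[OF APS_add[OF assms]])
    (rule order_trans[OF norm_triangle_ineq add_mono[OF APS_norm_bound[OF assms(1)] APS_norm_bound[OF assms(2)]]])

lemma Linf_norm_mult:
  assumes "f \<in> APS UNIV" "g \<in> APS UNIV"
  shows "Linf_norm (\<lambda>y. f y * g y) \<le> Linf_norm f * Linf_norm g"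
proof (rule APS_norm_upper[OF APS_mult_UNIV[OF assms]])
  show "cmod (f t * g t) \<le> Linf_norm f * Linf_norm g" for t
    unfolding norm_mult
    by (rule mult_mono[OF APS_norm_bound[OF assms(1)] APS_norm_bound[OF assms(2)]
      Linf_norm_nonneg[OF assms(1)] norm_ge_zero])
qed

lemma Linf_norm_cmult_le:
  assumes "f \<in> APS UNIV"
  shows "Linf_norm (\<lambda>y. c * f y) \<le> cmod c * Linf_norm f"
  by (rule APS_norm_upper[OF APS_cmult[OF assms]])
    (simp add: norm_mult mult_left_mono APS_norm_bound[OF assms])

lemma Linf_norm_cmult:
  assumes "f \<in> APS UNIV"
  shows "Linf_norm (\<lambda>y. c * f y) = cmod c * Linf_norm f"
proof (rule antisym[OF Linf_norm_cmult_le[OF assms]])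
  show "cmod c * Linf_norm f \<le> Linf_norm (\<lambda>y. c * f y)"
  proof (cases "c = 0")
    case True
    then show ?thesis using Linf_norm_nonneg[OF APS_cmult[OF assms, of c]] by simp
  next
    case False
    have "Linf_norm (\<lambda>y. inverse c * (c * f y)) \<le> cmod (inverse c) * Linf_norm (\<lambda>y. c * f y)"
      by (rule Linf_norm_cmult_le[OF APS_cmult[OF assms]])
    moreover have "(\<lambda>y. inverse c * (c * f y)) = f" using False by (simp add: fun_eq_iff)
    ultimately have "Linf_norm f \<le> inverse (cmod c) * Linf_norm (\<lambda>y. c * f y)"
      by (simp only: norm_inverse)
    then have "cmod c * Linf_norm f \<le> cmod c * (inverse (cmod c) * Linf_norm (\<lambda>y. c * f y))"
      by (intro mult_left_mono) simp_all
    then show ?thesis using False by (simp flip: mult.assoc)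
  qed
qed

lemma Linf_norm_eq_0:
  assumes "f \<in> APS UNIV"
  shows "Linf_norm f = 0 \<longleftrightarrow> f = (\<lambda>y. 0)"
proof
  assume "Linf_norm f = 0"
  then have "cmod (f t) \<le> 0" for t using APS_norm_bound[OF assms, of t] by simp
  then show "f = (\<lambda>y. 0)" by auto
next
  assume "f = (\<lambda>y. 0)"
  then have "Linf_norm f \<le> 0" by (intro APS_norm_upper[OF assms]) simp
  then show "Linf_norm f = 0" using Linf_norm_nonneg[OF assms] by simp
qed

lemma Linf_norm_1: "Linf_norm (\<lambda>y. 1) = 1"
proof (rule antisym)
  have 1: "(\<lambda>y. 1) \<in> APS UNIV" by (simp add: APS_const)
  show "Linf_norm (\<lambda>y. 1) \<le> 1" by (rule APS_norm_upper[OF 1]) simp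
  show "1 \<le> Linf_norm (\<lambda>y. 1)" using APS_norm_bound[OF 1] by simp
qed

lemma Linf_norm_minus_commute: "Linf_norm (\<lambda>t. x t - y t) = Linf_norm (\<lambda>t. y t - x t)"
  unfolding Linf_norm_def by (simp add: norm_minus_commute)

lemma AP_Metric_space: "Metric_space (APS UNIV) (alg_dist AP_algebra)"
proof
  fix x y :: "real \<Rightarrow> complex"
  show "0 \<le> alg_dist AP_algebra x y"
  proof (cases "x \<in> APS UNIV \<and> y \<in> APS UNIV")
    case True
    then show ?thesis using Linf_norm_nonneg[OF APS_diff[of x UNIV y]] by (simp add: AP_dist)
  qed (auto simp: alg_dist_def)
  show "alg_dist AP_algebra x y = alg_dist AP_algebra y x"
  proof (cases "x \<in> APS UNIV \<and> y \<in> APS UNIV")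
    case True
    then show ?thesis by (simp add: AP_dist Linf_norm_minus_commute[of x y])
  qed (auto simp: alg_dist_def)
next
  fix x y :: "real \<Rightarrow> complex"
  assume x: "x \<in> APS UNIV" and y: "y \<in> APS UNIV"
  have "alg_dist AP_algebra x y = 0 \<longleftrightarrow> (\<lambda>t. x t - y t) = (\<lambda>t. 0)"
    unfolding AP_dist[OF x y] by (rule Linf_norm_eq_0[OF APS_diff[OF x y]])
  then show "(alg_dist AP_algebra x y = 0) = (x = y)" by (simp add: fun_eq_iff)
  fix z assume z: "z \<in> APS UNIV"
  have "(\<lambda>t. x t - z t) = (\<lambda>t. (x t - y t) + (y t - z t))" by simp
  then show "alg_dist AP_algebra x z \<le> alg_dist AP_algebra x y + alg_dist AP_algebra y z"
    unfolding AP_dist[OF x y] AP_dist[OF y z] AP_dist[OF x z]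
    using Linf_norm_add[OF APS_diff[OF x y] APS_diff[OF y z]] by simp
qed

lemma AP_complete: "Metric_space.mcomplete (APS UNIV) (alg_dist AP_algebra)"
proof -
  interpret M: Metric_space "APS UNIV" "alg_dist AP_algebra" by (rule AP_Metric_space)
  show ?thesis
    unfolding M.mcomplete_def
  proof (intro allI impI)
    fix \<sigma> assume "M.MCauchy \<sigma>"
    then have s: "\<And>n. \<sigma> n \<in> APS UNIV"
      and C: "\<And>e. e > 0 \<Longrightarrow> \<exists>N. \<forall>n n'. N \<le> n \<longrightarrow> N \<le> n' \<longrightarrow> alg_dist AP_algebra (\<sigma> n) (\<sigma> n') < e"
      unfolding M.MCauchy_def by auto
    have pt: "cmod (\<sigma> n t - \<sigma> k t) \<le> alg_dist AP_algebra (\<sigma> n) (\<sigma> k)" for n k t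
      unfolding AP_dist[OF s s] by (rule APS_norm_bound[OF APS_diff[OF s s]])
    have "uniformly_Cauchy_on UNIV \<sigma>"
    proof (rule uniformly_Cauchy_onI)
      fix e :: real assume "e > 0"
      then obtain N where N: "\<And>n k. N \<le> n \<Longrightarrow> N \<le> k \<Longrightarrow> alg_dist AP_algebra (\<sigma> n) (\<sigma> k) < e" using C by blast
      have "dist (\<sigma> m t) (\<sigma> n t) < e" if "m \<ge> N" "n \<ge> N" for m n t
        unfolding dist_norm using pt[of m t n] N[OF that] by linarith
      then show "\<exists>N. \<forall>t\<in>UNIV. \<forall>m\<ge>N. \<forall>n\<ge>N. dist (\<sigma> m t) (\<sigma> n t) < e" by blast
    qed
    then obtain f where f: "uniform_limit UNIV \<sigma> f sequentially"
      using Cauchy_uniformly_convergent uniformly_convergent_on_def by blast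
    have near: "\<exists>N. \<forall>n\<ge>N. \<forall>t. cmod (\<sigma> n t - f t) \<le> e" if "e > 0" for e
      using uniform_limitD[OF f that] unfolding eventually_sequentially dist_norm
      by (meson UNIV_I less_imp_le)
    have fA: "f \<in> APS UNIV"
    proof (rule APS_limit)
      fix e :: real assume "e > 0"
      then obtain N where "\<forall>n\<ge>N. \<forall>t. cmod (\<sigma> n t - f t) \<le> e" using near by blast
      then have "\<forall>t. cmod (f t - \<sigma> N t) \<le> e" by (simp add: norm_minus_commute)
      then show "\<exists>g\<in>APS UNIV. \<forall>t. cmod (f t - g t) \<le> e" using s by (intro bexI[of _ "\<sigma> N"])
    qed
    have "limitin M.mtopology \<sigma> f sequentially"
      unfolding M.limit_metric_sequentially
    proof (intro conjI fA allI impI)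
      fix e :: real assume e: "e > 0"
      then obtain N where N: "\<forall>n\<ge>N. \<forall>t. cmod (\<sigma> n t - f t) \<le> e / 2" using near[of "e / 2"] by auto
      have "\<sigma> n \<in> APS UNIV \<and> alg_dist AP_algebra (\<sigma> n) f < e" if "n \<ge> N" for n
      proof -
        have "Linf_norm (\<lambda>t. \<sigma> n t - f t) \<le> e / 2"
          by (rule APS_norm_upper[OF APS_diff[OF s fA]]) (use N that in simp)
        then show ?thesis using e s unfolding AP_dist[OF s fA] by simp
      qed
      then show "\<exists>N. \<forall>n\<ge>N. \<sigma> n \<in> APS UNIV \<and> alg_dist AP_algebra (\<sigma> n) f < e" by blast
    qed
    then show "\<exists>x. limitin M.mtopology \<sigma> x sequentially" by blast
  qed
qed

lemma cring_complex_ring: "cring complex_ring"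
proof (rule cringI)
  show "abelian_group complex_ring"
  proof (rule abelian_groupI)
    fix x assume "x \<in> carrier complex_ring"
    show "\<exists>y\<in>carrier complex_ring. y \<oplus>\<^bsub>complex_ring\<^esub> x = \<zero>\<^bsub>complex_ring\<^esub>"
      by (rule bexI[of _ "- x"]) (simp_all add: complex_ring_def)
  qed (simp_all add: complex_ring_def)
  show "comm_monoid complex_ring"
    by (rule comm_monoidI) (simp_all add: complex_ring_def)
qed (simp add: complex_ring_def algebra_simps)

lemma algebra_AP: "algebra complex_ring AP_algebra"
  by (rule algebraI[OF cring_complex_ring cring_AP])
    (simp_all add: APS_cmult complex_ring_def algebra_simps)

lemma comm_banach_star_algebra_AP: "comm_banach_star_algebra AP_algebra"
proof (intro comm_banach_star_algebra.intro comm_banach_star_algebra_axioms.intro algebra_AP, unfold carrier_AP AP_algebra_ops)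
  show "Metric_space.mcomplete (APS UNIV) (alg_dist AP_algebra)" by (rule AP_complete)
  show "Linf_norm (\<lambda>y. 1) = 1" by (rule Linf_norm_1)
  fix x y :: "real \<Rightarrow> complex" and c :: complex
  assume x: "x \<in> APS UNIV"
  show "0 \<le> Linf_norm x" by (rule Linf_norm_nonneg[OF x])
  show "Linf_norm x = 0 \<longleftrightarrow> x = (\<lambda>y. 0)" by (rule Linf_norm_eq_0[OF x])
  show "Linf_norm (\<lambda>y. c * x y) = cmod c * Linf_norm x" by (rule Linf_norm_cmult[OF x])
  show "(\<lambda>y. cnj (x y)) \<in> APS UNIV" by (rule APS_cnj_UNIV[OF x])
  show "(\<lambda>y. cnj (cnj (x y))) = x" by simp
  show "(\<lambda>y. cnj (c * x y)) = (\<lambda>y. cnj c * cnj (x y))" by simp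
  assume y: "y \<in> APS UNIV"
  show "Linf_norm (\<lambda>t. x t + y t) \<le> Linf_norm x + Linf_norm y" by (rule Linf_norm_add[OF x y])
  show "Linf_norm (\<lambda>t. x t * y t) \<le> Linf_norm x * Linf_norm y" by (rule Linf_norm_mult[OF x y])
  show "(\<lambda>t. cnj (x t + y t)) = (\<lambda>t. cnj (x t) + cnj (y t))" by simp
  show "(\<lambda>t. cnj (x t * y t)) = (\<lambda>t. cnj (y t) * cnj (x t))" by (simp add: mult.commute)
qed

text \<open>If a larger ideal contains \<open>g\<close> with \<open>g t \<noteq> 0\<close>, then it
  contains \<open>g / g t\<close> and also \<open>1 - g / g t\<close>, which vanishes at
  \<open>t\<close>, and therefore 1.\<close>

lemma maximalideal_AP_eval:
  "maximalideal {g \<in> APS UNIV. g t = 0} AP_algebra"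
proof -
  interpret A: cring AP_algebra by (rule cring_AP)
  have ideal: "ideal {g \<in> APS UNIV. g t = 0} AP_algebra"
  proof (rule idealI)
    show "ring AP_algebra" by (rule A.ring_axioms)
    show "subgroup {g \<in> APS UNIV. g t = 0} (add_monoid AP_algebra)"
    proof (rule subgroup.intro)
      fix x assume x: "x \<in> {g \<in> APS UNIV. g t = 0}"
      then have "inv\<^bsub>add_monoid AP_algebra\<^esub> x = (\<lambda>t. - x t)"
        using AP_a_inv[of x] by (simp add: a_inv_def)
      then show "inv\<^bsub>add_monoid AP_algebra\<^esub> x \<in> {g \<in> APS UNIV. g t = 0}"
        using x by (simp add: APS_uminus)
    qed (simp_all add: APS_add APS_const Collect_restrict)
  qed (simp_all add: APS_mult_UNIV)
  then show ?thesis
  proof (rule maximalideal.intro, unfold maximalideal_axioms_def, intro conjI allI impI)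
    have "(\<lambda>y. 1) \<in> carrier AP_algebra" by (simp add: APS_const)
    moreover have "(\<lambda>y. 1) \<notin> {g \<in> APS UNIV. g t = 0}" by simp
    ultimately show "carrier AP_algebra \<noteq> {g \<in> APS UNIV. g t = 0}" by (metis (no_types))
    fix J assume J: "ideal J AP_algebra" and sub: "{g \<in> APS UNIV. g t = 0} \<subseteq> J" and JA: "J \<subseteq> carrier AP_algebra"
    interpret J: ideal J AP_algebra by (rule J)
    show "J = {g \<in> APS UNIV. g t = 0} \<or> J = carrier AP_algebra"
    proof (cases "J = {g \<in> APS UNIV. g t = 0}")
      case False
      then obtain g where gJ: "g \<in> J" and "g \<notin> {g \<in> APS UNIV. g t = 0}" using sub by blast
      moreover have "g \<in> APS UNIV" using subsetD[OF JA gJ] by simp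
      ultimately have g: "g \<in> J" "g \<in> APS UNIV" "g t \<noteq> 0" by simp_all
      have "(\<lambda>y. inverse (g t)) \<in> APS UNIV" by (simp add: APS_const)
      then have 1: "(\<lambda>y. inverse (g t) * g y) \<in> J"
        using J.I_l_closed[OF g(1), of "\<lambda>y. inverse (g t)"] by simp
      have "(\<lambda>y. 1 - inverse (g t) * g y) \<in> APS UNIV"
        by (rule APS_diff[OF APS_const APS_cmult[OF g(2)]]) simp
      then have "(\<lambda>y. 1 - inverse (g t) * g y) \<in> {g \<in> APS UNIV. g t = 0}" using g(3) by simp
      then have 2: "(\<lambda>y. 1 - inverse (g t) * g y) \<in> J" by (rule subsetD[OF sub])
      have "(\<lambda>y. 1) \<in> J" using J.a_closed[OF 1 2] by simp
      then have "\<one>\<^bsub>AP_algebra\<^esub> \<in> J" by simp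
      then show ?thesis using J.one_imp_carrier by blast
    qed simp
  qed
qed

text \<open>The evaluation ideals alone already intersect in 0.\<close>

lemma semisimple_AP: "semisimple AP_algebra"
  unfolding semisimple_def
proof (intro equalityI subsetI)
  fix f assume f: "f \<in> \<Inter> {I. maximalideal I AP_algebra}"
  have "f t = 0" for t
  proof -
    have "{g \<in> APS UNIV. g t = 0} \<in> {I. maximalideal I AP_algebra}"
      unfolding mem_Collect_eq[of _ "\<lambda>I. maximalideal I AP_algebra"] by (rule maximalideal_AP_eval)
    then have "f \<in> {g \<in> APS UNIV. g t = 0}" by (rule InterD[OF f])
    then show ?thesis by simp
  qed
  then show "f \<in> {\<zero>\<^bsub>AP_algebra\<^esub>}" by auto
next
  fix f assume "f \<in> {\<zero>\<^bsub>AP_algebra\<^esub>}"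
  then have f: "f = \<zero>\<^bsub>AP_algebra\<^esub>" by (rule singletonD)
  have "\<zero>\<^bsub>AP_algebra\<^esub> \<in> I" if "maximalideal I AP_algebra" for I
    by (rule additive_subgroup.zero_closed[OF ideal.axioms(1)[OF maximalideal.axioms(1)[OF that]]])
  then show "f \<in> \<Inter> {I. maximalideal I AP_algebra}" unfolding f by simp
qed

section \<open>Units and the winding number\<close>

lemma Units_function_algebra:
  "x \<in> Units (AP_algebra\<lparr>carrier := T\<rparr>) \<longleftrightarrow> x \<in> T \<and> (\<exists>h\<in>T. \<forall>t. x t * h t = 1)"
proof -
  have "h t * x t = 1 \<longleftrightarrow> x t * h t = 1" for h :: "real \<Rightarrow> complex" and t by (simp add: mult.commute)
  then show ?thesis unfolding Units_def by (simp add: fun_eq_iff)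
qed

lemma Units_AP: "x \<in> Units AP_algebra \<longleftrightarrow> x \<in> APS UNIV \<and> (\<exists>h\<in>APS UNIV. \<forall>t. x t * h t = 1)"
proof -
  have "AP_algebra\<lparr>carrier := APS UNIV\<rparr> = AP_algebra" by (simp add: AP_algebra_def AP_eq)
  then show ?thesis using Units_function_algebra[of x "APS UNIV"] by (simp only:)
qed

lemma Units_AP_bounded_below:
  assumes "x \<in> Units AP_algebra"
  obtains \<delta> where "x \<in> APS UNIV" "\<delta> > 0" "\<And>t. cmod (x t) \<ge> \<delta>"
proof -
  obtain h where x: "x \<in> APS UNIV" and h: "h \<in> APS UNIV" "\<And>t. x t * h t = 1"
    using assms unfolding Units_AP by blast
  obtain \<delta> where "\<delta> > 0" "\<And>t. cmod (x t) \<ge> \<delta>" using bounded_below_unit[OF h] by blast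
  then show ?thesis by (rule that[OF x])
qed

lemma avg_winding_locally_constant:
  "continuous_map (subtopology (norm_topology AP_algebra) (Units AP_algebra)) (discrete_topology UNIV) avg_winding"
proof -
  interpret M: Metric_space "APS UNIV" "alg_dist AP_algebra" by (rule AP_Metric_space)
  have top: "norm_topology AP_algebra = M.mtopology" unfolding norm_topology_def by simp
  have UA: "Units AP_algebra \<subseteq> APS UNIV" using Units_AP by (intro subsetI) blast
  show ?thesis
    unfolding continuous_map_def top
  proof (intro conjI allI impI)
    fix U :: "real set"
    define V where "V = {x \<in> Units AP_algebra. avg_winding x \<in> U}"
    have "topspace (subtopology M.mtopology (Units AP_algebra)) = Units AP_algebra"
      using UA by auto
    moreover have "openin (subtopology M.mtopology (Units AP_algebra)) V"
    proof (subst openin_subopen, intro ballI)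
      fix x assume x: "x \<in> V"
      then obtain \<delta> where d: "x \<in> APS UNIV" "\<delta> > 0" "\<And>t. cmod (x t) \<ge> \<delta>"
        using Units_AP_bounded_below[of x] unfolding V_def by blast
      \<comment> \<open>The radius is the tolerance of \<open>avg_winding_near\<close>.\<close>
      have "Units AP_algebra \<inter> M.mball x (\<delta> / 3) \<subseteq> V"
      proof
        fix y assume y: "y \<in> Units AP_algebra \<inter> M.mball x (\<delta> / 3)"
        then have yA: "y \<in> APS UNIV" and "alg_dist AP_algebra x y < \<delta> / 3" using UA by auto
        then have n: "Linf_norm (\<lambda>t. x t - y t) < \<delta> / 3" using AP_dist[OF d(1) yA] by simp
        have "cmod (y t - x t) \<le> \<delta> / 3" for t
          using APS_norm_bound[OF APS_diff[OF d(1) yA], of t] n by (simp add: norm_minus_commute)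
        then have "avg_winding y = avg_winding x" by (rule avg_winding_near[OF d yA])
        then show "y \<in> V" using x y unfolding V_def by simp
      qed
      moreover have "openin (subtopology M.mtopology (Units AP_algebra)) (Units AP_algebra \<inter> M.mball x (\<delta> / 3))"
        by (rule openin_subtopology_Int2[OF M.openin_mball])
      moreover have "x \<in> Units AP_algebra \<inter> M.mball x (\<delta> / 3)" using x d unfolding V_def by simp
      ultimately show "\<exists>T. openin (subtopology M.mtopology (Units AP_algebra)) T \<and> x \<in> T \<and> T \<subseteq> V" by blast
    qed
    ultimately show "openin (subtopology M.mtopology (Units AP_algebra))
        {x \<in> topspace (subtopology M.mtopology (Units AP_algebra)). avg_winding x \<in> U}"
      unfolding V_def by simp
  qed simp
qed

lemma Units_AP_plus_iff:
  assumes x: "x \<in> AP_plus" and u: "x \<in> Units AP_algebra"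
  shows "x \<in> Units (AP_algebra\<lparr>carrier := AP_plus\<rparr>) \<longleftrightarrow> avg_winding x = 0"
proof
  assume "x \<in> Units (AP_algebra\<lparr>carrier := AP_plus\<rparr>)"
  then obtain h where "h \<in> APS {0..}" "\<And>t. x t * h t = 1"
    unfolding Units_function_algebra AP_plus_eq by blast
  then show "avg_winding x = 0" using x unfolding AP_plus_eq by (intro winding_zero)
next
  assume w: "avg_winding x = 0"
  obtain h where h: "h \<in> APS UNIV" "\<And>t. x t * h t = 1" using u unfolding Units_AP by blast
  have "h \<in> APS {0..}" using inverse_nonneg_spectrum[OF x[unfolded AP_plus_eq] h w] .
  then show "x \<in> Units (AP_algebra\<lparr>carrier := AP_plus\<rparr>)"
    using x h(2) unfolding Units_function_algebra AP_plus_eq by blast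
qed

theorem lemma5p4:
  fixes R :: "(real \<Rightarrow> complex) set"
  assumes "full_subring R (AP_algebra\<lparr>carrier := AP_plus\<rparr>)"
  shows
    \<comment> \<open>(A1)\<close>
    "domain (AP_algebra\<lparr>carrier := R\<rparr>) \<and>
    \<comment> \<open>(A2)\<close>
     (comm_banach_star_algebra AP_algebra \<and> semisimple AP_algebra \<and> R \<subseteq> carrier AP_algebra) \<and>
    \<comment> \<open>(A3), (I1)-(I3)\<close>
     (\<forall>a\<in>Units AP_algebra. \<forall>b\<in>Units AP_algebra.
        avg_winding (a \<otimes>\<^bsub>AP_algebra\<^esub> b) = avg_winding a + avg_winding b) \<and>
     (\<forall>a\<in>Units AP_algebra. avg_winding (alg_star AP_algebra a) = - avg_winding a) \<and>
     continuous_map (subtopology (norm_topology AP_algebra) (Units AP_algebra))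
       (discrete_topology UNIV) avg_winding \<and>
    \<comment> \<open>(A4)\<close>
     (\<forall>x\<in>R \<inter> Units AP_algebra.
        x \<in> Units (AP_algebra\<lparr>carrier := R\<rparr>) \<longleftrightarrow> avg_winding x = 0)"
proof -
  interpret P: cring "AP_algebra\<lparr>carrier := AP_plus\<rparr>" by (rule cring_AP_plus)
  have sub: "subring R (AP_algebra\<lparr>carrier := AP_plus\<rparr>)"
    and full: "\<And>x. x \<in> R \<Longrightarrow> x \<in> Units (AP_algebra\<lparr>carrier := AP_plus\<rparr>) \<Longrightarrow> x \<in> Units (AP_algebra\<lparr>carrier := R\<rparr>)"
    using assms unfolding full_subring_def by auto
  have RP: "R \<subseteq> AP_plus" using subringE(1)[OF sub] by simp
  have "subdomain R (AP_algebra\<lparr>carrier := AP_plus\<rparr>)"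
  proof (rule P.subdomainI)
    show "subcring R (AP_algebra\<lparr>carrier := AP_plus\<rparr>)"
      by (rule P.subcringI'[OF sub])
    show "\<one>\<^bsub>AP_algebra\<lparr>carrier := AP_plus\<rparr>\<^esub> \<noteq> \<zero>\<^bsub>AP_algebra\<lparr>carrier := AP_plus\<rparr>\<^esub>"
      by (simp add: fun_eq_iff)
    fix f g assume fg: "f \<in> R" "g \<in> R"
      "f \<otimes>\<^bsub>AP_algebra\<lparr>carrier := AP_plus\<rparr>\<^esub> g = \<zero>\<^bsub>AP_algebra\<lparr>carrier := AP_plus\<rparr>\<^esub>"
    have "f t * g t = 0" for t using fun_cong[OF fg(3), of t] by simp
    then show "f = \<zero>\<^bsub>AP_algebra\<lparr>carrier := AP_plus\<rparr>\<^esub> \<or> g = \<zero>\<^bsub>AP_algebra\<lparr>carrier := AP_plus\<rparr>\<^esub>"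
      using APS_nonneg_zero_product[of f g] fg(1,2) RP by (auto simp: AP_plus_eq fun_eq_iff)
  qed
  then have "domain (AP_algebra\<lparr>carrier := R\<rparr>)"
    using P.subdomain_is_domain by fastforce
  moreover have "R \<subseteq> carrier AP_algebra"
    using RP APS_mono[of _ "{0..}" UNIV] by (auto simp: AP_plus_eq)
  moreover have "avg_winding (a \<otimes>\<^bsub>AP_algebra\<^esub> b) = avg_winding a + avg_winding b"
    if a: "a \<in> Units AP_algebra" and b: "b \<in> Units AP_algebra" for a b
  proof -
    obtain \<delta> where d: "a \<in> APS UNIV" "\<delta> > 0" "\<And>t. cmod (a t) \<ge> \<delta>" using Units_AP_bounded_below[OF a] by blast
    obtain \<delta>' where d': "b \<in> APS UNIV" "\<delta>' > 0" "\<And>t. cmod (b t) \<ge> \<delta>'" using Units_AP_bounded_below[OF b] by blast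
    show ?thesis using avg_winding_mult[OF d(1) d'(1) d(2,3) d'(2,3)] by simp
  qed
  moreover have "avg_winding (alg_star AP_algebra a) = - avg_winding a" if a: "a \<in> Units AP_algebra" for a
  proof -
    obtain \<delta> where d: "a \<in> APS UNIV" "\<delta> > 0" "\<And>t. cmod (a t) \<ge> \<delta>" using Units_AP_bounded_below[OF a] by blast
    show ?thesis using avg_winding_cnj[OF d] by simp
  qed
  moreover have "x \<in> Units (AP_algebra\<lparr>carrier := R\<rparr>) \<longleftrightarrow> avg_winding x = 0" if x: "x \<in> R \<inter> Units AP_algebra" for x
  proof -
    \<comment> \<open>An inverse in \<open>R\<close> is one in \<open>AP_plus\<close>, and fullness
      gives the converse, so the criterion for \<open>AP_plus\<close> carries over to
      \<open>R\<close>.\<close>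
    have "x \<in> Units (AP_algebra\<lparr>carrier := R\<rparr>) \<Longrightarrow> x \<in> Units (AP_algebra\<lparr>carrier := AP_plus\<rparr>)"
      using RP unfolding Units_function_algebra by blast
    then show ?thesis using full Units_AP_plus_iff[of x] x RP by blast
  qed
  ultimately show ?thesis
    using comm_banach_star_algebra_AP semisimple_AP avg_winding_locally_constant by blast
qed

end
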